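(* Let $\Gamma\subset\mathrm{PSL}(2,\mathbb R)$ be a discrete cocompact subgroup, let $\phi\in\widetilde M_2(\Gamma;\{i\})$ with $\delta(\phi)=1$, and let $\omega=\phi'-\phi^2$. Let $f_1,\dots,f_d$ be (homogeneous) modular forms in $I$ whose classes form a basis of $I/I^2$. Then there exists $N\in\mathbb N^*$ such that the ring $R$ generated over $\mathbb C$ by the set $$\{D_\phi^j(f_i)\ (0\le j\le N,\ 1\le i\le d)\ ;\ D_\phi^l(\omega)\ (0\le l\le N)\}$$ is closed under the operator $D_\phi$.
   Context: $\mathcal H$ is the upper half plane and $i=\sqrt{-1}\in\mathcal H$ (when not used as an index). $M_k(\Gamma)$ is the space of holomorphic modular forms of weight $k$: holomorphic $f$ on $\mathcal H$ with $f(\frac{az+b}{cz+d})=(cz+d)^kf(z)$ for all $\begin{pmatrix}a&b\\c&d\end{pmatrix}\in\Gamma$; $I=\bigoplus_{k>0}M_k(\Gamma)$ is the ideal of modular forms of positive weight. $M_*(\Gamma;\{i\})=\bigoplus_kM_k(\Gamma;\{i\})$ is the ring of meromorphic modular forms over $\Gamma$ (same transformation law, $f$ meromorphic on $\mathcal H$) without poles outside the $\Gamma$-orbit of $i$. $\widetilde M_2(\Gamma;\{i\})$ is the space of meromorphic quasimodular forms of weight $2$ over $\Gamma$ all of whose poles are in the $\Gamma$-orbit of $i$; the condition $\phi\in\widetilde M_2(\Gamma;\{i\})$, $\delta(\phi)=1$ means that $\phi$ is meromorphic on $\mathcal H$, with all poles in the orbit of $i$, and $\phi(\frac{az+b}{cz+d})=(cz+d)^2\phi(z)+c(cz+d)$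 for all $\begin{pmatrix}a&b\\c&d\end{pmatrix}\in\Gamma$. Then $\omega=\phi'-\phi^2\in M_4(\Gamma;\{i\})$. The derivation $D_\phi:M_k(\Gamma;\{i\})\to M_{k+2}(\Gamma;\{i\})$ is $D_\phi(f)=f'-k\phi f$ for $f$ of weight $k$, extended additively to $M_*(\Gamma;\{i\})$. *)

theory Defs
  imports
    "HOL-Complex_Analysis.Complex_Analysis"
    "HOL-Library.Poly_Mapping"
    "HOL-Algebra.Coset"
begin

section \<open>The group PSL(2,R) and its discrete cocompact subgroups\<close>

definition SL2R :: "(real^2^2) monoid" where
  "SL2R = \<lparr>carrier = {A. det A = 1}, mult = (**), one = mat 1\<rparr>"

definition PSL2R :: "(real^2^2) set monoid" where
  "PSL2R = SL2R Mod {mat 1, - mat 1}"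

definition psl_class :: "real^2^2 \<Rightarrow> (real^2^2) set" where
  "psl_class A = r_coset SL2R {mat 1, - mat 1} A"

lemma group_SL2R: "group SL2R"
proof (rule groupI)
  fix A assume A: "A \<in> carrier SL2R"
  then have inv: "invertible A"
    by (simp add: SL2R_def invertible_det_nz)
  then obtain B where B: "B ** A = mat 1"
    by (auto simp: invertible_def)
  then have "det B * det A = 1"
    by (metis det_I det_mul)
  with A have "B \<in> carrier SL2R"
    by (simp add: SL2R_def)
  with B show "\<exists>B\<in>carrier SL2R. B \<otimes>\<^bsub>SL2R\<^esub> A = \<one>\<^bsub>SL2R\<^esub>"
    by (auto simp: SL2R_def)
qed (auto simp: SL2R_def det_mul matrix_mul_assoc)

lemma det_uminus_2: "det (- A) = det A" for A :: "real^2^2"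
  by (simp add: det_2)

lemma normal_center_SL2R: "{mat 1, - mat 1} \<lhd> SL2R"
proof -
  interpret group SL2R by (rule group_SL2R)
  have neg: "(- mat 1) ** A = - A" "A ** (- mat 1) = - A" for A :: "real^2^2"
    by (simp_all add: vec_eq_iff matrix_matrix_mult_def mat_def forall_2 sum_2)
  have neg_inv: "inv\<^bsub>SL2R\<^esub> (- mat 1) = - mat 1"
    by (rule inv_equality) (auto simp: SL2R_def det_uminus_2 neg)
  have sub: "subgroup {mat 1, - mat 1} SL2R"
  proof
    fix x assume "x \<in> {mat 1, - mat 1 :: real^2^2}"
    moreover have "inv\<^bsub>SL2R\<^esub> (mat 1) = mat 1"
      using inv_one by (simp add: SL2R_def)
    ultimately show "inv\<^bsub>SL2R\<^esub> x \<in> {mat 1, - mat 1}"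
      using neg_inv by auto
  qed (auto simp: SL2R_def det_uminus_2 neg)
  show ?thesis
  proof (rule normalI[OF sub], intro ballI)
    fix A
    show "{mat 1, - mat 1} #>\<^bsub>SL2R\<^esub> A = A <#\<^bsub>SL2R\<^esub> {mat 1, - mat 1}"
      by (auto simp: r_coset_def l_coset_def SL2R_def neg)
  qed
qed

lemma group_PSL2R: "group PSL2R"
  unfolding PSL2R_def by (rule normal.factorgroup_is_group[OF normal_center_SL2R])

lemma psl_class_eq: "psl_class A = {A, - A}"
proof -
  have "(- mat 1) ** A = - A"
    by (simp add: vec_eq_iff matrix_matrix_mult_def mat_def forall_2 sum_2)
  then show ?thesis
    by (auto simp: psl_class_def r_coset_def SL2R_def)
qed

text \<open>The finest topology on the image of \<open>q\<close> that makes \<open>q\<close> continuous.\<close>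

definition quotient_topology :: "'a topology \<Rightarrow> ('a \<Rightarrow> 'b) \<Rightarrow> 'b topology" where
  "quotient_topology X q =
     topology (\<lambda>U. U \<subseteq> q ` topspace X \<and> openin X {x \<in> topspace X. q x \<in> U})"

lemma openin_quotient_topology:
  "openin (quotient_topology X q) U \<longleftrightarrow>
     U \<subseteq> q ` topspace X \<and> openin X {x \<in> topspace X. q x \<in> U}"
proof -
  have "istopology (\<lambda>U. U \<subseteq> q ` topspace X \<and> openin X {x \<in> topspace X. q x \<in> U})"
    unfolding istopology_def
  proof (intro conjI allI impI)
    fix S T
    assume "S \<subseteq> q ` topspace X \<and> openin X {x \<in> topspace X. q x \<in> S}"
      and "T \<subseteq> q ` topspace X \<and> openin X {x \<in> topspace X. q x \<in> T}"
    moreover have "{x \<in> topspace X. q x \<in> S \<inter> T} =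
        {x \<in> topspace X. q x \<in> S} \<inter> {x \<in> topspace X. q x \<in> T}"
      by blast
    ultimately show "S \<inter> T \<subseteq> q ` topspace X"
      and "openin X {x \<in> topspace X. q x \<in> S \<inter> T}"
      by auto
  next
    fix K
    assume K: "\<forall>U\<in>K. U \<subseteq> q ` topspace X \<and> openin X {x \<in> topspace X. q x \<in> U}"
    then show "\<Union>K \<subseteq> q ` topspace X"
      by blast
    have "{x \<in> topspace X. q x \<in> \<Union>K} = (\<Union>U\<in>K. {x \<in> topspace X. q x \<in> U})"
      by blast
    with K show "openin X {x \<in> topspace X. q x \<in> \<Union>K}"
      by (auto intro: openin_Union)
  qed
  then show ?thesis
    by (simp add: quotient_topology_def)
qed

lemma topspace_quotient_topology: "topspace (quotient_topology X q) = q ` topspace X"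
proof
  show "topspace (quotient_topology X q) \<subseteq> q ` topspace X"
    using openin_quotient_topology[of X q "topspace (quotient_topology X q)"] by simp
  have "{x \<in> topspace X. q x \<in> q ` topspace X} = topspace X"
    by blast
  then have "openin (quotient_topology X q) (q ` topspace X)"
    by (simp add: openin_quotient_topology)
  then show "q ` topspace X \<subseteq> topspace (quotient_topology X q)"
    by (rule openin_subset)
qed

lemma quotient_map_quotient_topology: "quotient_map X (quotient_topology X q) q"
  by (auto simp: quotient_map_def openin_quotient_topology topspace_quotient_topology)

definition PSL2R_topology :: "(real^2^2) set topology" where
  "PSL2R_topology = quotient_topology (top_of_set (carrier SL2R)) psl_class"

lemma topspace_PSL2R_topology: "topspace PSL2R_topology = carrier PSL2R"
  by (auto simp: PSL2R_topology_def topspace_quotient_topology PSL2R_def carrier_FactGroup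
      psl_class_def)

definition discrete_subgroup :: "(real^2^2) set set \<Rightarrow> bool" where
  "discrete_subgroup \<Gamma> \<longleftrightarrow>
     subgroup \<Gamma> PSL2R \<and> subtopology PSL2R_topology \<Gamma> = discrete_topology \<Gamma>"

definition cocompact :: "(real^2^2) set set \<Rightarrow> bool" where
  "cocompact \<Gamma> \<longleftrightarrow> compact_space (quotient_topology PSL2R_topology (r_coset PSL2R \<Gamma>))"

definition matrices_of :: "(real^2^2) set set \<Rightarrow> (real^2^2) set" where
  "matrices_of \<Gamma> = {A \<in> carrier SL2R. psl_class A \<in> \<Gamma>}"


section \<open>The ring of meromorphic functions on the upper half plane\<close>

definition uhp :: "complex set" where
  "uhp = {z. Im z > 0}"

lemma open_uhp: "open uhp"
  unfolding uhp_def by (rule open_halfspace_Im_gt)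

text \<open>
  A meromorphic function is represented by its unique normalised version, which has no removable
  singularities, takes the value 0 at its poles, and is 0 outside the upper half plane.
\<close>

typedef mero_uhp =
  "{f :: complex \<Rightarrow> complex. f nicely_meromorphic_on uhp \<and> (\<forall>z. z \<notin> uhp \<longrightarrow> f z = 0)}"
  morphisms eval_mero Abs_mero_uhp
proof
  have "(\<lambda>_. 0) nicely_meromorphic_on uhp"
    by (rule nicely_meromorphic_on_const)
  then show "(\<lambda>_. 0) \<in>
      {f. f nicely_meromorphic_on uhp \<and> (\<forall>z. z \<notin> uhp \<longrightarrow> f z = (0::complex))}"
    by simp
qed

text \<open>\<open>mero_of f\<close> is meaningful only if \<open>f\<close> is meromorphic on the upper half plane.\<close>

definition mero_of :: "(complex \<Rightarrow> complex) \<Rightarrow> mero_uhp" where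
  "mero_of f = Abs_mero_uhp (\<lambda>z. if z \<in> uhp then remove_sings f z else 0)"

lemma eval_mero_nicely: "eval_mero f nicely_meromorphic_on uhp"
  using eval_mero[of f] by simp

lemma eval_mero_meromorphic [meromorphic_intros]: "eval_mero f meromorphic_on uhp"
  using eval_mero_nicely by (simp add: nicely_meromorphic_on_def)

lemma eval_mero_outside: "z \<notin> uhp \<Longrightarrow> eval_mero f z = 0"
  using eval_mero[of f] by simp

lemma eval_mero_of:
  assumes "f meromorphic_on uhp"
  shows   "eval_mero (mero_of f) z = (if z \<in> uhp then remove_sings f z else 0)"
proof -
  let ?g = "\<lambda>z. if z \<in> uhp then remove_sings f z else 0"
  have nice: "remove_sings f nicely_meromorphic_on uhp"
    by (rule remove_sings_nicely_meromorphic[OF assms])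
  have eq: "\<forall>\<^sub>F w in at z. ?g w = remove_sings f w" if "z \<in> uhp" for z
    using eventually_at_in_open'[OF open_uhp that] by eventually_elim simp
  have "?g meromorphic_on uhp \<longleftrightarrow> remove_sings f meromorphic_on uhp"
    by (rule meromorphic_on_cong[OF eq refl])
  moreover have "is_pole ?g z \<longleftrightarrow> is_pole (remove_sings f) z" if "z \<in> uhp" for z
    by (rule is_pole_cong[OF eq[OF that] refl])
  moreover have "?g \<midarrow>z\<rightarrow> c \<longleftrightarrow> remove_sings f \<midarrow>z\<rightarrow> c" if "z \<in> uhp" for z c
    by (rule tendsto_cong[OF eq[OF that]])
  ultimately have "?g nicely_meromorphic_on uhp"
    using nice by (simp add: nicely_meromorphic_on_def)
  then have "eval_mero (mero_of f) = ?g"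
    unfolding mero_of_def by (intro Abs_mero_uhp_inverse) simp
  then show ?thesis
    by simp
qed

lemma eval_mero_of_cosparse:
  assumes "f meromorphic_on uhp"
  shows   "\<forall>\<^sub>\<approx>z\<in>uhp. eval_mero (mero_of f) z = f z"
  using eventually_remove_sings_eq[OF assms] eventually_in_cosparse[OF subset_refl open_uhp]
  by eventually_elim (simp add: eval_mero_of[OF assms])

lemma eval_mero_eqI:
  assumes "\<forall>\<^sub>\<approx>z\<in>uhp. eval_mero f z = eval_mero g z"
  shows   "f = g"
proof -
  have normal: "remove_sings (eval_mero h) z = eval_mero h z" if "z \<in> uhp" for h z
    using eval_mero_nicely[of h] that by (auto simp: nicely_meromorphic_on_def)
  have "eval_mero f z = eval_mero g z" for z
  proof (cases "z \<in> uhp")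
    case True
    have "remove_sings (eval_mero f) z = remove_sings (eval_mero g) z"
      by (rule remove_sings_cong[OF eventually_cosparse_imp_eventually_at[OF assms True] refl])
    with True show ?thesis
      by (simp add: normal)
  qed (simp add: eval_mero_outside)
  then show ?thesis
    by (simp add: eval_mero_inject[symmetric] fun_eq_iff)
qed

definition mero_const :: "complex \<Rightarrow> mero_uhp" where
  "mero_const c = mero_of (\<lambda>_. c)"

definition mero_deriv :: "mero_uhp \<Rightarrow> mero_uhp" where
  "mero_deriv f = mero_of (deriv (eval_mero f))"

instantiation mero_uhp :: comm_ring_1
begin

definition zero_mero_uhp :: mero_uhp where "0 = mero_const 0"
definition one_mero_uhp :: mero_uhp where "1 = mero_const 1"
definition plus_mero_uhp :: "mero_uhp \<Rightarrow> mero_uhp \<Rightarrow> mero_uhp"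
  where "f + g = mero_of (\<lambda>z. eval_mero f z + eval_mero g z)"
definition minus_mero_uhp :: "mero_uhp \<Rightarrow> mero_uhp \<Rightarrow> mero_uhp"
  where "f - g = mero_of (\<lambda>z. eval_mero f z - eval_mero g z)"
definition uminus_mero_uhp :: "mero_uhp \<Rightarrow> mero_uhp"
  where "- f = mero_of (\<lambda>z. - eval_mero f z)"
definition times_mero_uhp :: "mero_uhp \<Rightarrow> mero_uhp \<Rightarrow> mero_uhp"
  where "f * g = mero_of (\<lambda>z. eval_mero f z * eval_mero g z)"

lemma eval_mero_ops_cosparse:
  "\<forall>\<^sub>\<approx>z\<in>uhp. eval_mero 0 z = 0"
  "\<forall>\<^sub>\<approx>z\<in>uhp. eval_mero 1 z = 1"
  "\<forall>\<^sub>\<approx>z\<in>uhp. eval_mero (f + g) z = eval_mero f z + eval_mero g z"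
  "\<forall>\<^sub>\<approx>z\<in>uhp. eval_mero (f - g) z = eval_mero f z - eval_mero g z"
  "\<forall>\<^sub>\<approx>z\<in>uhp. eval_mero (- f) z = - eval_mero f z"
  "\<forall>\<^sub>\<approx>z\<in>uhp. eval_mero (f * g) z = eval_mero f z * eval_mero g z"
  unfolding zero_mero_uhp_def one_mero_uhp_def plus_mero_uhp_def minus_mero_uhp_def
    uminus_mero_uhp_def times_mero_uhp_def mero_const_def
  by (intro eval_mero_of_cosparse meromorphic_intros)+

instance
proof
  fix f g h :: mero_uhp
  note ops = eval_mero_ops_cosparse
  show "f * g * h = f * (g * h)"
    by (rule eval_mero_eqI)
      (use ops(6)[of "f * g" h] ops(6)[of f g] ops(6)[of f "g * h"] ops(6)[of g h]
        in eventually_elim, simp)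
  show "f * g = g * f"
    by (rule eval_mero_eqI) (use ops(6)[of f g] ops(6)[of g f] in eventually_elim, simp)
  show "1 * f = f"
    by (rule eval_mero_eqI) (use ops(6)[of 1 f] ops(2) in eventually_elim, simp)
  show "f + g + h = f + (g + h)"
    by (rule eval_mero_eqI)
      (use ops(3)[of "f + g" h] ops(3)[of f g] ops(3)[of f "g + h"] ops(3)[of g h]
        in eventually_elim, simp)
  show "f + g = g + f"
    by (rule eval_mero_eqI) (use ops(3)[of f g] ops(3)[of g f] in eventually_elim, simp)
  show "0 + f = f"
    by (rule eval_mero_eqI) (use ops(3)[of 0 f] ops(1) in eventually_elim, simp)
  show "- f + f = 0"
    by (rule eval_mero_eqI)
      (use ops(3)[of "- f" f] ops(5)[of f] ops(1) in eventually_elim, simp)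
  show "f - g = f + - g"
    by (rule eval_mero_eqI)
      (use ops(4)[of f g] ops(3)[of f "- g"] ops(5)[of g] in eventually_elim, simp)
  show "(f + g) * h = f * h + g * h"
    by (rule eval_mero_eqI)
      (use ops(6)[of "f + g" h] ops(3)[of f g] ops(3)[of "f * h" "g * h"] ops(6)[of f h]
        ops(6)[of g h] in eventually_elim, simp add: ring_distribs)
  have "eval_mero 0 \<i> = 0" "eval_mero 1 \<i> = 1"
    unfolding zero_mero_uhp_def one_mero_uhp_def mero_const_def
    by (subst eval_mero_of; auto simp: uhp_def intro!: meromorphic_intros)+
  then show "0 \<noteq> (1 :: mero_uhp)"
    by (metis zero_neq_one)
qed

end

lemma eval_mero_deriv_cosparse:
  "\<forall>\<^sub>\<approx>z\<in>uhp. eval_mero (mero_deriv f) z = deriv (eval_mero f) z"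
  unfolding mero_deriv_def by (intro eval_mero_of_cosparse meromorphic_intros open_uhp)

lemma mero_deriv_0: "mero_deriv 0 = 0"
proof -
  have "eval_mero 0 z = 0" for z
    by (cases "z \<in> uhp")
      (auto simp: zero_mero_uhp_def mero_const_def eval_mero_of meromorphic_on_const)
  then have "eval_mero 0 = (\<lambda>_. 0)"
    by auto
  then show ?thesis
    by (simp add: mero_deriv_def zero_mero_uhp_def mero_const_def)
qed

lemma mero_deriv_add: "mero_deriv (f + g) = mero_deriv f + mero_deriv g"
proof (rule eval_mero_eqI)
  have eq: "\<forall>\<^sub>\<approx>z\<in>uhp. deriv (eval_mero (f + g)) z = deriv (eval_mero f) z + deriv (eval_mero g) z"
    unfolding eventually_cosparse_open_eq[OF open_uhp]
  proof
    fix z assume z: "z \<in> uhp"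
    have "\<forall>\<^sub>F w in at z. eval_mero (f + g) w = eval_mero f w + eval_mero g w"
      by (rule eventually_cosparse_imp_eventually_at[OF eval_mero_ops_cosparse(3) z])
    then obtain S where S: "open S" "z \<in> S"
      "\<And>w. w \<in> S - {z} \<Longrightarrow> eval_mero (f + g) w = eval_mero f w + eval_mero g w"
      by (auto simp: eventually_at_topological)
    have "\<forall>\<^sub>F w in at z. w \<in> S - {z}"
      using S by (intro eventually_at_in_open) auto
    then have "\<forall>\<^sub>F w in at z. \<forall>\<^sub>F v in nhds w. eval_mero (f + g) v = eval_mero f v + eval_mero g v"
    proof eventually_elim
      case (elim w)
      then have "\<forall>\<^sub>F v in nhds w. v \<in> S - {z}"
        using S by (intro eventually_nhds_in_open open_delete) auto
      then show ?case
        by eventually_elim (rule S(3))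
    qed
    moreover have "\<forall>\<^sub>F w in at z. h analytic_on {w}" if "h meromorphic_on uhp" for h
      by (rule eventually_cosparse_imp_eventually_at[OF meromorphic_on_imp_analytic_cosparse[OF that] z])
    from this[OF eval_mero_meromorphic[of f]] this[OF eval_mero_meromorphic[of g]]
    have "\<forall>\<^sub>F w in at z. eval_mero f analytic_on {w} \<and> eval_mero g analytic_on {w}"
      by eventually_elim simp
    ultimately show "\<forall>\<^sub>F w in at z.
        deriv (eval_mero (f + g)) w = deriv (eval_mero f) w + deriv (eval_mero g) w"
    proof eventually_elim
      case (elim w)
      have "deriv (eval_mero (f + g)) w = deriv (\<lambda>v. eval_mero f v + eval_mero g v) w"
        by (rule deriv_cong_ev[OF elim(1) refl])
      also have "\<dots> = deriv (eval_mero f) w + deriv (eval_mero g) w"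
        using elim(2) by (intro deriv_add analytic_on_imp_differentiable_at) auto
      finally show ?case .
    qed
  qed
  show "\<forall>\<^sub>\<approx>z\<in>uhp. eval_mero (mero_deriv (f + g)) z = eval_mero (mero_deriv f + mero_deriv g) z"
    using eq eval_mero_deriv_cosparse[of "f + g"] eval_mero_deriv_cosparse[of f]
      eval_mero_deriv_cosparse[of g] eval_mero_ops_cosparse(3)[of "mero_deriv f" "mero_deriv g"]
    by eventually_elim simp
qed


section \<open>Modular forms\<close>

definition moebius :: "real^2^2 \<Rightarrow> complex \<Rightarrow> complex" where
  "moebius A z = (of_real (A$1$1) * z + of_real (A$1$2)) / (of_real (A$2$1) * z + of_real (A$2$2))"

definition automorphy :: "real^2^2 \<Rightarrow> complex \<Rightarrow> complex" where
  "automorphy A z = of_real (A$2$1) * z + of_real (A$2$2)"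

definition orbit :: "(real^2^2) set set \<Rightarrow> complex \<Rightarrow> complex set" where
  "orbit \<Gamma> z = (\<lambda>A. moebius A z) ` matrices_of \<Gamma>"

definition modular_forms :: "(real^2^2) set set \<Rightarrow> int \<Rightarrow> mero_uhp set" where
  "modular_forms \<Gamma> k = {f. eval_mero f holomorphic_on uhp \<and>
     (\<forall>A\<in>matrices_of \<Gamma>. \<forall>z\<in>uhp.
        eval_mero f (moebius A z) = automorphy A z powi k * eval_mero f z)}"

text \<open>
  The meromorphic quasimodular forms \<open>\<phi>\<close> of weight 2 with poles only in the orbit of \<open>\<i>\<close> and with
  \<open>\<delta>(\<phi>) = 1\<close>. The poles are excluded in the transformation law because \<open>eval_mero \<phi>\<close> has the
  value 0 there.
\<close>

definition quasimodular_weight2_delta1 :: "(real^2^2) set set \<Rightarrow> mero_uhp set" where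
  "quasimodular_weight2_delta1 \<Gamma> = {\<phi>.
     (\<forall>z\<in>uhp. is_pole (eval_mero \<phi>) z \<longrightarrow> z \<in> orbit \<Gamma> \<i>) \<and>
     (\<forall>A\<in>matrices_of \<Gamma>. \<forall>z\<in>uhp. \<not> is_pole (eval_mero \<phi>) z \<longrightarrow>
        eval_mero \<phi> (moebius A z) =
          automorphy A z ^ 2 * eval_mero \<phi> z + of_real (A$2$1) * automorphy A z)}"


section \<open>Graded rings of modular forms\<close>

text \<open>
  An element of a direct sum over the weights \<open>k\<close> is a finitely supported family of functions
  indexed by \<open>k\<close>; the multiplication of \<^typ>\<open>int \<Rightarrow>\<^sub>0 mero_uhp\<close> is the convolution product.
\<close>

type_synonym graded = "int \<Rightarrow>\<^sub>0 mero_uhp"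

definition graded_const :: "complex \<Rightarrow> graded" where
  "graded_const c = Poly_Mapping.single 0 (mero_const c)"

definition homogeneous :: "graded \<Rightarrow> bool" where
  "homogeneous F \<longleftrightarrow> (\<exists>k g. F = Poly_Mapping.single k g)"

definition positive_weight_ideal :: "(real^2^2) set set \<Rightarrow> graded set" where
  "positive_weight_ideal \<Gamma> =
     {F. \<forall>k. Poly_Mapping.lookup F k \<in> (if k > 0 then modular_forms \<Gamma> k else {0})}"

definition ideal_square :: "graded set \<Rightarrow> graded set" where
  "ideal_square I = {\<Sum>j<n. G j * H j |(n::nat) G H. \<forall>j<n. G j \<in> I \<and> H j \<in> I}"

text \<open>The classes of \<open>f 1, \<dots>, f d\<close> form a basis of the complex vector space \<open>I / J\<close>.\<close>

definition basis_modulo :: "graded set \<Rightarrow> graded set \<Rightarrow> nat \<Rightarrow> (nat \<Rightarrow> graded) \<Rightarrow> bool" where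
  "basis_modulo I J d f \<longleftrightarrow>
     (\<forall>i\<in>{1..d}. f i \<in> I) \<and>
     (\<forall>c. (\<Sum>i=1..d. graded_const (c i) * f i) \<in> J \<longrightarrow> (\<forall>i\<in>{1..d}. c i = 0)) \<and>
     (\<forall>F\<in>I. \<exists>c. F - (\<Sum>i=1..d. graded_const (c i) * f i) \<in> J)"

definition D :: "mero_uhp \<Rightarrow> graded \<Rightarrow> graded" where
  "D \<phi> F = (\<Sum>k\<in>Poly_Mapping.keys F.
     Poly_Mapping.single (k + 2) 
       (mero_deriv (Poly_Mapping.lookup F k) - of_int k * \<phi> * Poly_Mapping.lookup F k))"

lemma lookup_D:
  "Poly_Mapping.lookup (D \<phi> F) (k + 2) =
     mero_deriv (Poly_Mapping.lookup F k) - of_int k * \<phi> * Poly_Mapping.lookup F k"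
proof (cases "k \<in> Poly_Mapping.keys F")
  case True
  have "Poly_Mapping.lookup (D \<phi> F) (k + 2) = (\<Sum>l\<in>Poly_Mapping.keys F. if l = k then
      mero_deriv (Poly_Mapping.lookup F l) - of_int l * \<phi> * Poly_Mapping.lookup F l else 0)"
    by (auto simp: D_def lookup_sum lookup_single when_def intro!: sum.cong)
  with True show ?thesis
    by simp
next
  case False
  then have "Poly_Mapping.lookup (D \<phi> F) (k + 2) = 0"
    by (auto simp: D_def lookup_sum lookup_single when_def intro!: sum.neutral)
  with False show ?thesis
    by (simp add: in_keys_iff mero_deriv_0)
qed

lemma D_single:
  "D \<phi> (Poly_Mapping.single k g) = Poly_Mapping.single (k + 2) (mero_deriv g - of_int k * \<phi> * g)"
  by (cases "g = 0") (simp_all add: D_def mero_deriv_0)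

lemma D_add: "D \<phi> (F + G) = D \<phi> F + D \<phi> G"
proof (rule poly_mapping_eqI)
  fix k
  show "Poly_Mapping.lookup (D \<phi> (F + G)) k = Poly_Mapping.lookup (D \<phi> F + D \<phi> G) k"
    using lookup_D[of \<phi> "F + G" "k - 2"] lookup_D[of \<phi> F "k - 2"] lookup_D[of \<phi> G "k - 2"]
    by (simp add: lookup_add mero_deriv_add ring_distribs)
qed

definition omega :: "mero_uhp \<Rightarrow> mero_uhp" where
  "omega \<phi> = mero_deriv \<phi> - \<phi>\<^sup>2"

inductive_set generated_algebra :: "graded set \<Rightarrow> graded set" for S where
  const: "graded_const c \<in> generated_algebra S"
| incl: "F \<in> S \<Longrightarrow> F \<in> generated_algebra S"
| add: "F \<in> generated_algebra S \<Longrightarrow> G \<in> generated_algebra S \<Longrightarrow> F + G \<in> generated_algebra S"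
| mult: "F \<in> generated_algebra S \<Longrightarrow> G \<in> generated_algebra S \<Longrightarrow> F * G \<in> generated_algebra S"

end

theory Submission
  imports Defs
begin

text \<open>
  The algebra generated by all the \<open>D\<close>-derivatives of \<open>f 1, \<dots>, f d\<close> and of \<open>\<omega>\<close> is stable under
  \<open>D\<close>. Let \<open>R N\<close> be generated by the derivatives of order at most \<open>N\<close>. If \<open>R (N + 1) = R N\<close>, then
  \<open>D\<close> maps the generators of \<open>R N\<close> into \<open>R N\<close>, and the Leibniz rule does the rest. So the theorem
  says that the chain \<open>R 0 \<subseteq> R 1 \<subseteq> \<dots>\<close> has two equal consecutive members, which is a Noetherian
  property.

  All \<open>R N\<close> lie in one graded ring. Let \<open>forms j\<close> be the space of meromorphic functions of weight
  \<open>2 j\<close> whose pole at each point is at most \<open>j\<close> times the pole of \<open>\<phi>\<close>. Holomorphic forms of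
  positive weight belong to it, \<open>\<omega>\<close> belongs to \<open>forms 2\<close>, and \<open>D\<close> maps \<open>forms j\<close> to \<open>forms (j +
  1)\<close>. It behaves like the ring of sections of the powers of a line bundle on a compact curve; the
  order of vanishing of a section is \<open>rel_ord\<close>. This ring has good properties because \<open>\<omega>\<close> and its
  derivatives have no common zero. Away from the poles of \<open>\<phi>\<close> the operator \<open>D\<close> lowers every
  positive order of vanishing by exactly one, so at a zero of \<open>\<omega>\<close> of order \<open>m\<close> the form \<open>D\<^sup>m \<omega>\<close>
  does not vanish. At a pole of \<open>\<phi>\<close> the function \<open>\<omega> = \<phi>' - \<phi>\<^sup>2\<close> has a pole of exactly twice the
  order, unless the pole of \<open>\<phi>\<close> is simple with residue \<open>-1\<close>. Therefore some combination \<open>G\<close> of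
  powers of derivatives of \<open>\<omega>\<close> has no zero in common with \<open>\<omega>\<close>.

  The exceptional case is excluded by a curvature argument (\<open>exists_pole_residue_not_minus_one\<close>).
  The function \<open>\<psi>(z) = \<phi>(z) + 1 / (z - cnj z)\<close> has weight 2, so \<open>\<psi> dz\<close> is a form on the compact
  quotient, and \<open>\<partial>\<psi>/\<partial>cnj z = - 1 / (4 (Im z)\<^sup>2)\<close> is negative. By the formula of Stokes the
  residues of \<open>\<phi>\<close> have a positive sum over the quotient; they cannot all be \<open>-1\<close>, and there is at
  least one pole. As the poles form a single orbit, every pole is then unexceptional.

  For the chain condition, enumerate the zeros of \<open>\<omega>\<close> in a compact set that meets every orbit,
  with multiplicity and periodically. Each nonzero form has a level: the largest \<open>b\<close> such that it
  vanishes on the first \<open>b\<close> members of this sequence. Multiplication by \<open>\<omega>\<close> raises the level by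
  one period, multiplication by \<open>G\<close> keeps it, and two forms of the same weight and level have a
  linear combination of higher level. Levels are bounded in terms of the weight, since a form that
  vanishes on \<open>n\<close> periods is divisible by \<open>\<omega>\<^sup>n\<close> and there are no forms of negative weight
  (\<open>forms_negative\<close>). So a subspace is determined within a larger one by its levels, and the sets
  of pairs of weight and level that occur in the \<open>R N\<close> cannot increase forever by Dickson's lemma
  (\<open>chain_stabilises\<close>).
\<close>

section \<open>Area integrals in the complex plane\<close>

lemma integrable_compact_support:
  fixes g :: "complex \<Rightarrow> complex"
  assumes "continuous_on UNIV g" "compact X" "\<And>z. z \<notin> X \<Longrightarrow> g z = 0"
  shows "integrable lborel g"
proof -
  have "integrable lborel (\<lambda>x. indicator X x *\<^sub>R g x)"
    by (intro borel_integrable_compact assms continuous_on_subset[OF assms(1)]) auto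
  moreover have "(\<lambda>x. indicator X x *\<^sub>R g x) = g"
    using assms(3) by (auto simp: indicator_def fun_eq_iff)
  ultimately show ?thesis by simp
qed

lemma integral_translate:
  fixes g :: "complex \<Rightarrow> complex"
  assumes "g \<in> borel_measurable borel"
  shows "integral\<^sup>L lborel (\<lambda>z. g (z + w)) = integral\<^sup>L lborel g"
proof -
  have "integral\<^sup>L lborel g = integral\<^sup>L (distr lborel borel ((+) w)) g"
    by (simp add: lborel_distr_plus)
  also have "\<dots> = integral\<^sup>L lborel (\<lambda>z. g (w + z))"
    using assms by (subst integral_distr) auto
  finally show ?thesis by (simp add: add.commute)
qed

text \<open>
  The real derivative of \<open>g\<close> at \<open>z\<close> is \<open>h \<mapsto> a h + b cnj h\<close>; thus \<open>a = \<partial>g/\<partial>z\<close> and \<open>b = \<partial>g/\<partial>cnj z\<close>.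
\<close>

definition wirtinger :: "(complex \<Rightarrow> complex) \<Rightarrow> complex \<Rightarrow> complex \<Rightarrow> complex \<Rightarrow> bool" where
  "wirtinger g a b z \<longleftrightarrow> (g has_derivative (\<lambda>h. a * h + b * cnj h)) (at z)"

text \<open>
  The integral of \<open>z \<mapsto> g (z + t v)\<close> does not depend on \<open>t\<close>. Its derivative at \<open>t = 0\<close> is the
  integral of \<open>a v + b cnj v\<close>, which therefore vanishes for \<open>v = 1\<close> and \<open>v = \<i>\<close>.
\<close>

lemma integral_dbar_compact_support:
  fixes g a b :: "complex \<Rightarrow> complex"
  assumes der: "\<And>z. wirtinger g (a z) (b z) z"
    and cont: "continuous_on UNIV a" "continuous_on UNIV b"
    and X: "compact X" "\<And>z. z \<notin> X \<Longrightarrow> g z = 0"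
  shows "integral\<^sup>L lborel b = 0"
proof -
  have der': "(g has_derivative (\<lambda>h. a z * h + b z * cnj h)) (at z)" for z
    using der by (simp add: wirtinger_def)
  have ab0: "a z = 0 \<and> b z = 0" if "z \<notin> X" for z
  proof -
    have "open (-X)" using X(1) by (simp add: compact_imp_closed open_Compl)
    have "((\<lambda>_. 0) has_derivative (\<lambda>h. a z * h + b z * cnj h)) (at z)"
      by (rule has_derivative_transform_within_open[OF der' \<open>open (-X)\<close>]) (use that X in auto)
    then have eq: "(\<lambda>h. a z * h + b z * cnj h) = (\<lambda>_. 0)"
      using has_derivative_unique has_derivative_const by blast
    from fun_cong[OF eq, of 1] fun_cong[OF eq, of \<i>]
    have "a z + b z = 0" "a z - b z = 0"
      by (auto simp: algebra_simps)
    then show ?thesis by (simp add: complex_eq_iff)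
  qed
  have "compact (a ` X)" "compact (b ` X)"
    using cont X by (auto intro!: compact_continuous_image intro: continuous_on_subset)
  then have "bounded (a ` X)" "bounded (b ` X)" by (auto intro: compact_imp_bounded)
  then obtain Ma Mb where "\<forall>x\<in>a ` X. norm x \<le> Ma" "\<forall>x\<in>b ` X. norm x \<le> Mb"
    unfolding bounded_iff by blast
  then have M: "\<And>z. z \<in> X \<Longrightarrow> norm (a z) \<le> Ma" "\<And>z. z \<in> X \<Longrightarrow> norm (b z) \<le> Mb"
    by auto
  define M where "M = max 0 Ma + max 0 Mb"
  have Mab: "norm (a z) + norm (b z) \<le> M" for z
    using M[of z] ab0[of z] by (cases "z \<in> X") (auto simp: M_def)
  \<comment> \<open>The difference quotients are dominated by the Lipschitz constant on a large disc.\<close>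
  have lip: "norm (g x - g y) \<le> M * norm (x - y)" for x y
  proof (rule differentiable_bound[OF convex_UNIV])
    show "(g has_derivative (\<lambda>h. a x * h + b x * cnj h)) (at x within UNIV)" for x
      using der' by simp
    show "onorm (\<lambda>h. a x * h + b x * cnj h) \<le> M" for x
    proof (rule onorm_le)
      fix h
      have "norm (a x * h + b x * cnj h) \<le> (norm (a x) + norm (b x)) * norm h"
        by (metis (no_types, opaque_lifting) complex_mod_cnj distrib_right norm_mult norm_triangle_ineq)
      also have "\<dots> \<le> M * norm h" by (intro mult_right_mono Mab) auto
      finally show "norm (a x * h + b x * cnj h) \<le> M * norm h" .
    qed
  qed auto
  have gc: "continuous_on UNIV g"
    using der' has_derivative_continuous continuous_at_imp_continuous_on by blast
  then have gm: "g \<in> borel_measurable borel" by (rule borel_measurable_continuous_onI)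
  have gi: "integrable lborel g" by (rule integrable_compact_support[OF gc X])
  have ai: "integrable lborel a" "integrable lborel b"
    using integrable_compact_support cont X ab0 by blast+
  obtain R0 where R0: "\<And>z. z \<in> X \<Longrightarrow> norm z \<le> R0"
    using X(1) by (meson bounded_iff compact_imp_bounded)
  have L: "integral\<^sup>L lborel (\<lambda>z. a z * v + b z * cnj v) = 0" if v: "norm v = 1" for v
  proof -
    define s where "s = (\<lambda>n z. of_nat (Suc n) * (g (z + v / of_nat (Suc n)) - g z))"
    have gti: "integrable lborel (\<lambda>z. g (z + w))" for w
    proof (rule integrable_compact_support[where X="(\<lambda>z. z - w) ` X"])
      show "continuous_on UNIV (\<lambda>z. g (z + w))"
        by (intro continuous_on_compose2[OF gc] continuous_intros) auto
      show "compact ((\<lambda>z. z - w) ` X)"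
        using compact_translation_subtract X(1) by blast
      show "\<And>z. z \<notin> (\<lambda>z. z - w) ` X \<Longrightarrow> g (z + w) = 0"
        using X(2) by (metis (no_types, lifting) add_diff_cancel_right' image_iff)
    qed
    have s0: "integral\<^sup>L lborel (s n) = 0" for n
      unfolding s_def using gti gi integral_translate[OF gm]
      by (simp add: Bochner_Integration.integral_diff)
    have "(\<lambda>n. integral\<^sup>L lborel (s n)) \<longlonglongrightarrow> integral\<^sup>L lborel (\<lambda>z. a z * v + b z * cnj v)"
    proof (rule integral_dominated_convergence[where w="\<lambda>z. M * indicator (cball 0 (R0+1)) z"])
      show "(\<lambda>z. a z * v + b z * cnj v) \<in> borel_measurable lborel"
        using ai by measurable
      show "s n \<in> borel_measurable lborel" for n
        unfolding s_def using gti gi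
          by (intro borel_measurable_integrable Bochner_Integration.integrable_mult_right
            Bochner_Integration.integrable_diff)
      show "integrable lborel (\<lambda>z. M * indicator (cball 0 (R0+1)) z :: real)"
        by (intro Bochner_Integration.integrable_mult_right)
          (auto intro!: integrable_real_indicator emeasure_bounded_finite)
      show "AE z in lborel. (\<lambda>n. s n z) \<longlonglongrightarrow> a z * v + b z * cnj v"
      proof (rule AE_I2)
        fix z
        let ?h = "\<lambda>n. v / of_nat (Suc n)"
        let ?L = "\<lambda>h. a z * h + b z * cnj h"
        have lim: "((\<lambda>h. norm (g (z + h) - g z - ?L h) / norm h) \<longlongrightarrow> 0) (at 0)"
          using der'[of z] by (simp add: has_derivative_at)
        have h0: "?h \<longlonglongrightarrow> 0"
          using tendsto_mult[OF tendsto_const[of v] LIMSEQ_Suc[OF lim_1_over_n[where 'a=complex]]]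
          by (simp del: of_nat_Suc)
        have "filterlim ?h (at 0) sequentially"
          unfolding filterlim_at using h0 v by (auto simp del: of_nat_Suc)
        from filterlim_compose[OF lim this]
        have "(\<lambda>n. norm (g (z + ?h n) - g z - ?L (?h n)) / norm (?h n)) \<longlonglongrightarrow> 0" .
        moreover have "norm (g (z + ?h n) - g z - ?L (?h n)) / norm (?h n) = norm (s n z - ?L v)" for n
        proof -
          have "s n z - ?L v = of_nat (Suc n) * (g (z + ?h n) - g z - ?L (?h n))"
            unfolding s_def by (simp add: field_simps del: of_nat_Suc)
          then have "norm (s n z - ?L v) = real (Suc n) * norm (g (z + ?h n) - g z - ?L (?h n))"
            by (simp only: norm_mult norm_of_nat)
          then show ?thesis using v by (simp add: norm_divide del: of_nat_Suc)
        qed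
        ultimately have "(\<lambda>n. norm (s n z - ?L v)) \<longlonglongrightarrow> 0" by simp
        then show "(\<lambda>n. s n z) \<longlonglongrightarrow> ?L v"
          by (rule Lim_null[THEN iffD2, OF tendsto_norm_zero_cancel])
      qed
      show "AE z in lborel. norm (s n z) \<le> M * indicator (cball 0 (R0+1)) z" for n
      proof (rule AE_I2)
        fix z
        have nv: "norm (v / of_nat (Suc n)) = 1 / real (Suc n)"
          using v by (simp add: norm_divide del: of_nat_Suc)
        show "norm (s n z) \<le> M * indicator (cball 0 (R0+1)) z"
        proof (cases "z \<in> cball 0 (R0+1)")
          case True
          have "norm (s n z) = real (Suc n) * norm (g (z + v / of_nat (Suc n)) - g z)"
            by (simp add: s_def norm_mult del: of_nat_Suc)
          also have "\<dots> \<le> real (Suc n) * (M * (1 / real (Suc n)))"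
            using lip[of "z + v / of_nat (Suc n)" z] nv
              by (intro mult_left_mono) (simp_all del: of_nat_Suc)
          finally show ?thesis using True by (simp del: of_nat_Suc)
        next
          case False
          have "norm z \<le> norm (z + v / of_nat (Suc n)) + 1"
          proof -
            have "norm z \<le> norm (z + v / of_nat (Suc n)) + norm (v / of_nat (Suc n) :: complex)"
              by (metis add_diff_cancel norm_triangle_ineq4)
            also have "norm (v / of_nat (Suc n) :: complex) \<le> 1" unfolding nv by simp
            finally show ?thesis by simp
          qed
          then have "z \<notin> X" "z + v / of_nat (Suc n) \<notin> X" using False R0 by force+
          then show ?thesis using False X(2) by (simp add: s_def)
        qed
      qed
    qed
    then show ?thesis using s0 by (simp add: LIMSEQ_const_iff)
  qed
  have "integral\<^sup>L lborel a + integral\<^sup>L lborel b = 0"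
    using L[of 1] ai by simp
  moreover have "\<i> * (integral\<^sup>L lborel a - integral\<^sup>L lborel b) = 0"
    using L[of \<i>] ai by (simp add: algebra_simps)
  ultimately show ?thesis by (simp add: complex_eq_iff)
qed

definition vec2_of_complex :: "complex \<Rightarrow> real^2" where "vec2_of_complex z = vector [Re z, Im z]"
definition complex_of_vec2 :: "real^2 \<Rightarrow> complex" where "complex_of_vec2 x = Complex (x$1) (x$2)"

lemma complex_of_vec2_of_complex [simp]: "complex_of_vec2 (vec2_of_complex z) = z" and
    vec2_of_complex_of_vec2 [simp]: "vec2_of_complex (complex_of_vec2 x) = x"
  by (simp_all add: complex_of_vec2_def vec2_of_complex_def vec_eq_iff forall_2)

lemma bounded_linear_vec2_of_complex: "bounded_linear vec2_of_complex"
  unfolding linear_conv_bounded_linear[symmetric]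
  by (rule linearI) (simp_all add: vec2_of_complex_def vec_eq_iff forall_2)

lemma bounded_linear_complex_of_vec2: "bounded_linear complex_of_vec2"
  unfolding linear_conv_bounded_linear[symmetric]
  by (rule linearI) (simp_all add: complex_of_vec2_def complex_eq_iff)

text \<open>
  The isometry with \<open>\<real>\<^sup>2\<close> preserves area, so that substitutions can be carried out in \<open>\<real>\<^sup>2\<close>.
\<close>

lemma lborel_vec2_of_complex: "distr lborel borel vec2_of_complex = lborel"
proof (rule sym, rule lborel_eqI)
  fix l u :: "real^2" assume le: "\<And>b. b \<in> Basis \<Longrightarrow> l \<bullet> b \<le> u \<bullet> b"
  have le': "l $ 1 \<le> u $ 1" "l $ 2 \<le> u $ 2"
    using le[of "axis 1 1"] le[of "axis 2 1"] by (auto simp: inner_axis Basis_vec_def)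
  have [measurable]: "vec2_of_complex \<in> borel_measurable borel"
    by (intro borel_measurable_continuous_onI
      bounded_linear.continuous_on[OF bounded_linear_vec2_of_complex] continuous_intros)
  have "vec2_of_complex -` box l u = box (complex_of_vec2 l) (complex_of_vec2 u)"
    by (auto simp: vec2_of_complex_def complex_of_vec2_def box_def Basis_vec_def Basis_complex_def
      inner_axis exhaust_2 forall_2)
  then have "emeasure (distr lborel borel vec2_of_complex) (box l u)
      = emeasure lborel (box (complex_of_vec2 l) (complex_of_vec2 u))"
    by (subst emeasure_distr) auto
  also have "\<dots> = ennreal (prod ((\<bullet>) (complex_of_vec2 u - complex_of_vec2 l)) Basis)"
    by (rule emeasure_lborel_box) (use le' in \<open>auto simp: Basis_complex_def complex_of_vec2_def\<close>)
  also have "prod ((\<bullet>) (complex_of_vec2 u - complex_of_vec2 l)) Basis = (u$1 - l$1) * (u$2 - l$2)"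
    by (simp add: Basis_complex_def complex_of_vec2_def)
  also have "\<dots> = prod ((\<bullet>) (u - l)) Basis"
  proof -
    have B: "(Basis :: (real^2) set) = {axis 1 1, axis 2 1}"
      by (auto simp: Basis_vec_def exhaust_2) (metis exhaust_2)+
    have ne: "axis 1 (1::real) \<noteq> (axis 2 1 :: real^2)" by (simp add: axis_eq_axis)
    show ?thesis unfolding B using ne by (simp add: inner_axis)
  qed
  finally show "emeasure (distr lborel borel vec2_of_complex) (box l u)
      = ennreal (prod ((\<bullet>) (u - l)) Basis)" .
qed auto

text \<open>
  The real Jacobian determinant of a holomorphic function is the square of the modulus of its
  derivative.
\<close>

lemma integral_holomorphic_substitution:
  fixes g h h' :: "complex \<Rightarrow> complex"
  assumes X: "open X" and der: "\<And>z. z \<in> X \<Longrightarrow> (h has_field_derivative h' z) (at z)"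
    and inj: "inj_on h X" and g: "integrable lborel g" "\<And>z. z \<notin> h ` X \<Longrightarrow> g z = 0"
  shows "integral\<^sup>L lborel g = integral\<^sup>L lborel (\<lambda>w. if w \<in> X then of_real ((norm (h' w))\<^sup>2) * g (h w)
      else 0)"
    (is "_ = integral\<^sup>L lborel ?G")
proof -
  define f where "f = (\<lambda>x. vec2_of_complex (g (complex_of_vec2 x)))"
  define H where "H = (\<lambda>x. vec2_of_complex (h (complex_of_vec2 x)))"
  define H' where "H' = (\<lambda>x v. vec2_of_complex (h' (complex_of_vec2 x) * complex_of_vec2 v))"
  let ?S = "complex_of_vec2 -` X"
  have meas [measurable]: "vec2_of_complex \<in> borel_measurable borel"
      "complex_of_vec2 \<in> borel_measurable borel"
    by (intro borel_measurable_continuous_onI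
      bounded_linear.continuous_on[OF bounded_linear_vec2_of_complex]
        bounded_linear.continuous_on[OF bounded_linear_complex_of_vec2] continuous_intros)+
  have opS: "open ?S"
    by (intro open_vimage X bounded_linear.continuous_on[OF bounded_linear_complex_of_vec2]
      continuous_intros)
  have derH: "(H has_derivative H' x) (at x within ?S)" if "x \<in> ?S" for x
  proof -
    have "((\<lambda>x. h (complex_of_vec2 x)) has_derivative (\<lambda>v. h' (complex_of_vec2 x) * complex_of_vec2 v))
        (at x)"
      by (rule has_derivative_compose[OF bounded_linear.has_derivative[OF bounded_linear_complex_of_vec2
        has_derivative_ident]])
         (use der[of "complex_of_vec2 x"] that in \<open>auto simp: has_field_derivative_def\<close>)
    from bounded_linear.has_derivative[OF bounded_linear_vec2_of_complex this]
    show ?thesis unfolding H_def H'_def by (rule has_derivative_at_withinI)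
  qed
  have detH: "\<bar>det (matrix (H' x))\<bar> = (norm (h' (complex_of_vec2 x)))\<^sup>2" for x
    unfolding cmod_power2
      by (simp add: H'_def det_2 matrix_def vec2_of_complex_def complex_of_vec2_def axis_def
        power2_eq_square)
  have injH: "inj_on H ?S"
    using inj
      by (auto simp: inj_on_def H_def) (metis complex_of_vec2_of_complex vec2_of_complex_of_vec2)
  have img: "H ` ?S = complex_of_vec2 -` (h ` X)"
  proof safe
    fix x y assume "complex_of_vec2 x = h y" "y \<in> X"
    then have "x = H (vec2_of_complex y)" "vec2_of_complex y \<in> ?S"
      by (simp_all add: H_def) (metis vec2_of_complex_of_vec2)
    then show "x \<in> H ` ?S" by blast
  qed (auto simp: H_def)
  have fi: "integrable lborel f"
  proof -
    have "integrable (distr lborel borel vec2_of_complex) f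
        \<longleftrightarrow> integrable lborel (\<lambda>z. f (vec2_of_complex z))"
      by (rule integrable_distr_eq) (use g in \<open>auto simp: f_def\<close>)
    moreover have "integrable lborel (\<lambda>z. f (vec2_of_complex z))"
      unfolding f_def complex_of_vec2_of_complex
        by (rule integrable_bounded_linear[OF bounded_linear_vec2_of_complex g(1)])
    ultimately show ?thesis by (simp add: lborel_vec2_of_complex)
  qed
  have intf: "integral\<^sup>L lborel f = vec2_of_complex (integral\<^sup>L lborel g)"
  proof -
    have "integral\<^sup>L (distr lborel borel vec2_of_complex) f
        = integral\<^sup>L lborel (\<lambda>z. f (vec2_of_complex z))"
      by (rule integral_distr) (use fi in auto)
    also have "\<dots> = vec2_of_complex (integral\<^sup>L lborel g)"
      unfolding f_def complex_of_vec2_of_complex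
        by (rule integral_bounded_linear[OF bounded_linear_vec2_of_complex g(1)])
    finally show ?thesis by (simp add: lborel_vec2_of_complex)
  qed
  have f0: "f x = 0" if "x \<notin> H ` ?S" for x
    using that g(2) unfolding img by (auto simp: f_def vec2_of_complex_def vec_eq_iff forall_2)
  have fabs: "f absolutely_integrable_on UNIV"
    using fi by (simp add: set_integrable_def integrable_completion)
  have rU: "(\<lambda>x. if x \<in> H ` ?S then f x else 0) = f" using f0 by auto
  have fS: "f absolutely_integrable_on (H ` ?S)"
    using fabs absolutely_integrable_restrict_UNIV[of "H ` ?S" f] rU by simp
  have iS: "integral (H ` ?S) f = vec2_of_complex (integral\<^sup>L lborel g)"
  proof -
    have "integral (H ` ?S) f = integral UNIV f"
      using integral_restrict_UNIV[of "H ` ?S" f] rU by simp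
    also have "\<dots> = integral\<^sup>L lborel f" using fi by (simp add: integral_lborel)
    finally show ?thesis using intf by simp
  qed
  have Smeas: "?S \<in> sets lebesgue" using opS by auto
  have main: "(\<lambda>x. \<bar>det (matrix (H' x))\<bar> *\<^sub>R f (H x)) absolutely_integrable_on ?S \<and>
      integral ?S (\<lambda>x. \<bar>det (matrix (H' x))\<bar> *\<^sub>R f (H x)) = vec2_of_complex (integral\<^sup>L lborel g)"
    using has_absolute_integral_change_of_variables[OF Smeas derH injH, of f] fS iS by blast
  define G where "G = (\<lambda>x. vec2_of_complex (?G (complex_of_vec2 x)))"
  have Geq: "(\<lambda>x. if x \<in> ?S then \<bar>det (matrix (H' x))\<bar> *\<^sub>R f (H x) else 0) = G"
  proof
    fix x
    have scale: "vec2_of_complex (of_real r * w) = r *\<^sub>R vec2_of_complex w" for r w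
      by (simp add: vec2_of_complex_def vec_eq_iff forall_2)
    have "vec2_of_complex 0 = 0" by (simp add: vec2_of_complex_def vec_eq_iff forall_2)
    then show "(if x \<in> ?S then \<bar>det (matrix (H' x))\<bar> *\<^sub>R f (H x) else 0) = G x"
      by (cases "x \<in> ?S") (simp_all only: G_def f_def H_def detH complex_of_vec2_of_complex scale
        vimage_eq if_True if_False)
  qed
  have Gabs: "G absolutely_integrable_on UNIV" "integral UNIV G = vec2_of_complex (integral\<^sup>L lborel g)"
    using main absolutely_integrable_restrict_UNIV[of ?S "\<lambda>x. \<bar>det (matrix (H' x))\<bar> *\<^sub>R f (H x)"]
      integral_restrict_UNIV[of ?S "\<lambda>x. \<bar>det (matrix (H' x))\<bar> *\<^sub>R f (H x)"] unfolding Geq by auto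
  have hc: "continuous_on X h" using der
    by (meson DERIV_isCont continuous_at_imp_continuous_on)
  have dh: "h' z = deriv h z" if "z \<in> X" for z using der[OF that] by (simp add: DERIV_imp_deriv)
  have holo: "h holomorphic_on X" using der X by (auto simp: holomorphic_on_open)
  have Gm: "?G \<in> borel_measurable borel"
  proof -
    have "(\<lambda>w. if w \<in> X then of_real ((norm (deriv h w))\<^sup>2) * g (h w) else 0) \<in> borel_measurable borel"
    proof -
      have [measurable]: "(\<lambda>w. if w \<in> X then h w else 0) \<in> borel_measurable borel"
        using borel_measurable_continuous_on_if[of X h "\<lambda>_. 0"] hc X by auto
      have [measurable]: "(\<lambda>w. if w \<in> X then deriv h w else 0) \<in> borel_measurable borel"
        using borel_measurable_continuous_on_if[of X "deriv h" "\<lambda>_. 0"] X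
          holomorphic_on_imp_continuous_on[OF holomorphic_deriv[OF holo X]] by auto
      have [measurable]: "X \<in> sets borel" "g \<in> borel_measurable borel" using X g by auto
      have "(\<lambda>w. if w \<in> X then of_real ((norm (if w \<in> X then deriv h w else 0))\<^sup>2) * g (if w \<in> X then h
          w else 0) else 0) \<in> borel_measurable borel"
        by measurable
      then show ?thesis by (rule measurable_cong[THEN iffD1, rotated]) auto
    qed
    then show ?thesis by (rule measurable_cong[THEN iffD1, rotated]) (auto simp: dh)
  qed
  have Gm': "G \<in> borel_measurable lborel" unfolding G_def using Gm by measurable
  have Gi: "integrable lborel G"
    using Gabs(1) Gm' by (simp add: set_integrable_def integrable_completion)
  have "vec2_of_complex (integral\<^sup>L lborel g) = integral\<^sup>L lborel G"
    using Gabs(2) Gi by (simp add: integral_lborel)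
  also have "\<dots> = integral\<^sup>L (distr lborel borel vec2_of_complex) G"
    by (simp add: lborel_vec2_of_complex)
  also have "\<dots> = integral\<^sup>L lborel (\<lambda>z. G (vec2_of_complex z))"
    by (rule integral_distr) (use Gm' in auto)
  also have "\<dots> = vec2_of_complex (integral\<^sup>L lborel ?G)"
  proof -
    have "integrable (distr lborel borel vec2_of_complex) G
        \<longleftrightarrow> integrable lborel (\<lambda>z. G (vec2_of_complex z))"
      by (rule integrable_distr_eq) (use Gm' in auto)
    then have "integrable lborel (\<lambda>z. G (vec2_of_complex z))" using Gi
      by (simp add: lborel_vec2_of_complex)
    then have "integrable lborel (\<lambda>z. vec2_of_complex (?G z))"
      by (simp only: G_def complex_of_vec2_of_complex)
    from integrable_bounded_linear[OF bounded_linear_complex_of_vec2 this] have "integrable lborel ?G"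
      by simp
    then show ?thesis
      unfolding G_def complex_of_vec2_of_complex
        by (rule integral_bounded_linear[OF bounded_linear_vec2_of_complex])
  qed
  finally show ?thesis by (metis complex_of_vec2_of_complex)
qed

section \<open>The action on the upper half plane\<close>

no_notation fps_nth (infixl "$" 75)

lemma uhp_iff: "z \<in> uhp \<longleftrightarrow> Im z > 0" by (simp add: uhp_def)

lemma automorphy_nonzero:
  assumes "det A = 1" "z \<in> uhp" shows "automorphy A z \<noteq> 0"
proof
  assume "automorphy A z = 0"
  then have "A$2$1 * Im z = 0" "A$2$1 * Re z + A$2$2 = 0"
    by (auto simp: automorphy_def complex_eq_iff)
  with assms show False by (auto simp: uhp_def det_2)
qed

lemma Im_moebius:
  assumes "det A = 1" "z \<in> uhp" shows "Im (moebius A z) = Im z / (norm (automorphy A z))\<^sup>2"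
proof -
  let ?n = "of_real (A$1$1) * z + of_real (A$1$2)" and ?d = "automorphy A z"
  have "moebius A z = ?n * cnj ?d / of_real ((norm ?d)\<^sup>2)"
    unfolding moebius_def automorphy_def by (rule complex_div_cnj)
  also have "Im \<dots> = Im (?n * cnj ?d) / (norm ?d)\<^sup>2"
    by (rule Im_divide_of_real)
  also have "Im (?n * cnj ?d) = (A$1$1 * A$2$2 - A$1$2 * A$2$1) * Im z"
    by (simp add: automorphy_def algebra_simps)
  finally show ?thesis using assms by (simp add: det_2)
qed

lemma moebius_in_uhp: "det A = 1 \<Longrightarrow> z \<in> uhp \<Longrightarrow> moebius A z \<in> uhp"
  using Im_moebius[of A z] automorphy_nonzero[of A z] by (simp add: uhp_def)

lemma moebius_eq: "moebius A z = (of_real (A$1$1) * z + of_real (A$1$2)) / automorphy A z"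
  by (simp add: moebius_def automorphy_def)

lemma automorphy_mult:
  assumes "det B = 1" "z \<in> uhp"
  shows "automorphy (A ** B) z = automorphy A (moebius B z) * automorphy B z"
proof -
  have "automorphy A (moebius B z) * automorphy B z =
      of_real (A$2$1) * (moebius B z * automorphy B z) + of_real (A$2$2) * automorphy B z"
    by (simp only: automorphy_def[of A] distrib_right mult.assoc)
  also have "moebius B z * automorphy B z = of_real (B$1$1) * z + of_real (B$1$2)"
    using automorphy_nonzero[OF assms] by (simp add: moebius_eq)
  finally show ?thesis
    by (simp add: automorphy_def matrix_matrix_mult_def sum_2 algebra_simps)
qed

lemma moebius_mult:
  assumes "det A = 1" "det B = 1" "z \<in> uhp"
  shows "moebius (A ** B) z = moebius A (moebius B z)"
proof -
  have n: "automorphy B z \<noteq> 0" by (rule automorphy_nonzero) fact+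
  have "(of_real (A$1$1) * moebius B z + of_real (A$1$2)) * automorphy B z =
      of_real (A$1$1) * (moebius B z * automorphy B z) + of_real (A$1$2) * automorphy B z"
    by (simp only: distrib_right mult.assoc)
  also have "moebius B z * automorphy B z = of_real (B$1$1) * z + of_real (B$1$2)"
    using n by (simp add: moebius_eq)
  finally have H: "of_real ((A ** B)$1$1) * z + of_real ((A ** B)$1$2) =
     (of_real (A$1$1) * moebius B z + of_real (A$1$2)) * automorphy B z"
    by (simp add: automorphy_def matrix_matrix_mult_def sum_2 algebra_simps)
  show ?thesis
    unfolding moebius_eq[of "A ** B"] moebius_eq[of A "moebius B z"] H automorphy_mult[OF assms(2,3)]
    using n by (rule mult_divide_mult_cancel_right)
qed

lemma moebius_mat_1 [simp]: "moebius (mat 1) z = z"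
  and automorphy_mat_1 [simp]: "automorphy (mat 1) z = 1"
  by (simp_all add: moebius_def automorphy_def mat_def)

lemma moebius_uminus [simp]: "moebius (- A) z = moebius A z"
proof -
  have "of_real ((- A)$1$1) * z + of_real ((- A)$1$2) = - (of_real (A$1$1) * z + of_real (A$1$2))"
    "of_real ((- A)$2$1) * z + of_real ((- A)$2$2) = - (of_real (A$2$1) * z + of_real (A$2$2))"
    by simp_all
  then show ?thesis unfolding moebius_def by (simp only: minus_divide_divide)
qed

lemma automorphy_uminus [simp]: "automorphy (- A) z = - automorphy A z"
  by (simp add: automorphy_def)

lemma has_field_derivative_automorphy [derivative_intros]:
  "((\<lambda>z. automorphy A z) has_field_derivative of_real (A$2$1)) (at z)"
  unfolding automorphy_def by (auto intro!: derivative_eq_intros)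

lemma has_field_derivative_moebius:
  assumes "det A = 1" "z \<in> uhp"
  shows "(moebius A has_field_derivative 1 / (automorphy A z)\<^sup>2) (at z)"
proof -
  have "((\<lambda>z. (of_real (A$1$1) * z + of_real (A$1$2)) / automorphy A z) has_field_derivative
     (of_real (A$1$1) * automorphy A z - (of_real (A$1$1) * z + of_real (A$1$2)) * of_real (A$2$1)) /
       (automorphy A z * automorphy A z)) (at z)"
    by (rule derivative_eq_intros refl automorphy_nonzero assms | simp)+
  moreover have
      "of_real (A$1$1) * automorphy A z - (of_real (A$1$1) * z + of_real (A$1$2)) * of_real (A$2$1)
      = (of_real (det A) :: complex)"
    by (simp add: automorphy_def det_2 algebra_simps)
  ultimately show ?thesis using assms
    by (simp add: moebius_eq[abs_def] power2_eq_square)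
qed

lemma moebius_diff:
  assumes "det A = 1" "z \<in> uhp" "w \<in> uhp"
  shows "moebius A z - moebius A w = (z - w) / (automorphy A z * automorphy A w)"
proof -
  have n: "automorphy A z \<noteq> 0" "automorphy A w \<noteq> 0" using automorphy_nonzero assms by auto
  have "moebius A z - moebius A w =
     ((of_real (A$1$1) * z + of_real (A$1$2)) * automorphy A w - (of_real (A$1$1) * w + of_real (A$1$2))
         * automorphy A z)
       / (automorphy A z * automorphy A w)"
    using n by (simp add: moebius_eq diff_frac_eq)
  also have
      "(of_real (A$1$1) * z + of_real (A$1$2)) * automorphy A w - (of_real (A$1$1) * w + of_real
          (A$1$2)) * automorphy A z
     = of_real (det A) * (z - w)"
    by (simp add: automorphy_def det_2 algebra_simps)
  finally show ?thesis using assms by simp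
qed

text \<open>
  The inverse of a matrix of determinant 1, without a case distinction.
\<close>

definition adjugate2 :: "real^2^2 \<Rightarrow> real^2^2" where
  "adjugate2 A = (\<chi> i j. if i = 1 then (if j = 1 then A$2$2 else - (A$1$2)) else (if j
      = 1 then - (A$2$1) else A$1$1))"

lemma adjugate2_nth [simp]: "adjugate2 A $ 1 $ 1 = A$2$2" "adjugate2 A $ 1 $ 2 = - (A$1$2)"
   "adjugate2 A $ 2 $ 1 = - (A$2$1)" "adjugate2 A $ 2 $ 2 = A$1$1"
  by (simp_all add: adjugate2_def)

lemma det_adjugate2 [simp]: "det (adjugate2 A) = det A"
  by (simp add: det_2)

lemma adjugate2_mult:
  assumes "det A = 1"
  shows "adjugate2 A ** A = mat 1" "A ** adjugate2 A = mat 1"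
  using assms
    by (simp_all add: vec_eq_iff forall_2 matrix_matrix_mult_def sum_2 mat_def det_2 mult.commute)

lemma adjugate2_adjugate2 [simp]: "adjugate2 (adjugate2 A) = A"
  by (simp add: vec_eq_iff forall_2)

lemma moebius_adjugate2:
  assumes "det A = 1" "z \<in> uhp"
  shows "moebius (adjugate2 A) (moebius A z) = z" "moebius A (moebius (adjugate2 A) z) = z"
  using moebius_mult[of "adjugate2 A" A z] moebius_mult[of A "adjugate2 A" z] assms adjugate2_mult[of A]
    by auto

lemma psl_class_mult:
  assumes "det A = 1" "det B = 1"
  shows "psl_class A \<otimes>\<^bsub>PSL2R\<^esub> psl_class B = psl_class (A ** B)"
  using normal.rcos_sum[OF normal_center_SL2R, of A B] assms
  by (simp add: PSL2R_def psl_class_def FactGroup_def SL2R_def)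

lemma psl_class_in_PSL2R: "det A = 1 \<Longrightarrow> psl_class A \<in> carrier PSL2R"
  by (auto simp: PSL2R_def psl_class_def carrier_FactGroup SL2R_def)

lemma PSL2R_E: "x \<in> carrier PSL2R \<Longrightarrow> (\<And>A. det A = 1 \<Longrightarrow> x = psl_class A \<Longrightarrow> thesis) \<Longrightarrow> thesis"
  by (auto simp: PSL2R_def psl_class_def carrier_FactGroup SL2R_def)

lemma one_PSL2R: "\<one>\<^bsub>PSL2R\<^esub> = psl_class (mat 1)"
  by (simp add: PSL2R_def FactGroup_def psl_class_eq)

lemma matrices_of_det: "A \<in> matrices_of \<Gamma> \<Longrightarrow> det A = 1"
  by (simp add: matrices_of_def SL2R_def)

lemma matrices_of_mult:
  assumes "subgroup \<Gamma> PSL2R" "A \<in> matrices_of \<Gamma>" "B \<in> matrices_of \<Gamma>"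
  shows "A ** B \<in> matrices_of \<Gamma>"
  using assms subgroup.m_closed[OF assms(1), of "psl_class A" "psl_class B"] psl_class_mult[of A B]
  by (auto simp: matrices_of_def SL2R_def det_mul)

lemma matrices_of_1: "subgroup \<Gamma> PSL2R \<Longrightarrow> mat 1 \<in> matrices_of \<Gamma>"
  using subgroup.one_closed[of \<Gamma> PSL2R] by (auto simp: matrices_of_def SL2R_def one_PSL2R)

lemma matrices_of_uminus: "A \<in> matrices_of \<Gamma> \<Longrightarrow> - A \<in> matrices_of \<Gamma>"
  by (auto simp: matrices_of_def SL2R_def det_uminus_2 psl_class_eq insert_commute)

lemma matrices_of_adjugate2:
  assumes "subgroup \<Gamma> PSL2R" "A \<in> matrices_of \<Gamma>"
  shows "adjugate2 A \<in> matrices_of \<Gamma>"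
proof -
  interpret group PSL2R by (rule group_PSL2R)
  have d: "det A = 1" by (rule matrices_of_det[OF assms(2)])
  have "psl_class (adjugate2 A) \<otimes>\<^bsub>PSL2R\<^esub> psl_class A = \<one>\<^bsub>PSL2R\<^esub>"
    using d adjugate2_mult(1)[OF d] by (simp add: psl_class_mult one_PSL2R)
  then have "inv\<^bsub>PSL2R\<^esub> (psl_class A) = psl_class (adjugate2 A)"
    using d psl_class_in_PSL2R by (intro inv_equality) auto
  then show ?thesis using subgroup.m_inv_closed[OF assms(1), of "psl_class A"] assms(2)
    by (auto simp: matrices_of_def SL2R_def)
qed

lemma psl_class_eqD: "psl_class A = psl_class B \<Longrightarrow> A = B \<or> A = - B"
  unfolding psl_class_eq by (auto simp: doubleton_eq_iff)

text \<open>
  Every point of the half plane is \<open>A \<i>\<close> for some \<open>A\<close>. Exhaust the half plane by relatively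
  compact open sets \<open>Bn\<close>. That the orbit of \<open>A \<i>\<close> meets \<open>Bn\<close> depends only on the coset of \<open>A\<close> and
  is an open condition, so these conditions are an increasing open cover of the compact space of
  cosets.
\<close>

lemma cocompact_fundamental_compact:
  assumes G: "subgroup \<Gamma> PSL2R" and co: "cocompact \<Gamma>"
  obtains K where "compact K" "K \<subseteq> uhp" "\<And>z. z \<in> uhp \<Longrightarrow> \<exists>A\<in>matrices_of \<Gamma>. moebius A z \<in> K"
proof -
  interpret group PSL2R by (rule group_PSL2R)
  define Bn where "Bn = (\<lambda>n::nat. {z::complex. 1 / real (Suc n) < Im z \<and> norm z < real (Suc n)})"
  define Orb where "Orb = (\<lambda>n. {A. det A = 1 \<and> (\<exists>B\<in>matrices_of \<Gamma>. moebius B (moebius A \<i>) \<in> Bn n)})"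
  define q where "q = r_coset PSL2R \<Gamma>"
  define Uc where "Uc = (\<lambda>n. (\<lambda>A. q (psl_class A)) ` Orb n)"
  have iu: "\<i> \<in> uhp" by (simp add: uhp_def)
  have opB: "open (Bn n)" for n
    unfolding Bn_def by (intro open_Collect_conj open_Collect_less continuous_intros)
  have monoB: "Bn m \<subseteq> Bn n" if "m \<le> n" for m n
  proof -
    have "1 / real (Suc n) \<le> 1 / real (Suc m)" using that by (simp add: frac_le)
    then show ?thesis using that by (auto simp: Bn_def simp del: of_nat_Suc)
  qed
  have coverB: "\<exists>n. z \<in> Bn n" if "z \<in> uhp" for z
  proof -
    have "0 < Im z" using that by (simp add: uhp_def)
    then obtain n1 where n1: "1 / real (Suc n1) < Im z" by (rule nat_approx_posE)
    obtain n2 :: nat where n2: "norm z < real n2" using reals_Archimedean2 by blast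
    have "z \<in> Bn (max n1 n2)"
      using n1 n2 frac_le[of 1 1 "real (Suc n1)" "real (Suc (max n1 n2))"] by (auto simp: Bn_def)
    then show ?thesis ..
  qed
  \<comment> \<open>The set of matrices is a union of cosets.\<close>
  have saturated: "{A. det A = 1 \<and> q (psl_class A) \<in> Uc n} = Orb n" for n
  proof safe
    fix A assume A: "det A = 1" "q (psl_class A) \<in> Uc n"
    then obtain A' where A': "A' \<in> Orb n" "q (psl_class A) = q (psl_class A')" by (auto simp: Uc_def)
    then have d': "det A' = 1" by (simp add: Orb_def)
    have "psl_class A \<in> q (psl_class A)" unfolding q_def
      by (rule rcos_self[OF psl_class_in_PSL2R[OF A(1)] G])
    then obtain \<gamma> where \<gamma>: "\<gamma> \<in> \<Gamma>" "psl_class A = \<gamma> \<otimes>\<^bsub>PSL2R\<^esub> psl_class A'"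
      unfolding A'(2) by (auto simp: q_def r_coset_def)
    then obtain C where C: "det C = 1" "\<gamma> = psl_class C"
      using subgroup.mem_carrier[OF G] by (metis PSL2R_E)
    have "psl_class A = psl_class (C ** A')" using \<gamma> C d' by (simp add: psl_class_mult)
    then have eq: "moebius A \<i> = moebius C (moebius A' \<i>)"
      using psl_class_eqD[of A "C ** A'"] moebius_mult[OF C(1) d' iu] by auto
    have Cm: "C \<in> matrices_of \<Gamma>" using \<gamma> C by (simp add: matrices_of_def SL2R_def)
    obtain B where B: "B \<in> matrices_of \<Gamma>" "moebius B (moebius A' \<i>) \<in> Bn n" using A'(1)
      by (auto simp: Orb_def)
    have u: "moebius A' \<i> \<in> uhp" by (rule moebius_in_uhp[OF d' iu])
    have "moebius (B ** adjugate2 C) (moebius A \<i>) = moebius B (moebius A' \<i>)"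
      unfolding eq using C u B(1)[THEN matrices_of_det] moebius_in_uhp[OF C(1) u]
      by (subst moebius_mult) (auto simp: moebius_adjugate2)
    moreover have "B ** adjugate2 C \<in> matrices_of \<Gamma>"
      by (intro matrices_of_mult matrices_of_adjugate2 G B Cm)
    ultimately show "A \<in> Orb n" using A(1) B(2) unfolding Orb_def by force
  next
    fix A assume "A \<in> Orb n"
    then show "det A = 1" "q (psl_class A) \<in> Uc n" by (auto simp: Orb_def Uc_def)
  qed
  have openOrb: "openin (top_of_set (carrier SL2R)) (Orb n)" for n
  proof -
    have "Orb n = (\<Union>B\<in>matrices_of \<Gamma>. {A \<in> carrier SL2R. moebius B (moebius A \<i>) \<in> Bn n})"
      by (auto simp: Orb_def SL2R_def)
    moreover have
        "openin (top_of_set (carrier SL2R)) {A \<in> carrier SL2R. moebius B (moebius A \<i>) \<in> Bn n}"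
      if B: "B \<in> matrices_of \<Gamma>" for B
    proof -
      have "continuous_on (carrier SL2R) (\<lambda>A. moebius (B ** A) \<i>)"
      proof -
        have nz: "automorphy (B ** A) \<i> \<noteq> 0" if "A \<in> carrier SL2R" for A
          using that matrices_of_det[OF B] by (intro automorphy_nonzero iu) (simp add: SL2R_def det_mul)
        have "continuous_on (carrier SL2R) (\<lambda>A. (of_real ((B ** A)$1$1) * \<i> + of_real ((B ** A)$1$2)) /
            automorphy (B ** A) \<i>)"
          using nz unfolding automorphy_def matrix_matrix_mult_def
          by (auto intro!: continuous_intros)
        then show ?thesis by (simp add: moebius_def automorphy_def)
      qed
      moreover have "moebius (B ** A) \<i> = moebius B (moebius A \<i>)" if "A \<in> carrier SL2R" for A
        using that matrices_of_det[OF B] by (intro moebius_mult iu) (simp_all add: SL2R_def)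
      ultimately have "continuous_on (carrier SL2R) (\<lambda>A. moebius B (moebius A \<i>))"
        using continuous_on_cong by (metis (no_types, lifting))
      from continuous_openin_preimage_gen[OF this opB[of n]] show ?thesis
        by (simp add: vimage_def Int_def conj_commute)
    qed
    ultimately show ?thesis by (auto intro: openin_Union)
  qed
  have top: "topspace (quotient_topology PSL2R_topology q) = q ` carrier PSL2R"
    by (simp add: topspace_quotient_topology topspace_PSL2R_topology)
  have openUn: "openin (quotient_topology PSL2R_topology q) (Uc n)" for n
  proof -
    have "Uc n \<subseteq> q ` carrier PSL2R" by (auto simp: Uc_def Orb_def intro!: psl_class_in_PSL2R)
    moreover have "openin PSL2R_topology {x \<in> carrier PSL2R. q x \<in> Uc n}"
      unfolding PSL2R_topology_def openin_quotient_topology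
    proof
      show "{x \<in> carrier PSL2R. q x \<in> Uc n} \<subseteq> psl_class ` topspace (top_of_set (carrier SL2R))"
        by (auto elim!: PSL2R_E simp: SL2R_def)
      have "{x \<in> topspace (top_of_set (carrier SL2R)). psl_class x \<in> {x \<in> carrier PSL2R. q x \<in> Uc n}}
          = Orb n"
        unfolding saturated[symmetric] by (auto simp: SL2R_def psl_class_in_PSL2R)
      then show "openin (top_of_set (carrier SL2R))
         {x \<in> topspace (top_of_set (carrier SL2R)). psl_class x \<in> {x \<in> carrier PSL2R. q x \<in> Uc n}}"
        using openOrb by simp
    qed
    ultimately show ?thesis unfolding openin_quotient_topology topspace_PSL2R_topology by blast
  qed
  have comp: "compactin (quotient_topology PSL2R_topology q) (q ` carrier PSL2R)"
    using co unfolding cocompact_def q_def[symmetric] compact_space_def top .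
  have monoU: "Uc m \<subseteq> Uc n" if "m \<le> n" for m n
    using monoB[OF that] unfolding Uc_def Orb_def by blast
  have "q ` carrier PSL2R \<subseteq> \<Union>(range Uc)"
  proof safe
    fix x assume "x \<in> carrier PSL2R"
    then obtain A where A: "det A = 1" "x = psl_class A" by (rule PSL2R_E)
    obtain n where "moebius A \<i> \<in> Bn n" using coverB[OF moebius_in_uhp[OF A(1) iu]] ..
    then have "A \<in> Orb n" using A matrices_of_1[OF G] by (auto simp: Orb_def intro!: bexI[of _ "mat 1"])
    then show "q x \<in> \<Union>(range Uc)" using A by (auto simp: Uc_def)
  qed
  then obtain F where F: "finite F" "F \<subseteq> range Uc" "q ` carrier PSL2R \<subseteq> \<Union>F"
    using comp openUn unfolding compactin_def by (metis (no_types, lifting) imageE)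
  then obtain I where I: "finite I" "F = Uc ` I" by (meson finite_subset_image)
  define n where "n = Max (insert 0 I)"
  have sub: "q ` carrier PSL2R \<subseteq> Uc n"
  proof
    fix x assume "x \<in> q ` carrier PSL2R"
    then obtain i where "i \<in> I" "x \<in> Uc i" using F(3) I(2) by blast
    moreover have "i \<le> n" using \<open>i \<in> I\<close> I(1) by (simp add: n_def)
    ultimately show "x \<in> Uc n" using monoU by blast
  qed
  define K where "K = {z::complex. 1 / real (Suc n) \<le> Im z} \<inter> cball 0 (real (Suc n))"
  show ?thesis
  proof (rule that)
    show "compact K" unfolding K_def
      by (intro closed_Int_compact closed_Collect_le continuous_intros compact_cball)
    show "K \<subseteq> uhp"
    proof
      fix z assume "z \<in> K"
      then have "1 / real (Suc n) \<le> Im z" by (simp add: K_def del: of_nat_Suc)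
      moreover have "0 < 1 / real (Suc n)" by simp
      ultimately show "z \<in> uhp" unfolding uhp_iff by linarith
    qed
    fix z assume z: "z \<in> uhp"
    define y where "y = sqrt (Im z)"
    have y: "y > 0" "y * y = Im z" using z by (auto simp: y_def uhp_def)
    define A :: "real^2^2"
        where "A = (\<chi> i j. if i = 1 then (if j = 1 then y else Re z / y) else (if j
            = 1 then 0 else 1 / y))"
    have A: "A$1$1 = y" "A$1$2 = Re z / y" "A$2$1 = 0" "A$2$2 = 1/y" by (simp_all add: A_def)
    have dA: "det A = 1" using y by (simp add: det_2 A)
    have mA: "moebius A \<i> = z"
      using y by (simp add: moebius_def A field_simps complex_eq_iff)
    have "A \<in> Orb n" unfolding saturated[symmetric] using dA sub psl_class_in_PSL2R[OF dA] by auto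
    then obtain B where "B \<in> matrices_of \<Gamma>" "moebius B z \<in> Bn n" using mA by (auto simp: Orb_def)
    then show "\<exists>A\<in>matrices_of \<Gamma>. moebius A z \<in> K"
      by (auto simp: Bn_def K_def intro!: bexI[of _ B] simp del: of_nat_Suc)
  qed
qed

text \<open>
  A neighbourhood of the identity of the quotient group pulls back to one of \<open>mat 1\<close>.
\<close>

lemma discrete_subgroup_isolated:
  assumes "discrete_subgroup \<Gamma>"
  obtains e
      where "e > 0" "\<And>A. A \<in> matrices_of \<Gamma> \<Longrightarrow> (\<And>i j. \<bar>A$i$j - (mat 1 :: real^2^2)$i$j\<bar> < e) \<Longrightarrow> A = mat 1
          \<or> A = - mat 1"
proof -
  have G: "subgroup \<Gamma> PSL2R" and disc: "subtopology PSL2R_topology \<Gamma> = discrete_topology \<Gamma>"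
    using assms by (auto simp: discrete_subgroup_def)
  have one: "psl_class (mat 1) \<in> \<Gamma>" using matrices_of_1[OF G] by (simp add: matrices_of_def)
  have "openin (subtopology PSL2R_topology \<Gamma>) {psl_class (mat 1)}"
    unfolding disc using one by simp
  then obtain U where U: "openin PSL2R_topology U" "{psl_class (mat 1)} = U \<inter> \<Gamma>"
    by (auto simp: openin_subtopology)
  have "openin (top_of_set (carrier SL2R)) {A \<in> carrier SL2R. psl_class A \<in> U}"
    using U(1) by (simp add: PSL2R_topology_def openin_quotient_topology)
  then obtain V where V: "open V" "{A \<in> carrier SL2R. psl_class A \<in> U} = carrier SL2R \<inter> V"
    by (auto simp: openin_open)
  have "mat 1 \<in> {A \<in> carrier SL2R. psl_class A \<in> U}" using U(2) by (auto simp: SL2R_def)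
  then have "mat 1 \<in> V" using V(2) by blast
  then obtain e where e: "e > 0" "\<And>A. dist A (mat 1) < e \<Longrightarrow> A \<in> V" using V(1) by (auto simp: open_dist)
  show ?thesis
  proof (rule that[of "e / 4"])
    fix A assume A: "A \<in> matrices_of \<Gamma>" and s: "\<And>i j. \<bar>A$i$j - (mat 1 :: real^2^2)$i$j\<bar> < e / 4"
    have "dist A (mat 1) = norm (A - mat 1)" by (simp add: dist_norm)
    also have "\<dots> \<le> (\<Sum>i\<in>UNIV. norm ((A - mat 1) $ i))" unfolding norm_vec_def
      by (rule L2_set_le_sum) simp
    also have "\<dots> \<le> (\<Sum>i\<in>UNIV. \<Sum>j\<in>UNIV. \<bar>(A - mat 1) $ i $ j\<bar>)"
      by (intro sum_mono norm_le_l1_cart)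
    also have "\<dots> < e" using s[of 1 1] s[of 1 2] s[of 2 1] s[of 2 2] by (simp add: sum_2)
    finally have "A \<in> V" by (rule e(2))
    then have "psl_class A \<in> U \<inter> \<Gamma>" using V(2) A by (auto simp: matrices_of_def)
    then show "A = mat 1 \<or> A = - mat 1" using U(2) psl_class_eqD by blast
  qed (use e in simp)
qed

text \<open>
  If \<open>A\<close> moves a point of \<open>K\<close> into \<open>K\<close>, the formula for \<open>Im (A z)\<close> bounds the denominator of \<open>A
  z\<close>, hence also the numerator, and so the entries of \<open>A\<close>. Infinitely many such matrices would
  accumulate. Among three of them that are close to each other, \<open>P\<inverse> Q\<close> and \<open>P\<inverse> R\<close> are near the
  identity, hence \<open>\<plusminus> 1\<close>, which leaves only the two values \<open>\<plusminus> P\<close> for the three.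
\<close>

lemma finite_return_set:
  assumes disc: "discrete_subgroup \<Gamma>" and K: "compact K" "K \<subseteq> uhp"
  shows "finite {A \<in> matrices_of \<Gamma>. \<exists>z\<in>K. moebius A z \<in> K}" (is "finite ?T")
proof (rule ccontr)
  assume inf: "infinite ?T"
  have G: "subgroup \<Gamma> PSL2R" using disc by (simp add: discrete_subgroup_def)
  have Kne: "K \<noteq> {}" using inf by auto
  obtain M where M: "\<And>z. z \<in> K \<Longrightarrow> norm z \<le> M" using compact_imp_bounded[OF K(1)]
    by (auto simp: bounded_iff)
  have "\<exists>z0\<in>K. \<forall>z\<in>K. Im z0 \<le> Im z"
    by (rule continuous_attains_inf[OF K(1) Kne]) (intro continuous_intros)
  then obtain z0 where z0: "z0 \<in> K" "\<And>z. z \<in> K \<Longrightarrow> Im z0 \<le> Im z" by blast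
  \<comment> \<open>Bounds for the points of \<open>K\<close> and for the entries of the matrices.\<close>
  define m where "m = Im z0"
  have m: "m > 0" "\<And>z. z \<in> K \<Longrightarrow> m \<le> Im z" using z0 K(2) by (auto simp: m_def uhp_def)
  have M0: "M > 0" using m(2)[OF z0(1)] m(1) M[OF z0(1)] abs_Im_le_cmod[of z0] by linarith
  define C where "C = sqrt (M / m)"
  define E where "E = max C (M * C)"
  define B where "B = max (E / m) (E + (E / m) * M)"
  have bd: "\<bar>A$i$j\<bar> \<le> B" if A: "A \<in> ?T" for A i j
  proof -
    obtain z where z: "z \<in> K" "moebius A z \<in> K" using A by auto
    have d: "det A = 1" using A by (auto dest: matrices_of_det)
    have zu: "z \<in> uhp" using z K by auto
    have nz: "automorphy A z \<noteq> 0" by (rule automorphy_nonzero[OF d zu])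
    have bz: "m \<le> Im z" "Im z \<le> M" "norm z \<le> M" "m \<le> Im (moebius A z)" "norm (moebius A z) \<le> M"
      using m(2)[OF z(1)] m(2)[OF z(2)] M[OF z(1)] M[OF z(2)] abs_Im_le_cmod[of z] by auto
    have "m * (norm (automorphy A z))\<^sup>2 \<le> Im z"
      using bz(4) nz unfolding Im_moebius[OF d zu] by (simp add: field_simps)
    then have "(norm (automorphy A z))\<^sup>2 \<le> M / m" using bz m(1) by (simp add: field_simps)
    then have nd: "norm (automorphy A z) \<le> C" unfolding C_def by (rule real_le_rsqrt)
    have "of_real (A$1$1) * z + of_real (A$1$2) = moebius A z * automorphy A z"
      using nz by (simp add: moebius_def automorphy_def)
    then have "norm (of_real (A$1$1) * z + of_real (A$1$2)) \<le> M * C"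
      using mult_mono[OF bz(5) nd] M0 by (simp add: norm_mult)
    then have nn: "norm (of_real (A$1$1) * z + of_real (A$1$2)) \<le> E" by (simp add: E_def)
    have nd': "norm (of_real (A$2$1) * z + of_real (A$2$2)) \<le> E" using nd
      by (simp add: E_def automorphy_def)
    have gen: "\<bar>p\<bar> \<le> B \<and> \<bar>r\<bar> \<le> B" if "norm (of_real p * z + of_real r) \<le> E" for p r
    proof -
      have "\<bar>p * Im z\<bar> \<le> E" using that abs_Im_le_cmod[of "of_real p * z + of_real r"] by simp
      then have "\<bar>p\<bar> * Im z \<le> E" using bz m by (simp add: abs_mult)
      moreover have "\<bar>p\<bar> * m \<le> \<bar>p\<bar> * Im z" using bz by (intro mult_left_mono) auto
      ultimately have p: "\<bar>p\<bar> \<le> E / m" using m by (simp add: field_simps)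
      have "norm (of_real r :: complex) \<le> norm (of_real p * z + of_real r) + norm (of_real p * z)"
        by (metis add.commute add_diff_cancel_left' norm_triangle_ineq4)
      also have "norm (of_real p * z) \<le> (E / m) * M"
        using mult_mono[OF p bz(3)] order_trans[OF abs_ge_zero p] by (simp add: norm_mult)
      finally have "\<bar>r\<bar> \<le> E + (E / m) * M" using that by simp
      then show ?thesis using p by (auto simp: B_def)
    qed
    have "\<forall>i j. \<bar>A$i$j\<bar> \<le> B" using gen[OF nn] gen[OF nd'] by (simp add: forall_2)
    then show ?thesis by blast
  qed
  have B0: "B \<ge> 0" using bd inf
    by (metis (no_types, lifting) abs_ge_zero equals0I finite.emptyI order_trans)
  have "bounded ?T"
  proof (rule boundedI)
    fix A assume A: "A \<in> ?T"
    have "norm A \<le> (\<Sum>i\<in>UNIV. norm (A $ i))" unfolding norm_vec_def by (rule L2_set_le_sum) simp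
    also have "\<dots> \<le> (\<Sum>i\<in>UNIV. \<Sum>j\<in>UNIV. \<bar>A $ i $ j\<bar>)" by (intro sum_mono norm_le_l1_cart)
    also have "\<dots> \<le> 4 * B" using bd[OF A, of 1 1] bd[OF A, of 1 2] bd[OF A, of 2 1] bd[OF A, of 2 2]
      by (simp add: sum_2)
    finally show "norm A \<le> 4 * B" .
  qed
  then have "compact (closure ?T)" by simp
  then obtain L where L: "L islimpt ?T"
    using Heine_Borel_imp_Bolzano_Weierstrass[OF _ inf closure_subset] by blast
  obtain e where e: "e > 0" "\<And>A. A \<in> matrices_of \<Gamma> \<Longrightarrow> (\<And>i j. \<bar>A$i$j - (mat 1 :: real^2^2)$i$j\<bar> < e) \<Longrightarrow> A
      = mat 1 \<or> A = - mat 1"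
    using discrete_subgroup_isolated[OF disc] by blast
  define \<delta> where "\<delta> = e / (4 * B + 4)"
  have \<delta>: "\<delta> > 0" "2 * B * (2 * \<delta>) < e" using e(1) B0 by (auto simp: \<delta>_def field_simps)
  have "infinite (?T \<inter> ball L \<delta>)" using L \<delta>(1) islimpt_eq_infinite_ball by blast
  then obtain S3 where S3: "S3 \<subseteq> ?T \<inter> ball L \<delta>" "finite S3" "card S3 = 3"
    by (meson infinite_arbitrarily_large)
  then obtain P Q R where PQR: "S3 = {P, Q, R}" "P \<noteq> Q" "Q \<noteq> R" "P \<noteq> R" by (auto simp: card_3_iff)
  have near: "Y = X \<or> Y = - X" if X: "X \<in> S3" and Y: "Y \<in> S3" for X Y
  proof -
    have XT: "X \<in> ?T" "Y \<in> ?T" "dist L X < \<delta>" "dist L Y < \<delta>" using X Y S3 by auto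
    have dX: "det X = 1" using XT by (auto dest: matrices_of_det)
    have "dist X Y < 2 * \<delta>" using XT(3,4) dist_triangle2[of X Y L] by (simp add: dist_commute)
    then have n: "norm (Y - X) < 2 * \<delta>" by (simp add: dist_norm norm_minus_commute)
    have ent: "\<bar>Y$i$j - X$i$j\<bar> \<le> 2 * \<delta>" for i j
      using component_le_norm_cart[of "(Y - X)$i" j] component_le_norm_cart
        Finite_Cartesian_Product.norm_nth_le[of "Y - X" i] n
      by (metis (no_types, opaque_lifting) less_eq_real_def order_trans vector_minus_component)
    have "adjugate2 X ** Y - mat 1 = adjugate2 X ** (Y - X)"
      using adjugate2_mult(1)[OF dX]
      by (simp add: vec_eq_iff matrix_matrix_mult_def right_diff_distrib sum_subtractf)
    then have eq: "(adjugate2 X ** Y) $ i $ j - (mat 1 :: real^2^2) $ i $ j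
        = (adjugate2 X ** (Y - X)) $ i $ j" for i j
      by (metis vector_minus_component)
    have abd: "\<bar>adjugate2 X $ i $ k\<bar> \<le> B" for i k
    proof -
      have "\<forall>i k. \<bar>adjugate2 X $ i $ k\<bar> \<le> B" unfolding forall_2 using bd[OF XT(1)] by simp
      then show ?thesis by blast
    qed
    have "\<bar>(adjugate2 X ** Y) $ i $ j - (mat 1 :: real^2^2) $ i $ j\<bar> < e" for i j
    proof -
      have t: "\<bar>adjugate2 X $ i $ k * (Y - X) $ k $ j\<bar> \<le> B * (2 * \<delta>)" for k
        unfolding abs_mult using abd ent B0 \<delta>(1) by (intro mult_mono) auto
      have "\<bar>(adjugate2 X ** (Y - X)) $ i $ j\<bar> \<le> \<bar>adjugate2 X $ i $ 1 * (Y - X) $ 1 $ j\<bar> + \<bar>adjugate2 X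
          $ i $ 2 * (Y - X) $ 2 $ j\<bar>"
        by (simp only: matrix_matrix_mult_def sum_2 vec_lambda_beta abs_triangle_ineq)
      then show ?thesis unfolding eq using t[of 1] t[of 2] \<delta>(2) by linarith
    qed
    moreover have "adjugate2 X ** Y \<in> matrices_of \<Gamma>" using XT G
      by (intro matrices_of_mult matrices_of_adjugate2) auto
    ultimately have "adjugate2 X ** Y = mat 1 \<or> adjugate2 X ** Y = - mat 1" by (rule e(2)[rotated])
    moreover have "Y = X ** (adjugate2 X ** Y)" using adjugate2_mult(2)[OF dX]
      by (simp add: matrix_mul_assoc)
    moreover have "X ** (- mat 1) = - X"
      by (simp add: vec_eq_iff matrix_matrix_mult_def mat_def forall_2 sum_2)
    ultimately show ?thesis by (metis matrix_mul_rid)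
  qed
  show False using near[of P Q] near[of P R] PQR by auto
qed

section \<open>Wirtinger derivatives and averaging over the group\<close>

lemma wirtinger_const: "wirtinger (\<lambda>_. c) 0 0 z" and wirtinger_ident: "wirtinger (\<lambda>w. w) 1 0 z"
  and wirtinger_cnj_ident: "wirtinger cnj 0 1 z"
  by (auto simp: wirtinger_def intro!: derivative_eq_intros)

lemma wirtinger_holomorphic: "(f has_field_derivative f') (at z) \<Longrightarrow> wirtinger f f' 0 z"
  by (simp add: wirtinger_def has_field_derivative_def)

lemma wirtinger_add:
  assumes "wirtinger f a b z" "wirtinger g a' b' z"
  shows "wirtinger (\<lambda>w. f w + g w) (a + a') (b + b') z"
  unfolding wirtinger_def
  by (rule has_derivative_eq_rhs[OF has_derivative_add[OF assms[unfolded wirtinger_def]]])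
    (auto simp: algebra_simps)

lemma wirtinger_diff:
  assumes "wirtinger f a b z" "wirtinger g a' b' z"
  shows "wirtinger (\<lambda>w. f w - g w) (a - a') (b - b') z"
  unfolding wirtinger_def
  by (rule has_derivative_eq_rhs[OF has_derivative_diff[OF assms[unfolded wirtinger_def]]])
    (auto simp: algebra_simps)

lemma wirtinger_mult:
  assumes "wirtinger f a b z" "wirtinger g a' b' z"
  shows "wirtinger (\<lambda>w. f w * g w) (a * g z + f z * a') (b * g z + f z * b') z"
  unfolding wirtinger_def
  by (rule has_derivative_eq_rhs[OF has_derivative_mult[OF assms[unfolded wirtinger_def]]])
    (auto simp: algebra_simps)

lemma wirtinger_cnj:
  assumes "wirtinger f a b z" shows "wirtinger (\<lambda>w. cnj (f w)) (cnj b) (cnj a) z"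
  unfolding wirtinger_def
  by (rule has_derivative_eq_rhs[OF has_derivative_cnj[OF assms[unfolded wirtinger_def]]])
    (auto simp: algebra_simps)

lemma wirtinger_inverse:
  assumes "wirtinger f a b z" "f z \<noteq> 0"
  shows "wirtinger (\<lambda>w. inverse (f w)) (- a / (f z)\<^sup>2) (- b / (f z)\<^sup>2) z"
proof -
  have "((\<lambda>x. inverse x) has_field_derivative - inverse ((f z)\<^sup>2)) (at (f z))"
    using assms(2) by (auto intro!: derivative_eq_intros simp: power2_eq_square)
  then have "((\<lambda>x. inverse x) has_derivative (*) (- inverse ((f z)\<^sup>2))) (at (f z))"
    by (simp add: has_field_derivative_def)
  from has_derivative_compose[OF assms(1)[unfolded wirtinger_def] this] show ?thesis
    unfolding wirtinger_def by (rule has_derivative_eq_rhs) (auto simp: divide_inverse algebra_simps)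
qed

lemma wirtinger_sum: "(\<And>i. i \<in> I \<Longrightarrow> wirtinger (f i) (a i) (b i) z) \<Longrightarrow>
    wirtinger (\<lambda>w. \<Sum>i\<in>I. f i w) (\<Sum>i\<in>I. a i) (\<Sum>i\<in>I. b i) z"
  by (induction I rule: infinite_finite_induct) (auto intro: wirtinger_const wirtinger_add)

lemma wirtinger_compose_holomorphic:
  assumes "wirtinger f a b (h z)" "(h has_field_derivative h') (at z)"
  shows "wirtinger (\<lambda>w. f (h w)) (a * h') (b * cnj h') z"
  unfolding wirtinger_def
  by (rule has_derivative_eq_rhs[OF has_derivative_compose[OF assms(2)[unfolded
    has_field_derivative_def] assms(1)[unfolded wirtinger_def]]])
     (auto simp: algebra_simps)

lemma wirtinger_transform:
  assumes "wirtinger f a b z" "open S" "z \<in> S" "\<And>w. w \<in> S \<Longrightarrow> f w = g w"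
  shows "wirtinger g a b z"
  using assms unfolding wirtinger_def by (blast intro: has_derivative_transform_within_open)

lemma wirtinger_continuous: "wirtinger f a b z \<Longrightarrow> isCont f z"
  unfolding wirtinger_def by (rule has_derivative_continuous)

text \<open>
  A derivative \<open>h \<mapsto> a h + b cnj h\<close> of a real function takes real values; this makes the chain rule
  for a real outer function linear in \<open>a\<close> and \<open>b\<close>.
\<close>

lemma wirtinger_real_compose:
  assumes "wirtinger (\<lambda>w. of_real (N w)) a b z" "(k has_real_derivative k') (at (N z))"
  shows "wirtinger (\<lambda>w. of_real (k (N w))) (of_real k' * a) (of_real k' * b) z"
proof -
  let ?L = "\<lambda>h. a * h + b * cnj h"
  have L: "((\<lambda>w. complex_of_real (N w)) has_derivative ?L) (at z)" using assms(1)
    by (simp add: wirtinger_def)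
  have "((\<lambda>w. Im (complex_of_real (N w))) has_derivative (\<lambda>h. Im (?L h))) (at z)"
    by (rule has_derivative_Im[OF L])
  then have "((\<lambda>w. 0) has_derivative (\<lambda>h. Im (?L h))) (at z)" by simp
  then have "(\<lambda>h. Im (?L h)) = (\<lambda>_. 0)" using has_derivative_unique has_derivative_const by blast
  then have im: "of_real (Re (?L h)) = ?L h" for h by (auto simp: complex_eq_iff fun_eq_iff)
  have "((\<lambda>w. Re (complex_of_real (N w))) has_derivative (\<lambda>h. Re (?L h))) (at z)"
    by (rule has_derivative_Re[OF L])
  then have N: "(N has_derivative (\<lambda>h. Re (?L h))) (at z)" by simp
  have "((\<lambda>w. k (N w)) has_derivative (\<lambda>h. k' * Re (?L h))) (at z)"
    by (rule has_derivative_compose[OF N assms(2)[unfolded has_field_derivative_def]])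
  then have "((\<lambda>w. complex_of_real (k (N w))) has_derivative (\<lambda>h. of_real (k' * Re (?L h)))) (at z)"
    by (rule has_derivative_of_real)
  then show ?thesis unfolding wirtinger_def of_real_mult im by (simp add: algebra_simps)
qed

lemma has_real_derivative_max_0_squared:
  "((\<lambda>t::real. (max 0 t)\<^sup>2) has_real_derivative 2 * max 0 t) (at t)"
proof -
  consider "t < 0" | "t > 0" | "t = 0" by linarith
  then show ?thesis
  proof cases
    case 1
    have "((\<lambda>t::real. 0) has_real_derivative 0) (at t)" by simp
    then have "((\<lambda>t::real. (max 0 t)\<^sup>2) has_real_derivative 0) (at t)"
      by (rule has_field_derivative_transform_within_open[of _ _ _ "{..<0}"]) (use 1 in auto)
    then show ?thesis using 1 by simp
  next
    case 2
    have "((\<lambda>t::real. t\<^sup>2) has_real_derivative 2 * t) (at t)" by (auto intro!: derivative_eq_intros)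
    then have "((\<lambda>t::real. (max 0 t)\<^sup>2) has_real_derivative 2 * t) (at t)"
      by (rule has_field_derivative_transform_within_open[of _ _ _ "{0<..}"]) (use 2 in auto)
    then show ?thesis using 2 by simp
  next
    case 3
    have "(\<lambda>h::real. ((max 0 (0 + h))\<^sup>2 - (max 0 0)\<^sup>2) / h) \<midarrow>0\<rightarrow> 0"
    proof (rule Lim_null_comparison[where g = "\<lambda>h. \<bar>h\<bar>"])
      show "\<forall>\<^sub>F h in at 0. norm (((max 0 (0 + h))\<^sup>2 - (max 0 0)\<^sup>2) / h) \<le> \<bar>h\<bar>" for h :: real
        by (rule always_eventually) (auto simp: max_def power2_eq_square)
      show "((\<lambda>h::real. \<bar>h\<bar>) \<longlongrightarrow> 0) (at 0)" by (rule tendsto_rabs_zero) (rule tendsto_ident_at)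
    qed
    then show ?thesis using 3 by (simp add: DERIV_def)
  qed
qed

lemma continuous_zero_extension:
  fixes g :: "complex \<Rightarrow> complex"
  assumes "open U" "compact X" "X \<subseteq> U" "continuous_on U g" "\<And>z. z \<in> U \<Longrightarrow> z \<notin> X \<Longrightarrow> g z = 0"
  shows "continuous_on UNIV (\<lambda>z. if z \<in> U then g z else 0)"
proof -
  have "continuous_on (U \<union> - X) (\<lambda>z. if z \<in> U then g z else 0)"
  proof (rule continuous_on_open_Un)
    show "continuous_on U (\<lambda>z. if z \<in> U then g z else 0)" using assms(4)
      by (simp cong: continuous_on_cong)
    have "continuous_on (- X) (\<lambda>z::complex. 0::complex)" by simp
    then show "continuous_on (- X) (\<lambda>z. if z \<in> U then g z else 0)"
      by (rule continuous_on_cong[THEN iffD1, OF refl, rotated]) (use assms(5) in auto)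
  qed (use assms compact_imp_closed in auto)
  moreover have "U \<union> - X = UNIV" using assms(3) by auto
  ultimately show ?thesis by simp
qed

text \<open>
  The region \<open>\<bar>z - \<i>\<bar>\<^sup>2 \<le> c Im z\<close> is a hyperbolic disc about \<open>\<i>\<close>, compact in the half plane, and
  contains \<open>K\<close> for large \<open>c\<close>. The square of the positive part of the difference of the two sides
  is continuously differentiable.
\<close>

lemma bump_function:
  assumes "compact K" "K \<subseteq> uhp"
  obtains F :: "complex \<Rightarrow> real" and a b :: "complex \<Rightarrow> complex" and X where
    "\<And>z. wirtinger (\<lambda>w. of_real (F w)) (a z) (b z) z" "continuous_on UNIV a" "continuous_on UNIV b"
    "compact X" "X \<subseteq> uhp" "\<And>z. F z \<ge> 0" "\<And>z. z \<in> K \<Longrightarrow> F z > 0"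
    "\<And>z. F z > 0 \<Longrightarrow> z \<in> X" "\<And>z. z \<notin> X \<Longrightarrow> F z = 0 \<and> a z = 0 \<and> b z = 0"
proof -
  have "compact ((\<lambda>z. (norm (z - \<i>))\<^sup>2 / Im z) ` K)"
    using assms by (intro compact_continuous_image continuous_intros) (auto simp: uhp_def)
  then have "bounded ((\<lambda>z. (norm (z - \<i>))\<^sup>2 / Im z) ` K)" by (rule compact_imp_bounded)
  then obtain c0 where c0: "\<And>z. z \<in> K \<Longrightarrow> norm ((norm (z - \<i>))\<^sup>2 / Im z) \<le> c0" by (auto simp: bounded_iff)
  define c where "c = max 0 c0 + 1"
  have c: "c > 0" by (simp add: c_def)
  define r where "r = (\<lambda>z. c * Im z - (norm (z - \<i>))\<^sup>2)"
  define X where "X = {z. r z \<ge> 0}"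
  define F where "F = (\<lambda>z. (max 0 (r z))\<^sup>2)"
  define k where "k = of_real c / (2 * \<i>)"
  define ra where "ra = (\<lambda>z. k - (cnj z + \<i>))"
  define rb where "rb = (\<lambda>z. - k - (z - \<i>))"
  have rc: "continuous_on UNIV r" unfolding r_def by (intro continuous_intros)
  have rw: "wirtinger (\<lambda>w. of_real (r w)) (ra z) (rb z) z" for z
  proof -
    have eq: "complex_of_real (r w) = of_real c / (2 * \<i>) * (w - cnj w) - (w - \<i>) * (cnj w + \<i>)" for w
    proof -
      have "(w - \<i>) * (cnj w + \<i>) = of_real ((norm (w - \<i>))\<^sup>2)"
        by (simp only: complex_norm_square complex_cnj_diff complex_cnj_i) simp
      moreover have "of_real c / (2 * \<i>) * (w - cnj w) = of_real (c * Im w)"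
        unfolding complex_diff_cnj by (simp add: complex_eq_iff)
      ultimately show ?thesis by (simp add: r_def)
    qed
    show ?thesis unfolding eq k_def[symmetric] wirtinger_def ra_def rb_def
      by (auto intro!: derivative_eq_intros simp: algebra_simps)
  qed
  show ?thesis
  proof (rule that[of F "\<lambda>z. of_real (2 * max 0 (r z)) * ra z" "\<lambda>z. of_real (2 * max 0 (r z)) * rb z"
      X])
    show "wirtinger (\<lambda>w. of_real (F w)) (of_real (2 * max 0 (r z)) * ra z) (of_real (2 * max 0 (r z)) *
        rb z) z" for z
      unfolding F_def by (rule wirtinger_real_compose[OF rw has_real_derivative_max_0_squared])
    show "continuous_on UNIV (\<lambda>z. of_real (2 * max 0 (r z)) * ra z)"
      "continuous_on UNIV (\<lambda>z. of_real (2 * max 0 (r z)) * rb z)"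
      unfolding ra_def rb_def by (intro continuous_intros rc; simp)+
    have "closed X" unfolding X_def by (intro closed_Collect_le rc continuous_intros)
    moreover have "bounded X"
    proof (rule boundedI)
      fix z assume "z \<in> X"
      then have h: "(norm (z - \<i>))\<^sup>2 \<le> c * Im z" by (simp add: X_def r_def)
      have "Im z \<le> 1 + norm (z - \<i>)" using abs_Im_le_cmod[of "z - \<i>"] by simp
      then have h2: "(norm (z - \<i>))\<^sup>2 \<le> c * (1 + norm (z - \<i>))" using h c
        by (meson mult_left_mono less_imp_le order_trans)
      have "norm (z - \<i>) \<le> c + 1"
      proof (rule ccontr)
        assume n: "\<not> ?thesis"
        then have "(c + 1) * norm (z - \<i>) < norm (z - \<i>) * norm (z - \<i>)" using c
          by (intro mult_strict_right_mono) auto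
        then show False using h2 n c by (simp add: power2_eq_square algebra_simps)
      qed
      then show "norm z \<le> c + 2" using norm_triangle_ineq[of "z - \<i>" \<i>] by simp
    qed
    ultimately show "compact X" by (simp add: compact_eq_bounded_closed)
    show "X \<subseteq> uhp"
    proof
      fix z assume "z \<in> X"
      then have h: "(norm (z - \<i>))\<^sup>2 \<le> c * Im z" by (simp add: X_def r_def)
      have "0 \<le> c * Im z" using h zero_le_power2 order_trans by blast
      then have "Im z \<ge> 0" using c by (simp add: zero_le_mult_iff)
      moreover have "Im z \<noteq> 0" using h by auto
      ultimately show "z \<in> uhp" by (simp add: uhp_def)
    qed
    show "F z \<ge> 0" for z by (simp add: F_def)
    show "F z > 0" if "z \<in> K" for z
    proof -
      have y: "Im z > 0" using that assms by (auto simp: uhp_def)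
      then have "(norm (z - \<i>))\<^sup>2 / Im z \<le> c0" using c0[OF that] by simp
      then have "(norm (z - \<i>))\<^sup>2 / Im z < c" by (simp add: c_def)
      then have "r z > 0" using y by (simp add: r_def field_simps)
      then show ?thesis by (simp add: F_def)
    qed
    show "z \<in> X" if "F z > 0" for z using that by (auto simp: F_def X_def max_def split: if_splits)
    show "F z = 0 \<and> of_real (2 * max 0 (r z)) * ra z = 0 \<and> of_real (2 * max 0 (r z)) * rb z = 0"
        if "z \<notin> X" for z
      using that by (auto simp: F_def X_def)
  qed
qed

text \<open>
  This says that \<open>\<Theta> dz\<close> is an invariant continuously differentiable differential form, with \<open>a =
  \<partial>\<Theta>/\<partial>z\<close> and \<open>b = \<partial>\<Theta>/\<partial>cnj z\<close>.
\<close>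

definition smooth_weight2_form ::
    "(real^2^2) set set \<Rightarrow> (complex \<Rightarrow> complex) \<Rightarrow> (complex \<Rightarrow> complex) \<Rightarrow> (complex \<Rightarrow> complex) \<Rightarrow> bool" where
  "smooth_weight2_form \<Gamma> \<Theta> a b \<longleftrightarrow>
     (\<forall>z\<in>uhp. wirtinger \<Theta> (a z) (b z) z) \<and> continuous_on uhp a \<and> continuous_on uhp b \<and>
     (\<forall>A\<in>matrices_of \<Gamma>. \<forall>z\<in>uhp. \<Theta> (moebius A z) = (automorphy A z)\<^sup>2 * \<Theta> z)"

text \<open>
  Integration against \<open>q\<close> stands in for integration over the quotient by \<open>\<Gamma>\<close>. The last condition
  is the formula of Stokes on the quotient: the exact form \<open>d(\<Theta> dz)\<close> has integral 0.
\<close>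

definition averaging_weight ::
    "(real^2^2) set set \<Rightarrow> complex set \<Rightarrow> (complex \<Rightarrow> real) \<Rightarrow> complex set \<Rightarrow> bool" where
  "averaging_weight \<Gamma> K q X \<longleftrightarrow> compact X \<and> X \<subseteq> uhp \<and> continuous_on UNIV q \<and>
     (\<forall>z. q z \<ge> 0) \<and> (\<forall>z\<in>K. q z > 0) \<and> (\<forall>z. z \<notin> X \<longrightarrow> q z = 0) \<and>
     (\<forall>\<Theta> a b. smooth_weight2_form \<Gamma> \<Theta> a b \<longrightarrow> integral\<^sup>L lborel (\<lambda>z. of_real (q z) * b z) = 0)"

text \<open>
  Take \<open>q = F / P\<close> with a bump function \<open>F\<close> and \<open>P = (\<Sum>A. F \<circ> A)\<close>, so that the translates of \<open>q\<close>
  add up to 1. The integral of \<open>\<partial>(q \<Theta>)/\<partial>cnj z\<close> is 0. It remains to see that \<open>\<Theta> \<partial>q/\<partial>cnj z\<close> has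
  integral 0. By the quotient rule this is the difference of \<open>\<Theta> P \<partial>F/\<partial>cnj z / P\<^sup>2\<close> and \<open>\<Theta> F
  \<partial>P/\<partial>cnj z / P\<^sup>2\<close>. Writing \<open>P\<close> as a sum over the group, the substitution \<open>z \<mapsto> A\<inverse> z\<close> turns the
  summand of the first with index \<open>A\<close> into the summand of the second with index \<open>A\<inverse>\<close>.
\<close>

lemma averaging_weight_exists:
  assumes disc: "discrete_subgroup \<Gamma>" and K: "compact K" "K \<subseteq> uhp"
    and cover: "\<And>z. z \<in> uhp \<Longrightarrow> \<exists>A\<in>matrices_of \<Gamma>. moebius A z \<in> K"
  shows "\<exists>q X. averaging_weight \<Gamma> K q X"
proof -
  have G: "subgroup \<Gamma> PSL2R" using disc by (simp add: discrete_subgroup_def)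
  obtain F :: "complex \<Rightarrow> real" and aF bF X where
    F: "\<And>z. wirtinger (\<lambda>w. of_real (F w)) (aF z) (bF z) z" "continuous_on UNIV aF"
        "continuous_on UNIV bF"
    "compact X" "X \<subseteq> uhp" "\<And>z. F z \<ge> 0" "\<And>z. z \<in> K \<Longrightarrow> F z > 0"
    "\<And>z. F z > 0 \<Longrightarrow> z \<in> X" "\<And>z. z \<notin> X \<Longrightarrow> F z = 0 \<and> aF z = 0 \<and> bF z = 0"
    using bump_function[OF K] by blast
  define S where "S = {A \<in> matrices_of \<Gamma>. \<exists>z\<in>X. moebius A z \<in> X}"
  have finS: "finite S" unfolding S_def by (rule finite_return_set[OF disc F(4,5)])
  have SM: "A \<in> matrices_of \<Gamma>" "det A = 1" if "A \<in> S" for A using that matrices_of_det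
    by (auto simp: S_def)
  define J where "J = (\<lambda>A z. 1 / (automorphy A z)\<^sup>2)"
  have dmoeb: "(moebius A has_field_derivative J A z) (at z)" if "A \<in> S" "z \<in> uhp" for A z
    unfolding J_def by (rule has_field_derivative_moebius[OF SM(2)[OF that(1)] that(2)])
  have Jc: "continuous_on uhp (J A)" if "A \<in> S" for A
    unfolding J_def automorphy_def
    by (intro continuous_intros) (use automorphy_nonzero[OF SM(2)[OF that]] in \<open>auto simp:
      automorphy_def\<close>)
  have mc: "continuous_on uhp (moebius A)" if "A \<in> S" for A
    using dmoeb[OF that] by (meson DERIV_isCont continuous_at_imp_continuous_on)
  have mu: "moebius A z \<in> uhp" if "A \<in> S" "z \<in> uhp" for A z using moebius_in_uhp SM that by blast
  have Fc: "continuous_on UNIV F"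
  proof -
    have "continuous_on UNIV (\<lambda>z. Re (complex_of_real (F z)))"
      by (intro continuous_on_Re continuous_at_imp_continuous_on ballI wirtinger_continuous[OF F(1)])
    then show ?thesis by simp
  qed
  define P where "P = (\<lambda>z. \<Sum>A\<in>S. F (moebius A z))"
  define aP where "aP = (\<lambda>z. \<Sum>A\<in>S. aF (moebius A z) * J A z)"
  define bP where "bP = (\<lambda>z. \<Sum>A\<in>S. bF (moebius A z) * cnj (J A z))"
  have Pw: "wirtinger (\<lambda>w. of_real (P w)) (aP z) (bP z) z" if "z \<in> uhp" for z
    unfolding P_def aP_def bP_def of_real_sum
    by (rule wirtinger_sum, rule wirtinger_compose_holomorphic[OF F(1) dmoeb]) (use that in auto)
  have comp: "continuous_on uhp (\<lambda>z. h (moebius A z))" if "continuous_on UNIV h" "A \<in> S"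
      for h :: "complex \<Rightarrow> 'x::topological_space" and A
    by (rule continuous_on_compose2[OF that(1) mc[OF that(2)]]) auto
  have Pc: "continuous_on uhp P" "continuous_on uhp aP" "continuous_on uhp bP"
    unfolding P_def aP_def bP_def
    by (intro continuous_intros comp[OF Fc] comp[OF F(2)] comp[OF F(3)] Jc; assumption)+
  define U where "U = {z \<in> uhp. P z > 0}"
  have Uo: "open U"
  proof -
    have "open (P -` {0<..} \<inter> uhp)"
      using Pc(1) by (simp add: continuous_on_open_vimage[OF open_uhp])
    moreover have "P -` {0<..} \<inter> uhp = U" by (auto simp: U_def)
    ultimately show ?thesis by simp
  qed
  have Uu: "U \<subseteq> uhp" by (auto simp: U_def)
  have XU: "X \<subseteq> U"
  proof
    fix z assume z: "z \<in> X"
    then have zu: "z \<in> uhp" using F(5) by auto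
    obtain A where A: "A \<in> matrices_of \<Gamma>" "moebius A z \<in> K" using cover[OF zu] by blast
    have "F (moebius A z) > 0" using F(7) A by blast
    moreover have "A \<in> S" using A z F(7,8) unfolding S_def by blast
    ultimately have "P z > 0" unfolding P_def using F(6) finS by (intro sum_pos2[of _ A]) auto
    then show "z \<in> U" using zu by (simp add: U_def)
  qed
  have Pnz: "complex_of_real (P z) \<noteq> 0" if "z \<in> U" for z using that by (simp add: U_def)
  have PcU: "continuous_on U (\<lambda>z. complex_of_real (P z))" "continuous_on U aP" "continuous_on U bP"
    using Pc Uu by (auto intro!: continuous_intros intro: continuous_on_subset)
  have FcU: "continuous_on U (\<lambda>z. complex_of_real (F z))" "continuous_on U aF" "continuous_on U bF"
    using Fc F(2,3) by (auto intro!: continuous_intros intro: continuous_on_subset)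
  \<comment> \<open>Both sides are the sum over all matrices of the group; only finitely many summands, with
    different index sets, are nonzero.\<close>
  have Pinv: "P (moebius B w) = P w" if B: "B \<in> matrices_of \<Gamma>" and w: "w \<in> X" "moebius B w \<in> X" for B w
    unfolding P_def
  proof (rule sum.reindex_bij_witness_not_neutral[where
        S'="{A \<in> S. F (moebius A (moebius B w)) = 0}" and T'="{A \<in> S. F (moebius A w) = 0}"
        and i="\<lambda>C. C ** adjugate2 B" and j="\<lambda>A. A ** B"])
    have dB: "det B = 1" and wu: "w \<in> uhp" using matrices_of_det B w F(5) by auto
    note [simp] = adjugate2_mult[OF dB]
    have mAB: "moebius (A ** B) w = moebius A (moebius B w)" if "A \<in> S" for A
      by (rule moebius_mult[OF SM(2)[OF that] dB wu])
    have mCB: "moebius (C ** adjugate2 B) (moebius B w) = moebius C w" if "C \<in> S" for C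
      using moebius_mult[OF SM(2)[OF that], of "adjugate2 B" "moebius B w"] dB wu
        moebius_in_uhp[OF dB wu] moebius_adjugate2[OF dB wu]
      by simp
    show "A ** B ** adjugate2 B = A" for A by (simp flip: matrix_mul_assoc)
    show "C ** adjugate2 B ** B = C" for C by (simp flip: matrix_mul_assoc)
    show "A ** B \<in> S - {A \<in> S. F (moebius A w) = 0}"
        if A: "A \<in> S - {A \<in> S. F (moebius A (moebius B w)) = 0}" for A
    proof -
      have "F (moebius A (moebius B w)) > 0" using A F(6)[of "moebius A (moebius B w)"] by auto
      then have "moebius A (moebius B w) \<in> X" by (rule F(8))
      then show ?thesis using A mAB[of A] w matrices_of_mult[OF G _ B, of A] unfolding S_def
        by (auto intro!: bexI[of _ w])
    qed
    show "C ** adjugate2 B \<in> S - {A \<in> S. F (moebius A (moebius B w)) = 0}"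
        if C: "C \<in> S - {A \<in> S. F (moebius A w) = 0}" for C
    proof -
      have "F (moebius C w) > 0" using C F(6)[of "moebius C w"] by auto
      then have "moebius C w \<in> X" by (rule F(8))
      then show ?thesis using C mCB[of C] w matrices_of_mult[OF G _ matrices_of_adjugate2[OF G B], of C]
        unfolding S_def by (auto intro!: bexI[of _ "moebius B w"])
    qed
    show "F (moebius (A ** B) w) = F (moebius A (moebius B w))" if "A \<in> S" for A
      using mAB that by auto
  qed (use finS in auto)
  define q where "q = (\<lambda>z. if z \<in> U then F z / P z else 0)"
  define aq
      where "aq = (\<lambda>z. if z \<in> U then (aF z * of_real (P z) - of_real (F z) * aP z) / (of_real (P z))\<^sup>2
          else 0)"
  define bq
      where "bq = (\<lambda>z. if z \<in> U then (bF z * of_real (P z) - of_real (F z) * bP z) / (of_real (P z))\<^sup>2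
          else 0)"
  have q0: "q z = 0" "aq z = 0" "bq z = 0" if "z \<notin> X" for z
    using F(9)[OF that] by (auto simp: q_def aq_def bq_def)
  have "continuous_on UNIV (\<lambda>z. if z \<in> U then complex_of_real (F z) / of_real (P z) else 0)"
    by (rule continuous_zero_extension[OF Uo F(4) XU])
      (use Pnz F(9) in \<open>auto intro!: continuous_intros FcU PcU\<close>)
  then have "continuous_on UNIV (\<lambda>z. Re (if z \<in> U then complex_of_real (F z) / of_real (P z) else 0))"
    by (intro continuous_intros)
  moreover have "(\<lambda>z. Re (if z \<in> U then complex_of_real (F z) / of_real (P z) else 0)) = q"
    by (auto simp: q_def fun_eq_iff simp flip: of_real_divide)
  ultimately have qc: "continuous_on UNIV q" by (simp only:)
  have qw: "wirtinger (\<lambda>w. of_real (q w)) (aq z) (bq z) z" if z: "z \<in> U" for z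
  proof -
    have "wirtinger (\<lambda>w. of_real (F w) * inverse (of_real (P w))) (aF z * inverse (of_real (P z)) +
        of_real (F z) * (- aP z / (of_real (P z))\<^sup>2))
        (bF z * inverse (of_real (P z)) + of_real (F z) * (- bP z / (of_real (P z))\<^sup>2)) z"
      using z Uu Pnz by (intro wirtinger_mult wirtinger_inverse Pw F) auto
    moreover have "aF z * inverse (of_real (P z)) + of_real (F z) * (- aP z / (of_real (P z))\<^sup>2) = aq z"
      "bF z * inverse (of_real (P z)) + of_real (F z) * (- bP z / (of_real (P z))\<^sup>2) = bq z"
      using z Pnz[OF z] by (simp_all add: aq_def bq_def field_simps power2_eq_square)
    ultimately have "wirtinger (\<lambda>w. of_real (F w) * inverse (of_real (P w))) (aq z) (bq z) z" by simp
    then show ?thesis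
      by (rule wirtinger_transform[OF _ Uo z]) (simp add: q_def divide_inverse)
  qed
  have aqc: "continuous_on U aq" "continuous_on U bq"
  proof -
    have "continuous_on U (\<lambda>z. (aF z * of_real (P z) - of_real (F z) * aP z) / (of_real (P z))\<^sup>2)"
      "continuous_on U (\<lambda>z. (bF z * of_real (P z) - of_real (F z) * bP z) / (of_real (P z))\<^sup>2)"
      using Pnz by (auto intro!: continuous_intros FcU PcU)
    then show "continuous_on U aq" "continuous_on U bq"
      by (auto simp: aq_def bq_def cong: continuous_on_cong)
  qed
  show ?thesis
  proof (intro exI[of _ q] exI[of _ X], unfold averaging_weight_def, intro conjI allI ballI impI)
    show "compact X" "X \<subseteq> uhp" "continuous_on UNIV q" using F qc by auto
    show "q z \<ge> 0" for z using F(6) by (auto simp: q_def U_def)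
    show "q z > 0" if "z \<in> K" for z
    proof -
      have "F z > 0" "z \<in> U" using F(7,8) XU that by blast+
      then show ?thesis by (auto simp: q_def U_def)
    qed
    show "q z = 0" if "z \<notin> X" for z using q0 that by simp
    fix \<Theta> a b
    assume form: "smooth_weight2_form \<Gamma> \<Theta> a b"
    have \<Theta>w: "\<And>z. z \<in> uhp \<Longrightarrow> wirtinger \<Theta> (a z) (b z) z" and ac: "continuous_on uhp a" and bc:
        "continuous_on uhp b"
      and inv: "\<And>A z. A \<in> matrices_of \<Gamma> \<Longrightarrow> z \<in> uhp \<Longrightarrow> \<Theta> (moebius A z) = (automorphy A z)\<^sup>2 * \<Theta> z"
      using form by (simp_all add: smooth_weight2_form_def)
    have \<Theta>c: "continuous_on U \<Theta>" using \<Theta>w Uu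
      by (meson continuous_at_imp_continuous_on wirtinger_continuous subsetD)
    have acU: "continuous_on U a" "continuous_on U b" using ac bc Uu
      by (auto intro: continuous_on_subset)
    have qcU: "continuous_on U (\<lambda>z. complex_of_real (q z))"
      by (intro continuous_intros continuous_on_subset[OF qc]) auto
    note cU = acU qcU \<Theta>c aqc FcU PcU
    define aG where "aG = (\<lambda>z. if z \<in> U then aq z * \<Theta> z + of_real (q z) * a z else 0)"
    define bG where "bG = (\<lambda>z. if z \<in> U then bq z * \<Theta> z + of_real (q z) * b z else 0)"
    have Gw: "wirtinger (\<lambda>w. of_real (q w) * \<Theta> w) (aG z) (bG z) z" for z
    proof (cases "z \<in> U")
      case True
      then show ?thesis using wirtinger_mult[OF qw[OF True] \<Theta>w] Uu unfolding aG_def bG_def by auto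
    next
      case False
      then have zX: "z \<in> - X" using XU by auto
      have "wirtinger (\<lambda>_. 0) 0 0 z" by (rule wirtinger_const)
      then have "wirtinger (\<lambda>w. of_real (q w) * \<Theta> w) 0 0 z"
        by (rule wirtinger_transform[OF _ _ zX]) (use q0 compact_imp_closed[OF F(4)] in auto)
      then show ?thesis using False by (simp add: aG_def bG_def)
    qed
    have aGc: "continuous_on UNIV aG" "continuous_on UNIV bG"
      unfolding aG_def bG_def
      by (rule continuous_zero_extension[OF Uo F(4) XU]; use q0 in \<open>auto intro!: continuous_intros cU\<close>)+
    have IG: "integral\<^sup>L lborel bG = 0"
      by (rule integral_dbar_compact_support[OF Gw aGc F(4)]) (use q0 in auto)
    \<comment> \<open>The summands of the two terms of the quotient rule.\<close>
    define T where
        "T = (\<lambda>A z. if z \<in> U then \<Theta> z * of_real (F (moebius A z)) * bF z / (of_real (P z))\<^sup>2 else 0)"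
    define V where
        "V = (\<lambda>A z. if z \<in> U then \<Theta> z * of_real (F z) * (bF (moebius A z) * cnj (J A z)) / (of_real (P
            z))\<^sup>2 else 0)"
    have cmA: "continuous_on U (\<lambda>z. complex_of_real (F (moebius A z)))"
        "continuous_on U (\<lambda>z. bF (moebius A z))"
       "continuous_on U (J A)" if "A \<in> S" for A
      using comp[OF Fc that] comp[OF F(3) that] Jc[OF that] Uu
        by (auto intro!: continuous_intros intro: continuous_on_subset)
    have Tc: "continuous_on UNIV (T A)" "continuous_on UNIV (V A)" if "A \<in> S" for A
      unfolding T_def V_def
      by (rule continuous_zero_extension[OF Uo F(4) XU]; use F(9) Pnz in \<open>auto intro!: continuous_intros
        cU cmA[OF that]\<close>)+
    have T0: "T A z = 0" "V A z = 0" if "z \<notin> X" for A z using F(9)[OF that] by (auto simp: T_def V_def)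
    have Ti: "integrable lborel (T A)" "integrable lborel (V A)" if "A \<in> S" for A
      using integrable_compact_support[OF _ F(4)] Tc[OF that] T0 by blast+
    have adjS: "adjugate2 A \<in> S" if "A \<in> S" for A
    proof -
      obtain z where z: "z \<in> X" "moebius A z \<in> X" using \<open>A \<in> S\<close> by (auto simp: S_def)
      then have "moebius (adjugate2 A) (moebius A z) = z" using moebius_adjugate2 SM[OF that] F(5)
        by blast
      then show ?thesis using z matrices_of_adjugate2[OF G SM(1)[OF that]] unfolding S_def
        by (auto intro!: bexI[of _ "moebius A z"])
    qed
    have TV: "integral\<^sup>L lborel (T A) = integral\<^sup>L lborel (V (adjugate2 A))" if A: "A \<in> S" for A
    proof -
      define B where "B = adjugate2 A"
      have B: "B \<in> S" "det B = 1" "B \<in> matrices_of \<Gamma>"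
        using adjS[OF A] SM(1)[OF adjS[OF A]] SM(2)[OF adjS[OF A]] by (auto simp: B_def)
      have AB: "moebius A (moebius B w) = w" "moebius B (moebius A w) = w" if "w \<in> uhp" for w
        using moebius_adjugate2[OF SM(2)[OF A] that] by (auto simp: B_def)
      have inj: "inj_on (moebius B) uhp" using AB by (metis inj_onI)
      have img: "moebius B ` uhp = uhp"
        using AB mu[OF A] mu[OF B(1)]
          by (metis (no_types, lifting) image_subset_iff image_iff subsetI subset_antisym)
      have out: "T A z = 0" if "z \<notin> moebius B ` uhp" for z
      proof (rule T0(1))
        show "z \<notin> X" using that F(5) unfolding img by blast
      qed
      have "integral\<^sup>L lborel (T A) = integral\<^sup>L lborel (\<lambda>w. if w \<in> uhp then of_real ((norm (J B w))\<^sup>2)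
          * T A (moebius B w) else 0)"
        by (rule integral_holomorphic_substitution[OF open_uhp dmoeb[OF B(1)] inj Ti(1)[OF A] out])
      also have "(\<lambda>w. if w \<in> uhp then of_real ((norm (J B w))\<^sup>2) * T A (moebius B w) else 0) = V B"
      proof
        fix w
        show "(if w \<in> uhp then of_real ((norm (J B w))\<^sup>2) * T A (moebius B w) else 0) = V B w"
        proof (cases "w \<in> X \<and> moebius B w \<in> X")
          case True
          then have wu: "w \<in> uhp" "w \<in> U" "moebius B w \<in> U" using F(5) XU by auto
          have nz: "automorphy B w \<noteq> 0" by (rule automorphy_nonzero[OF B(2) wu(1)])
          have JJ: "of_real ((norm (J B w))\<^sup>2) * (automorphy B w)\<^sup>2 = cnj (J B w)"
            using nz complex_norm_square[of "J B w"] by (simp add: J_def)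
          have "of_real ((norm (J B w))\<^sup>2) * T A (moebius B w) =
             of_real ((norm (J B w))\<^sup>2) * (automorphy B w)\<^sup>2 * \<Theta> w * of_real (F w) * bF (moebius B w) /
                 (of_real (P w))\<^sup>2"
            using wu Pinv[OF B(3)] True inv[OF B(3) wu(1)] AB(1)[OF wu(1)] by (simp add: T_def mult_ac)
          then show ?thesis using wu unfolding JJ by (simp add: V_def mult_ac)
        next
          case False
          have "V B w = 0" using False F(9) by (auto simp: V_def)
          moreover have "T A (moebius B w) = 0" if "w \<in> uhp"
            using False F(9)[of w] F(9)[of "moebius B w"] AB(1)[OF that] by (auto simp: T_def)
          ultimately show ?thesis by auto
        qed
      qed
      finally show ?thesis by (simp add: B_def)
    qed
    have "integral\<^sup>L lborel (\<lambda>z. \<Sum>A\<in>S. T A z) = (\<Sum>A\<in>S. integral\<^sup>L lborel (T A))"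
      by (rule Bochner_Integration.integral_sum) (rule Ti)
    also have "\<dots> = (\<Sum>A\<in>S. integral\<^sup>L lborel (V (adjugate2 A)))" by (intro sum.cong TV refl)
    also have "\<dots> = (\<Sum>A\<in>S. integral\<^sup>L lborel (V A))"
      by (rule sum.reindex_bij_witness[of _ adjugate2 adjugate2]) (use adjS in auto)
    also have "\<dots> = integral\<^sup>L lborel (\<lambda>z. \<Sum>A\<in>S. V A z)"
      by (rule Bochner_Integration.integral_sum[symmetric]) (rule Ti)
    finally have eqTV: "integral\<^sup>L lborel (\<lambda>z. \<Sum>A\<in>S. T A z) = integral\<^sup>L lborel (\<lambda>z. \<Sum>A\<in>S. V A z)" .
    have sumT: "(\<Sum>A\<in>S. T A z) - (\<Sum>A\<in>S. V A z) = bq z * \<Theta> z" for z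
    proof (cases "z \<in> U")
      case True
      have 1: "(\<Sum>A\<in>S. T A z) = \<Theta> z * of_real (P z) * bF z / (of_real (P z))\<^sup>2"
        using True by (simp add: T_def P_def sum_distrib_left sum_distrib_right sum_divide_distrib)
      have 2: "(\<Sum>A\<in>S. V A z) = \<Theta> z * of_real (F z) * bP z / (of_real (P z))\<^sup>2"
        using True by (simp add: V_def bP_def sum_distrib_left sum_distrib_right sum_divide_distrib)
      show ?thesis unfolding 1 2 using True
        by (simp add: bq_def diff_divide_distrib[symmetric] algebra_simps)
    qed (simp add: T_def V_def bq_def)
    have qb: "of_real (q z) * b z = bG z - ((\<Sum>A\<in>S. T A z) - (\<Sum>A\<in>S. V A z))" for z
      unfolding sumT by (auto simp: bG_def q_def bq_def)
    have "integral\<^sup>L lborel (\<lambda>z. bG z - ((\<Sum>A\<in>S. T A z) - (\<Sum>A\<in>S. V A z))) =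
       integral\<^sup>L lborel bG - (integral\<^sup>L lborel (\<lambda>z. \<Sum>A\<in>S. T A z) - integral\<^sup>L lborel (\<lambda>z. \<Sum>A\<in>S. V A
           z))"
    proof -
      have "integrable lborel bG"
        by (rule integrable_compact_support[OF aGc(2) F(4)]) (use q0 in \<open>auto simp: bG_def\<close>)
      moreover have "integrable lborel (\<lambda>z. \<Sum>A\<in>S. T A z)" "integrable lborel (\<lambda>z. \<Sum>A\<in>S. V A z)"
        by (intro Bochner_Integration.integrable_sum Ti; assumption)+
      ultimately show ?thesis by simp
    qed
    then show "integral\<^sup>L lborel (\<lambda>z. of_real (q z) * b z) = 0" unfolding qb using IG eqTV by simp
  qed
qed

section \<open>Orders and weights of meromorphic functions\<close>

lemma connected_uhp: "connected uhp"
  unfolding uhp_def by (rule convex_connected) (rule convex_halfspace_Im_gt)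

lemma cosparse_uhp_iff: "(\<forall>\<^sub>\<approx>z\<in>uhp. Q z) \<longleftrightarrow> (\<forall>z\<in>uhp. \<forall>\<^sub>F w in at z. Q w)"
  by (rule eventually_cosparse_open_eq[OF open_uhp])

lemma cosparse_uhp_nhds:
  assumes "\<forall>\<^sub>\<approx>z\<in>uhp. Q z"
  shows "\<forall>\<^sub>\<approx>z\<in>uhp. \<forall>\<^sub>F w in nhds z. Q w"
  unfolding cosparse_uhp_iff
proof
  fix z assume "z \<in> uhp"
  then have "\<forall>\<^sub>F w in at z. Q w" using assms unfolding cosparse_uhp_iff by blast
  then obtain S where S: "open S" "z \<in> S" "\<And>w. w \<in> S - {z} \<Longrightarrow> Q w"
    by (auto simp: eventually_at_topological)
  have "\<forall>\<^sub>F w in at z. w \<in> S - {z}" using S by (intro eventually_at_in_open) auto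
  then show "\<forall>\<^sub>F w in at z. \<forall>\<^sub>F v in nhds w. Q v"
  proof eventually_elim
    case (elim w)
    then have "\<forall>\<^sub>F v in nhds w. v \<in> S - {z}" using S by (intro eventually_nhds_in_open open_delete) auto
    then show ?case by eventually_elim (rule S(3))
  qed
qed

lemma filterlim_moebius_at:
  assumes "det A = 1" "z \<in> uhp"
  shows "filterlim (moebius A) (at (moebius A z)) (at z)"
  unfolding filterlim_at
proof
  show "(moebius A \<longlongrightarrow> moebius A z) (at z)"
    using DERIV_isCont[OF has_field_derivative_moebius[OF assms]] by (simp add: isCont_def)
  have "\<forall>\<^sub>F w in at z. w \<in> uhp - {z}" using eventually_at_in_open[OF open_uhp assms(2)] by simp
  then show "\<forall>\<^sub>F w in at z. moebius A w \<in> UNIV \<and> moebius A w \<noteq> moebius A z"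
  proof eventually_elim
    case (elim w)
    then have "moebius A w - moebius A z \<noteq> 0"
      using moebius_diff[OF assms(1), of w z] automorphy_nonzero[OF assms(1)] assms(2) by auto
    then show ?case by simp
  qed
qed

lemma cosparse_uhp_moebius:
  assumes "det A = 1" "\<forall>\<^sub>\<approx>z\<in>uhp. Q z"
  shows "\<forall>\<^sub>\<approx>z\<in>uhp. Q (moebius A z)"
  unfolding cosparse_uhp_iff
proof
  fix z assume z: "z \<in> uhp"
  have "\<forall>\<^sub>F w in at (moebius A z). Q w"
    using assms(2) moebius_in_uhp[OF assms(1) z] unfolding cosparse_uhp_iff by blast
  then show "\<forall>\<^sub>F w in at z. Q (moebius A w)"
    using filterlim_moebius_at[OF assms(1) z] by (simp add: filterlim_iff)
qed

lemma cosparse_analytic: "\<forall>\<^sub>\<approx>z\<in>uhp. eval_mero f analytic_on {z}"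
  by (rule meromorphic_on_imp_analytic_cosparse[OF eval_mero_meromorphic])

text \<open>
  Taking Laurent expansions at a fixed point is an injective ring homomorphism that commutes with
  derivatives. Questions about orders thereby become questions about formal Laurent series.
\<close>

definition laurent_at :: "mero_uhp \<Rightarrow> complex \<Rightarrow> complex fls" where
  "laurent_at f z = laurent_expansion (eval_mero f) z"

lemma has_laurent_expansion_laurent_at:
  assumes "z \<in> uhp" shows "(\<lambda>w. eval_mero f (z + w)) has_laurent_expansion laurent_at f z"
proof -
  have "eval_mero f meromorphic_on {z}" using assms
    by (intro meromorphic_on_subset[OF eval_mero_meromorphic]) auto
  then show ?thesis unfolding laurent_at_def
    by (auto simp: meromorphic_on_def laurent_expansion_eqI)
qed

lemma laurent_at_eqI:
  assumes "z \<in> uhp" "(\<lambda>w. g (z + w)) has_laurent_expansion G" "\<forall>\<^sub>\<approx>z\<in>uhp. eval_mero f z = g z"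
  shows "laurent_at f z = G"
proof -
  have "\<forall>\<^sub>F w in at z. eval_mero f w = g w" using assms(1,3) unfolding cosparse_uhp_iff by blast
  then have "(\<lambda>w. eval_mero f (z + w)) has_laurent_expansion G"
    using assms(2) has_laurent_expansion_cong'[of "eval_mero f" g z G G z] by simp
  then show ?thesis unfolding laurent_at_def by (rule laurent_expansion_eqI)
qed

lemma laurent_at_0: "z \<in> uhp \<Longrightarrow> laurent_at 0 z = 0" and laurent_at_1: "z \<in> uhp \<Longrightarrow> laurent_at 1 z = 1"
  and laurent_at_add: "z \<in> uhp \<Longrightarrow> laurent_at (f + g) z = laurent_at f z + laurent_at g z"
  and laurent_at_diff: "z \<in> uhp \<Longrightarrow> laurent_at (f - g) z = laurent_at f z - laurent_at g z"
  and laurent_at_uminus: "z \<in> uhp \<Longrightarrow> laurent_at (- f) z = - laurent_at f z"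
  and laurent_at_mult: "z \<in> uhp \<Longrightarrow> laurent_at (f * g) z = laurent_at f z * laurent_at g z"
proof -
  assume z: "z \<in> uhp"
  note L = has_laurent_expansion_laurent_at[OF z]
  show "laurent_at 0 z = 0"
    by (rule laurent_at_eqI[OF z _ eval_mero_ops_cosparse(1)]) (rule has_laurent_expansion_0)
  show "laurent_at 1 z = 1"
    by (rule laurent_at_eqI[OF z _ eval_mero_ops_cosparse(2)])
      (use has_laurent_expansion_const[of 1] in simp)
  show "laurent_at (f + g) z = laurent_at f z + laurent_at g z"
    by (rule laurent_at_eqI[OF z _ eval_mero_ops_cosparse(3)]) (intro has_laurent_expansion_add L)
  show "laurent_at (f - g) z = laurent_at f z - laurent_at g z"
    by (rule laurent_at_eqI[OF z _ eval_mero_ops_cosparse(4)]) (intro has_laurent_expansion_diff L)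
  show "laurent_at (- f) z = - laurent_at f z"
    by (rule laurent_at_eqI[OF z _ eval_mero_ops_cosparse(5)]) (intro has_laurent_expansion_minus L)
  show "laurent_at (f * g) z = laurent_at f z * laurent_at g z"
    by (rule laurent_at_eqI[OF z _ eval_mero_ops_cosparse(6)]) (intro has_laurent_expansion_mult L)
qed

lemma eval_mero_const_cosparse: "\<forall>\<^sub>\<approx>z\<in>uhp. eval_mero (mero_const c) z = c"
  unfolding mero_const_def by (rule eval_mero_of_cosparse) (intro meromorphic_intros)

lemma laurent_at_const: "z \<in> uhp \<Longrightarrow> laurent_at (mero_const c) z = fls_const c"
  by (rule laurent_at_eqI[OF _ _ eval_mero_const_cosparse]) auto

lemma laurent_at_deriv: assumes z: "z \<in> uhp" shows
    "laurent_at (mero_deriv f) z = fls_deriv (laurent_at f z)"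
proof (rule laurent_at_eqI[OF z _ eval_mero_deriv_cosparse])
  have "deriv (\<lambda>w. eval_mero f (z + w)) has_laurent_expansion fls_deriv (laurent_at f z)"
    by (rule has_laurent_expansion_deriv[OF has_laurent_expansion_laurent_at[OF z]])
  moreover have "deriv (\<lambda>w. eval_mero f (z + w)) = (\<lambda>w. deriv (eval_mero f) (z + w))"
    using DERIV_shift[of "eval_mero f" _ _ z] by (simp add: fun_eq_iff deriv_def add.commute)
  ultimately show "(\<lambda>w. deriv (eval_mero f) (z + w)) has_laurent_expansion fls_deriv (laurent_at f z)"
    by simp
qed

lemma eventually_nonzero:
  assumes "f \<noteq> 0" shows "\<forall>\<^sub>\<approx>z\<in>uhp. eval_mero f z \<noteq> 0"
proof (rule ccontr)
  assume "\<not> ?thesis"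
  then have "\<forall>x\<in>uhp. eval_mero f x = 0"
    using nicely_meromorphic_imp_constant_or_avoid[OF eval_mero_nicely open_uhp connected_uhp, of f 0]
      by blast
  then have "\<forall>\<^sub>\<approx>z\<in>uhp. eval_mero f z = eval_mero 0 z"
    using eval_mero_ops_cosparse(1) eventually_in_cosparse[OF subset_refl open_uhp]
    by (auto elim: eventually_elim2)
  then have "f = 0" by (rule eval_mero_eqI)
  with assms show False by simp
qed

lemma laurent_at_eq_0_iff: assumes z: "z \<in> uhp" shows "laurent_at f z = 0 \<longleftrightarrow> f = 0"
proof
  assume L: "laurent_at f z = 0"
  show "f = 0"
  proof (rule ccontr)
    assume "f \<noteq> 0"
    then have "\<forall>\<^sub>F w in at z. eval_mero f w \<noteq> 0" using eventually_nonzero z unfolding cosparse_uhp_iff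
      by blast
    then show False
      using has_laurent_expansion_eventually_nonzero_iff[OF has_laurent_expansion_laurent_at[OF z]] L
        by blast
  qed
qed (simp add: laurent_at_0[OF z])

lemma i_in_uhp: "\<i> \<in> uhp" by (simp add: uhp_def)

lemma mero_eqI_laurent_at: "laurent_at f \<i> = laurent_at g \<i> \<Longrightarrow> f = g"
  using laurent_at_eq_0_iff[OF i_in_uhp, of "f - g"] laurent_at_diff[OF i_in_uhp, of f g] by simp

text \<open>
  Formal Laurent series over a field form an integral domain.
\<close>

lemma mero_no_zero_divisors: "f * g = 0 \<longleftrightarrow> f = 0 \<or> g = (0 :: mero_uhp)"
  using laurent_at_eq_0_iff[OF i_in_uhp] laurent_at_mult[OF i_in_uhp, of f g] by (metis mult_eq_0_iff)

lemma mero_const_add: "mero_const (a + b) = mero_const a + mero_const b"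
  and mero_const_diff: "mero_const (a - b) = mero_const a - mero_const b"
  and mero_const_mult: "mero_const (a * b) = mero_const a * mero_const b"
  and mero_const_0: "mero_const 0 = 0" and mero_const_1: "mero_const 1 = 1"
  and mero_const_of_int: "mero_const (of_int k) = of_int k"
proof -
  show "mero_const 0 = 0" "mero_const 1 = 1" by (simp_all add: zero_mero_uhp_def one_mero_uhp_def)
  show "mero_const (a + b) = mero_const a + mero_const b"
      "mero_const (a - b) = mero_const a - mero_const b"
     "mero_const (a * b) = mero_const a * mero_const b"
    by (rule mero_eqI_laurent_at, simp add: i_in_uhp laurent_at_const laurent_at_add laurent_at_diff
      laurent_at_mult fls_plus_const fls_minus_const)+
  have laurent_at_nat: "laurent_at (of_nat n) \<i> = of_nat n" for n
    by (induction n) (simp_all add: i_in_uhp laurent_at_add laurent_at_0 laurent_at_1)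
  have "laurent_at (of_int k) \<i> = of_int k"
    by (cases k) (simp_all add: laurent_at_nat laurent_at_diff laurent_at_uminus i_in_uhp laurent_at_add
      laurent_at_1)
  then show "mero_const (of_int k) = of_int k"
    by (intro mero_eqI_laurent_at) (simp add: i_in_uhp laurent_at_const fls_of_int)
qed

lemma mero_deriv_mult: "mero_deriv (f * g) = mero_deriv f * g + f * mero_deriv g"
  by (rule mero_eqI_laurent_at) (simp add: i_in_uhp laurent_at_deriv laurent_at_mult laurent_at_add
    algebra_simps)

lemma mero_deriv_const: "mero_deriv (mero_const c) = 0"
  by (rule mero_eqI_laurent_at) (simp add: i_in_uhp laurent_at_deriv laurent_at_const laurent_at_0)

definition ord :: "mero_uhp \<Rightarrow> complex \<Rightarrow> int" where "ord f z = fls_subdegree (laurent_at f z)"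

text \<open>
  The order of the zero function is infinite; in contrast to \<open>ord\<close>, this predicate says so.
\<close>

definition ord_ge :: "mero_uhp \<Rightarrow> complex \<Rightarrow> int \<Rightarrow> bool" where
  "ord_ge f z m \<longleftrightarrow> (\<forall>n<m. fls_nth (laurent_at f z) n = 0)"

lemma ord_ge_iff: assumes "z \<in> uhp" shows "ord_ge f z m \<longleftrightarrow> f = 0 \<or> m \<le> ord f z"
proof (cases "f = 0")
  case False
  then have "laurent_at f z \<noteq> 0" using laurent_at_eq_0_iff assms by blast
  then show ?thesis using False unfolding ord_ge_def ord_def
    by (meson fls_eq0_below_subdegree fls_subdegree_geI less_le_trans)
qed (simp add: ord_ge_def laurent_at_0 assms)

lemma ord_ge_0: "z \<in> uhp \<Longrightarrow> ord_ge 0 z m" by (simp add: ord_ge_iff)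

lemma ord_ge_mono: "ord_ge f z m \<Longrightarrow> n \<le> m \<Longrightarrow> ord_ge f z n" by (auto simp: ord_ge_def)

lemma ord_ge_add: "z \<in> uhp \<Longrightarrow> ord_ge f z m \<Longrightarrow> ord_ge g z m \<Longrightarrow> ord_ge (f + g) z m"
  and ord_ge_diff: "z \<in> uhp \<Longrightarrow> ord_ge f z m \<Longrightarrow> ord_ge g z m \<Longrightarrow> ord_ge (f - g) z m"
  by (auto simp: ord_ge_def laurent_at_add laurent_at_diff)

lemma ord_mult: "z \<in> uhp \<Longrightarrow> f \<noteq> 0 \<Longrightarrow> g \<noteq> 0 \<Longrightarrow> ord (f * g) z = ord f z + ord g z"
  by (simp add: ord_def laurent_at_mult laurent_at_eq_0_iff)

lemma ord_ge_mult: "z \<in> uhp \<Longrightarrow> ord_ge f z m \<Longrightarrow> ord_ge g z n \<Longrightarrow> ord_ge (f * g) z (m + n)"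
  using ord_mult[of z f g] by (cases "f = 0 \<or> g = 0") (auto simp: ord_ge_iff)

lemma ord_const: "z \<in> uhp \<Longrightarrow> ord (mero_const c) z = 0" by (simp add: ord_def laurent_at_const)

lemma ord_ge_const: "z \<in> uhp \<Longrightarrow> ord_ge (mero_const c) z 0" by (simp add: ord_ge_iff ord_const)

lemma ord_ge_cmult: "z \<in> uhp \<Longrightarrow> ord_ge f z m \<Longrightarrow> ord_ge (mero_const c * f) z m"
  using ord_ge_mult[OF _ ord_ge_const] by fastforce

lemma ord_ge_of_int_mult: "z \<in> uhp \<Longrightarrow> ord_ge f z m \<Longrightarrow> ord_ge (of_int k * f) z m"
  by (metis ord_ge_cmult mero_const_of_int)

lemma ord_ge_deriv: "z \<in> uhp \<Longrightarrow> ord_ge f z m \<Longrightarrow> ord_ge (mero_deriv f) z (m - 1)"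
  by (auto simp: ord_ge_def laurent_at_deriv)

text \<open>
  The derivative of a power series has no term of exponent \<open>-1\<close>, since the factor 0 kills it.
\<close>

lemma ord_ge_deriv_0: "z \<in> uhp \<Longrightarrow> ord_ge f z 0 \<Longrightarrow> ord_ge (mero_deriv f) z 0"
proof -
  assume z: "z \<in> uhp" and f: "ord_ge f z 0"
  have "of_int (n + 1) * fls_nth (laurent_at f z) (n + 1) = 0" if "n < 0" for n
    using f that by (cases "n = -1") (auto simp: ord_ge_def)
  then show ?thesis unfolding ord_ge_def laurent_at_deriv[OF z] fls_deriv_nth by blast
qed

lemma ord_add_less:
  assumes "z \<in> uhp" "f \<noteq> 0" "ord_ge g z (ord f z + 1)"
  shows "f + g \<noteq> 0" "ord (f + g) z = ord f z"
proof -
  have L: "laurent_at f z \<noteq> 0" using assms laurent_at_eq_0_iff by blast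
  have n: "fls_nth (laurent_at (f + g) z) (ord f z) \<noteq> 0"
    using assms L by (simp add: laurent_at_add ord_ge_def ord_def)
  then have "laurent_at (f + g) z \<noteq> 0" by auto
  then show "f + g \<noteq> 0" using laurent_at_eq_0_iff assms by blast
  show "ord (f + g) z = ord f z"
    unfolding ord_def
  proof (rule fls_subdegree_eqI)
    show "fls_nth (laurent_at (f + g) z) (fls_subdegree (laurent_at f z)) \<noteq> 0" using n
      by (simp add: ord_def)
    show "fls_nth (laurent_at (f + g) z) k = 0" if "k < fls_subdegree (laurent_at f z)" for k
      using that assms(1,3) by (simp add: laurent_at_add ord_ge_def ord_def)
  qed
qed

lemma ord_deriv:
  assumes "z \<in> uhp" "f \<noteq> 0" "ord f z \<noteq> 0"
  shows "mero_deriv f \<noteq> 0" "ord (mero_deriv f) z = ord f z - 1"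
proof -
  have L: "laurent_at f z \<noteq> 0" using assms laurent_at_eq_0_iff by blast
  have n: "fls_nth (laurent_at (mero_deriv f) z) (ord f z - 1) \<noteq> 0"
    using assms L by (simp add: laurent_at_deriv ord_def)
  then have "laurent_at (mero_deriv f) z \<noteq> 0" by auto
  then show "mero_deriv f \<noteq> 0" using laurent_at_eq_0_iff assms by blast
  show "ord (mero_deriv f) z = ord f z - 1"
    unfolding ord_def
  proof (rule fls_subdegree_eqI)
    show "fls_nth (laurent_at (mero_deriv f) z) (fls_subdegree (laurent_at f z) - 1) \<noteq> 0" using n
      by (simp add: ord_def)
    show "fls_nth (laurent_at (mero_deriv f) z) k = 0" if "k < fls_subdegree (laurent_at f z) - 1" for k
      using that assms(1) by (simp add: laurent_at_deriv)
  qed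
qed

lemma cancel_leading_coefficient:
  assumes z: "z \<in> uhp" and "f \<noteq> 0" "g \<noteq> 0" "ord f z = ord g z"
  obtains c where "ord_ge (f - mero_const c * g) z (ord f z + 1)"
proof
  let ?m = "ord f z"
  define c where "c = fls_nth (laurent_at f z) ?m / fls_nth (laurent_at g z) ?m"
  have L: "laurent_at g z \<noteq> 0" using assms laurent_at_eq_0_iff by blast
  have g: "fls_nth (laurent_at g z) ?m \<noteq> 0" unfolding assms(4) using L by (simp add: ord_def)
  show "ord_ge (f - mero_const c * g) z (?m + 1)"
    unfolding ord_ge_def
  proof safe
    fix n assume "n < ?m + 1"
    then consider "n < ?m" | "n = ?m" by linarith
    then show "fls_nth (laurent_at (f - mero_const c * g) z) n = 0"
    proof cases
      case 1
      then show ?thesis using assms(4)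
        by (simp add: laurent_at_diff laurent_at_mult laurent_at_const z ord_def)
    next
      case 2
      then show ?thesis using g by (simp add: laurent_at_diff laurent_at_mult laurent_at_const z c_def)
    qed
  qed
qed

lemma mero_divide:
  fixes f g :: mero_uhp
  assumes "g \<noteq> 0" obtains h where "f = g * h"
proof
  define h where "h = mero_of (\<lambda>z. eval_mero f z / eval_mero g z)"
  have h: "\<forall>\<^sub>\<approx>z\<in>uhp. eval_mero h z = eval_mero f z / eval_mero g z"
    unfolding h_def by (intro eval_mero_of_cosparse meromorphic_intros)
  show "f = g * h"
    by (rule eval_mero_eqI) (use h eval_mero_ops_cosparse(6)[of g h] eventually_nonzero[OF assms]
      in eventually_elim, simp)
qed

lemma ord_eq_zorder: "z \<in> uhp \<Longrightarrow> f \<noteq> 0 \<Longrightarrow> ord f z = zorder (eval_mero f) z"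
  using has_laurent_expansion_zorder[OF has_laurent_expansion_laurent_at] laurent_at_eq_0_iff
    by (simp add: ord_def)

lemma is_pole_iff_ord: "z \<in> uhp \<Longrightarrow> is_pole (eval_mero f) z \<longleftrightarrow> ord f z < 0"
  unfolding ord_def by (rule is_pole_fls_subdegree_iff[OF has_laurent_expansion_laurent_at])

lemma ord_ge_0_iff: "z \<in> uhp \<Longrightarrow> ord_ge f z 0 \<longleftrightarrow> \<not> is_pole (eval_mero f) z"
  by (auto simp: is_pole_iff_ord ord_ge_iff) (simp add: ord_def laurent_at_0)

lemma analytic_at_nonpole:
  assumes "z \<in> uhp" "\<not> is_pole (eval_mero f) z" shows "eval_mero f analytic_on {z}"
  using nicely_meromorphic_on_imp_analytic_at[OF eval_mero_nicely assms] .

text \<open>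
  The law is required off a sparse set only. The values at poles are normalised to 0 and do not
  obey the identities that define sums and products, so pointwise laws would not be stable under
  the ring operations.
\<close>

definition has_weight :: "(real^2^2) set set \<Rightarrow> int \<Rightarrow> mero_uhp \<Rightarrow> bool" where
  "has_weight \<Gamma> k f \<longleftrightarrow> (\<forall>A\<in>matrices_of \<Gamma>. \<forall>\<^sub>\<approx>z\<in>uhp.
     eval_mero f (moebius A z) = automorphy A z powi k * eval_mero f z)"

lemma has_weight_0: "has_weight \<Gamma> k 0"
  unfolding has_weight_def
proof
  fix A assume "A \<in> matrices_of \<Gamma>"
  then have d: "det A = 1" by (rule matrices_of_det)
  show "\<forall>\<^sub>\<approx>z\<in>uhp. eval_mero 0 (moebius A z) = automorphy A z powi k * eval_mero 0 z"
    using cosparse_uhp_moebius[OF d eval_mero_ops_cosparse(1)] eval_mero_ops_cosparse(1)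
    by eventually_elim simp
qed

lemma has_weight_const: "has_weight \<Gamma> 0 (mero_const c)"
  unfolding has_weight_def
proof
  fix A assume "A \<in> matrices_of \<Gamma>"
  then have d: "det A = 1" by (rule matrices_of_det)
  show "\<forall>\<^sub>\<approx>z\<in>uhp. eval_mero (mero_const c) (moebius A z)
      = automorphy A z powi 0 * eval_mero (mero_const c) z"
    using cosparse_uhp_moebius[OF d eval_mero_const_cosparse[of c]] eval_mero_const_cosparse[of c]
    by eventually_elim simp
qed

lemma has_weight_add:
  assumes "has_weight \<Gamma> k f" "has_weight \<Gamma> k g" shows "has_weight \<Gamma> k (f + g)"
  unfolding has_weight_def
proof
  fix A assume A: "A \<in> matrices_of \<Gamma>"
  show "\<forall>\<^sub>\<approx>z\<in>uhp. eval_mero (f + g) (moebius A z) = automorphy A z powi k * eval_mero (f + g) z"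
    using cosparse_uhp_moebius[OF matrices_of_det[OF A] eval_mero_ops_cosparse(3)[of f g]]
      eval_mero_ops_cosparse(3)[of f g]
      bspec[OF assms(1)[unfolded has_weight_def] A] bspec[OF assms(2)[unfolded has_weight_def] A]
    by eventually_elim (simp add: algebra_simps)
qed

lemma has_weight_mult:
  assumes "has_weight \<Gamma> k f" "has_weight \<Gamma> l g" shows "has_weight \<Gamma> (k + l) (f * g)"
  unfolding has_weight_def
proof
  fix A assume A: "A \<in> matrices_of \<Gamma>"
  show "\<forall>\<^sub>\<approx>z\<in>uhp. eval_mero (f * g) (moebius A z) = automorphy A z powi (k + l) * eval_mero (f * g) z"
    using cosparse_uhp_moebius[OF matrices_of_det[OF A] eval_mero_ops_cosparse(6)[of f g]]
      eval_mero_ops_cosparse(6)[of f g]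
      bspec[OF assms(1)[unfolded has_weight_def] A] bspec[OF assms(2)[unfolded has_weight_def] A]
      eventually_in_cosparse[OF subset_refl open_uhp]
    by eventually_elim (simp add: power_int_add automorphy_nonzero[OF matrices_of_det[OF A]])
qed

lemma has_weight_cmult: "has_weight \<Gamma> k f \<Longrightarrow> has_weight \<Gamma> k (mero_const c * f)"
  using has_weight_mult[OF has_weight_const] by fastforce

lemma has_weight_diff:
  assumes "has_weight \<Gamma> k f" "has_weight \<Gamma> k g" shows "has_weight \<Gamma> k (f - g)"
proof -
  have "f - g = f + mero_const (-1) * g"
    using mero_const_of_int[of "-1"] by simp
  then show ?thesis using assms by (metis has_weight_add has_weight_cmult)
qed

lemma has_weight_divide:
  assumes "has_weight \<Gamma> k f" "has_weight \<Gamma> l g" "g \<noteq> 0" "f = g * h" shows "has_weight \<Gamma> (k - l) h"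
  unfolding has_weight_def
proof
  fix A assume A: "A \<in> matrices_of \<Gamma>"
  note d = matrices_of_det[OF A]
  have m: "\<forall>\<^sub>\<approx>z\<in>uhp. eval_mero f z = eval_mero g z * eval_mero h z"
    using eval_mero_ops_cosparse(6)[of g h] assms(4) by simp
  show "\<forall>\<^sub>\<approx>z\<in>uhp. eval_mero h (moebius A z) = automorphy A z powi (k - l) * eval_mero h z"
    using cosparse_uhp_moebius[OF d m] m cosparse_uhp_moebius[OF d eventually_nonzero[OF assms(3)]]
      bspec[OF assms(1)[unfolded has_weight_def] A] bspec[OF assms(2)[unfolded has_weight_def] A]
      eventually_in_cosparse[OF subset_refl open_uhp] eventually_nonzero[OF assms(3)]
  proof eventually_elim
    case (elim z)
    have n: "automorphy A z \<noteq> 0" by (rule automorphy_nonzero[OF d elim(6)])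
    have "automorphy A z powi l * eval_mero g z * eval_mero h (moebius A z)
        = automorphy A z powi k * (eval_mero g z * eval_mero h z)"
      using elim by metis
    then have "automorphy A z powi l * eval_mero h (moebius A z)
        = automorphy A z powi k * eval_mero h z"
      using elim(7) by simp
    then show ?case using n by (simp add: power_int_diff field_simps)
  qed
qed

lemma modular_forms_has_weight: "f \<in> modular_forms \<Gamma> k \<Longrightarrow> has_weight \<Gamma> k f"
  unfolding has_weight_def modular_forms_def
  using eventually_in_cosparse[OF subset_refl open_uhp] by (auto elim!: eventually_mono)

text \<open>
  The matrix \<open>- mat 1\<close> acts trivially and has automorphy factor \<open>-1\<close>.
\<close>

lemma has_weight_odd:
  assumes "subgroup \<Gamma> PSL2R" "has_weight \<Gamma> k f" "odd k" shows "f = 0"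
proof (rule ccontr)
  assume "f \<noteq> 0"
  have "- mat 1 \<in> matrices_of \<Gamma>" by (intro matrices_of_uminus matrices_of_1 assms)
  from bspec[OF assms(2)[unfolded has_weight_def] this]
  have "\<forall>\<^sub>\<approx>z\<in>uhp. eval_mero f z = - eval_mero f z" using assms(3) by simp
  with eventually_nonzero[OF \<open>f \<noteq> 0\<close>] have "\<forall>\<^sub>\<approx>z\<in>uhp. False"
    by eventually_elim (simp add: eq_neg_iff_add_eq_0)
  then show False using i_in_uhp unfolding cosparse_uhp_iff by (auto simp: trivial_limit_at)
qed

lemma zorder_moebius:
  assumes d: "det A = 1" and z: "z \<in> uhp" and nz: "f \<noteq> 0"
  shows "zorder (\<lambda>w. eval_mero f (moebius A w)) z = ord f (moebius A z)"
proof -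
  have Az: "moebius A z \<in> uhp" by (rule moebius_in_uhp[OF d z])
  have fm: "eval_mero f meromorphic_on {moebius A z}"
    using Az by (intro meromorphic_on_subset[OF eval_mero_meromorphic]) auto
  have holo: "moebius A holomorphic_on uhp"
    using has_field_derivative_moebius[OF d] by (auto simp: holomorphic_on_open[OF open_uhp])
  have an: "moebius A analytic_on {z}"
    by (rule analytic_on_subset[OF holo[folded analytic_on_open[OF open_uhp]]]) (use z in auto)
  have z1: "zorder (\<lambda>x. moebius A x - moebius A z) z = 1"
  proof (rule zorder_eqI[OF open_uhp z])
    show "(\<lambda>x. 1 / (automorphy A x * automorphy A z)) holomorphic_on uhp"
      using automorphy_nonzero[OF d] z unfolding automorphy_def by (intro holomorphic_intros) auto
  qed (use moebius_diff[OF d] z automorphy_nonzero[OF d] in auto)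
  have "zorder (eval_mero f \<circ> moebius A) z = zorder (eval_mero f) (moebius A z) * zorder (\<lambda>x. moebius A
      x - moebius A z) z"
  proof (rule zorder_compose')
    show "isolated_singularity_at (eval_mero f) (moebius A z)"
        "not_essential (eval_mero f) (moebius A z)"
      using fm by (auto simp: meromorphic_at_iff)
    show "\<forall>\<^sub>F w in at z. moebius A w \<noteq> moebius A z" using filterlim_moebius_at[OF d z]
      by (simp add: filterlim_at)
    show "\<forall>\<^sub>F w in at (moebius A z). eval_mero f w \<noteq> 0"
      using eventually_nonzero[OF nz] Az unfolding cosparse_uhp_iff by blast
  qed (rule an)
  then show ?thesis using z1 ord_eq_zorder[OF Az nz] by (simp add: o_def)
qed

lemma automorphy_power_mero:
  assumes "det A = 1"
  obtains a where "a \<noteq> 0" "\<forall>\<^sub>\<approx>z\<in>uhp. eval_mero a z = automorphy A z powi k" "\<forall>z\<in>uhp. ord a z = 0"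
proof -
  define a where "a = mero_of (\<lambda>z. automorphy A z powi k)"
  have a: "\<forall>\<^sub>\<approx>z\<in>uhp. eval_mero a z = automorphy A z powi k"
    unfolding a_def automorphy_def by (intro eval_mero_of_cosparse meromorphic_intros)
  have nz: "a \<noteq> 0"
  proof
    assume 0: "a = 0"
    have "\<forall>\<^sub>\<approx>z\<in>uhp. False"
      using a eval_mero_ops_cosparse(1) eventually_in_cosparse[OF subset_refl open_uhp]
      by eventually_elim (use automorphy_nonzero[OF assms] 0 in auto)
    then show False using i_in_uhp unfolding cosparse_uhp_iff by (auto simp: trivial_limit_at)
  qed
  have "ord a z = 0" if z: "z \<in> uhp" for z
  proof -
    have "zorder (\<lambda>w. automorphy A w powi k) z = 0"
    proof (rule zorder_eq_0I)
      show "(\<lambda>w. automorphy A w powi k) analytic_on {z}"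
        using automorphy_nonzero[OF assms z] unfolding automorphy_def by (intro analytic_intros) auto
    qed (use automorphy_nonzero[OF assms z] in auto)
    moreover have "zorder (eval_mero a) z = zorder (\<lambda>w. automorphy A w powi k) z"
      using a z unfolding cosparse_uhp_iff by (intro zorder_cong) auto
    ultimately show ?thesis using ord_eq_zorder[OF z nz] by simp
  qed
  with a nz show ?thesis by (intro that) auto
qed

text \<open>
  The automorphy factor has neither zeros nor poles in the half plane.
\<close>

lemma ord_has_weight_moebius:
  assumes A: "A \<in> matrices_of \<Gamma>" and f: "has_weight \<Gamma> k f" and z: "z \<in> uhp" and nz: "f \<noteq> 0"
  shows "ord f (moebius A z) = ord f z"
proof -
  note d = matrices_of_det[OF A]
  obtain a where a: "a \<noteq> 0" "\<forall>\<^sub>\<approx>z\<in>uhp. eval_mero a z = automorphy A z powi k" "\<forall>z\<in>uhp. ord a z = 0"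
    by (rule automorphy_power_mero[OF d, of k])
  have "\<forall>\<^sub>\<approx>z\<in>uhp. eval_mero f (moebius A z) = eval_mero (a * f) z"
    using bspec[OF f[unfolded has_weight_def] A] a(2) eval_mero_ops_cosparse(6)[of a f]
      by eventually_elim simp
  then have "zorder (\<lambda>w. eval_mero f (moebius A w)) z = zorder (eval_mero (a * f)) z"
    using z unfolding cosparse_uhp_iff by (intro zorder_cong) auto
  also have "\<dots> = ord (a * f) z" using a(1) nz
    by (subst ord_eq_zorder[OF z]) (auto simp: mero_no_zero_divisors)
  also have "\<dots> = ord f z" using ord_mult[OF z a(1) nz] a(3) z by simp
  finally show ?thesis using zorder_moebius[OF d z nz] by simp
qed

section \<open>A pole that is not simple with residue -1\<close>

lemma eventually_not_pole:
  "z \<in> uhp \<Longrightarrow> \<forall>\<^sub>F w in at z. \<not> is_pole (eval_mero f) w"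
  using meromorphic_on_imp_not_pole_cosparse[OF eval_mero_meromorphic[of f]] unfolding cosparse_uhp_iff
    by blast

lemma quasimodular_law:
  assumes "\<phi> \<in> quasimodular_weight2_delta1 \<Gamma>" "A \<in> matrices_of \<Gamma>" "z \<in> uhp" "\<not> is_pole (eval_mero \<phi>) z"
  shows "eval_mero \<phi> (moebius A z) = (automorphy A z)\<^sup>2 * eval_mero \<phi> z + of_real (A$2$1) * automorphy A
      z"
  using assms by (simp add: quasimodular_weight2_delta1_def)

text \<open>
  Near a point that is not a pole, the transformation law bounds \<open>\<phi> \<circ> A\<close>.
\<close>

lemma pole_moebius:
  assumes G: "subgroup \<Gamma> PSL2R" and \<phi>: "\<phi> \<in> quasimodular_weight2_delta1 \<Gamma>" and A: "A \<in> matrices_of \<Gamma>"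
      and z: "z \<in> uhp"
  shows "is_pole (eval_mero \<phi>) (moebius A z) \<longleftrightarrow> is_pole (eval_mero \<phi>) z"
proof -
  have main: "\<not> is_pole (eval_mero \<phi>) (moebius B w)"
    if B: "B \<in> matrices_of \<Gamma>" and w: "w \<in> uhp" and np: "\<not> is_pole (eval_mero \<phi>) w" for B w
  proof
    note d = matrices_of_det[OF B]
    assume "is_pole (eval_mero \<phi>) (moebius B w)"
    then have "filterlim (\<lambda>u. eval_mero \<phi> (moebius B u)) at_infinity (at w)"
      unfolding is_pole_def by (rule filterlim_compose[OF _ filterlim_moebius_at[OF d w]])
    moreover have "((\<lambda>u. eval_mero \<phi> (moebius B u)) \<longlongrightarrow>
       (automorphy B w)\<^sup>2 * eval_mero \<phi> w + of_real (B$2$1) * automorphy B w) (at w)"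
    proof (rule Lim_transform_eventually)
      have "isCont (eval_mero \<phi>) w" using analytic_at_nonpole[OF w np] analytic_at_imp_isCont by blast
      then have "(eval_mero \<phi> \<longlongrightarrow> eval_mero \<phi> w) (at w)" by (simp add: isCont_def)
      then show "((\<lambda>u. (automorphy B u)\<^sup>2 * eval_mero \<phi> u + of_real (B$2$1) * automorphy B u) \<longlongrightarrow>
       (automorphy B w)\<^sup>2 * eval_mero \<phi> w + of_real (B$2$1) * automorphy B w) (at w)"
        unfolding automorphy_def by (intro tendsto_intros)
      show "\<forall>\<^sub>F u in at w. (automorphy B u)\<^sup>2 * eval_mero \<phi> u + of_real (B$2$1) * automorphy B u
          = eval_mero \<phi> (moebius B u)"
        using eventually_not_pole[OF w, of \<phi>] eventually_at_in_open'[OF open_uhp w]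
        by eventually_elim (simp add: quasimodular_law[OF \<phi> B])
    qed
    ultimately show False using not_tendsto_and_filterlim_at_infinity[of "at w"] by auto
  qed
  note d = matrices_of_det[OF A]
  show ?thesis
    using main[OF A z] main[OF matrices_of_adjugate2[OF G A] moebius_in_uhp[OF d z]]
      moebius_adjugate2(1)[OF d z] by auto
qed

text \<open>
  The inhomogeneous term is the negative of that of \<open>\<phi>\<close>, so \<open>\<phi>(z) + 1 / (z - cnj z)\<close> has weight 2.
\<close>

lemma inverse_z_minus_cnj_moebius:
  assumes "det A = 1" "z \<in> uhp"
  shows "inverse (moebius A z - cnj (moebius A z)) =
     (automorphy A z)\<^sup>2 * inverse (z - cnj z) - of_real (A$2$1) * automorphy A z"
proof -
  let ?j = "automorphy A z"
  have nz: "?j \<noteq> 0" "cnj ?j \<noteq> 0" using automorphy_nonzero[OF assms] by auto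
  have zz: "z - cnj z \<noteq> 0" using assms(2) by (simp add: uhp_def complex_eq_iff)
  have "moebius A z - cnj (moebius A z) = of_real (2 * Im (moebius A z)) * \<i>" by (rule complex_diff_cnj)
  also have "\<dots> = of_real (2 * Im z) * \<i> / of_real ((norm ?j)\<^sup>2)" unfolding Im_moebius[OF assms] by simp
  also have "\<dots> = (z - cnj z) / (?j * cnj ?j)" by (simp only: complex_diff_cnj complex_norm_square)
  finally have 1: "inverse (moebius A z - cnj (moebius A z)) = ?j * cnj ?j / (z - cnj z)" by simp
  have 2: "cnj ?j = ?j - of_real (A$2$1) * (z - cnj z)" by (simp add: automorphy_def algebra_simps)
  show ?thesis unfolding 1 using zz by (simp add: 2 field_simps power2_eq_square)
qed

lemma wirtinger_Im: "wirtinger (\<lambda>w. of_real (Im w)) (1 / (2 * \<i>)) (- (1 / (2 * \<i>))) z"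
proof -
  define k where "k = 1 / (2 * \<i>)"
  have eq: "complex_of_real (Im w) = k * (w - cnj w)" for w
    unfolding k_def complex_diff_cnj by (simp add: complex_eq_iff)
  show ?thesis unfolding eq k_def[symmetric] wirtinger_def
    by (auto intro!: derivative_eq_intros simp: algebra_simps)
qed

lemma wirtinger_inverse_z_minus_cnj:
  assumes "z \<in> uhp"
  shows "wirtinger (\<lambda>w. inverse (w - cnj w)) (- 1 / (z - cnj z)\<^sup>2) (1 / (z - cnj z)\<^sup>2) z"
proof -
  have nz: "z - cnj z \<noteq> 0" using assms by (simp add: uhp_def complex_eq_iff)
  have "wirtinger (\<lambda>w. w - cnj w) (1 - 0) (0 - 1) z"
    by (intro wirtinger_diff wirtinger_ident wirtinger_cnj_ident)
  from wirtinger_inverse[OF this nz] show ?thesis by simp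
qed

text \<open>
  Differentiate the holomorphic function \<open>g(w) = (w - z0) f(w)\<close>, which has the value \<open>r\<close> at \<open>z0\<close>.
\<close>

lemma simple_pole_limits:
  assumes z0: "z0 \<in> uhp" and pole: "is_pole (eval_mero f) z0"
    and lim: "((\<lambda>w. (w - z0) * eval_mero f w) \<longlongrightarrow> r) (at z0)"
  shows "((\<lambda>w. (w - z0)\<^sup>2 * deriv (eval_mero f) w) \<longlongrightarrow> - r) (at z0)"
proof -
  let ?L = "laurent_at f z0"
  have L: "(\<lambda>w. eval_mero f (z0 + w)) has_laurent_expansion ?L"
    by (rule has_laurent_expansion_laurent_at[OF z0])
  define g where "g = (\<lambda>w. if w = z0 then r else (w - z0) * eval_mero f w)"
  have ev: "\<forall>\<^sub>F w in at z0. eval_mero f analytic_on {w}"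
    using cosparse_analytic z0 unfolding cosparse_uhp_iff by blast
  then obtain S where S: "open S" "z0 \<in> S" "\<And>w. w \<in> S - {z0} \<Longrightarrow> eval_mero f analytic_on {w}"
    by (auto simp: eventually_at_topological)
  have an: "eval_mero f analytic_on (S - {z0})" using S(3) by (simp add: analytic_on_def)
  have fh: "eval_mero f holomorphic_on (S - {z0})" using an by (rule analytic_imp_holomorphic)
  have "\<forall>\<^sub>F w in at z0. (w - z0) * eval_mero f w = g w" by (auto simp: g_def eventually_at_filter)
  from Lim_transform_eventually[OF lim this] have "(g \<longlongrightarrow> g z0) (at z0)" by (simp add: g_def)
  have gh: "g holomorphic_on S"
  proof (rule no_isolated_singularity'[where K="{z0}"])
    show "g holomorphic_on S - {z0}"
      by (rule holomorphic_transform[of "\<lambda>w. (w - z0) * eval_mero f w"])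
        (auto intro!: holomorphic_intros fh simp: g_def)
    show "(g \<longlongrightarrow> g z) (at z within S)" if "z \<in> {z0}" for z
      using \<open>(g \<longlongrightarrow> g z0) (at z0)\<close> that by (auto intro: tendsto_within_subset)
  qed (use S in auto)
  have gd: "(g has_field_derivative deriv g w) (at w)" if "w \<in> S" for w
    by (rule holomorphic_derivI[OF gh S(1) that])
  have "((\<lambda>w. (w - z0) * deriv g w - g w) \<longlongrightarrow> (z0 - z0) * deriv g z0 - g z0) (at z0)"
  proof -
    have "isCont (deriv g) z0"
      using holomorphic_on_imp_continuous_on[OF holomorphic_deriv[OF gh S(1)]] S
        by (simp add: continuous_on_eq_continuous_at)
    moreover have "isCont g z0" using gd[OF S(2)] by (rule DERIV_isCont)
    ultimately have "isCont (\<lambda>w. (w - z0) * deriv g w - g w) z0" by (intro continuous_intros)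
    then show ?thesis by (simp add: isCont_def)
  qed
  then have "((\<lambda>w. (w - z0) * deriv g w - g w) \<longlongrightarrow> - r) (at z0)" by (simp add: g_def)
  moreover have "\<forall>\<^sub>F w in at z0. (w - z0) * deriv g w - g w = (w - z0)\<^sup>2 * deriv (eval_mero f) w"
  proof -
    have "\<forall>\<^sub>F w in at z0. w \<in> S - {z0}" using S by (intro eventually_at_in_open) auto
    then show ?thesis
    proof eventually_elim
      case (elim w)
      have "(eval_mero f has_field_derivative deriv (eval_mero f) w) (at w)"
        using S(3)[OF elim] analytic_on_imp_differentiable_at[of "eval_mero f" "{w}"]
          by (simp add: DERIV_deriv_iff_field_differentiable)
      then have
          "((\<lambda>w. (w - z0) * eval_mero f w) has_field_derivative (eval_mero f w + (w - z0) * deriv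
              (eval_mero f) w)) (at w)"
        by (auto intro!: derivative_eq_intros)
      then have "(g has_field_derivative (eval_mero f w + (w - z0) * deriv (eval_mero f) w)) (at w)"
        by (rule has_field_derivative_transform_within_open[of _ _ _ "S - {z0}"])
          (use elim S in \<open>auto simp: g_def open_delete\<close>)
      then have dg: "deriv g w = eval_mero f w + (w - z0) * deriv (eval_mero f) w"
        by (rule DERIV_imp_deriv)
      have gw: "g w = (w - z0) * eval_mero f w" using elim by (simp add: g_def)
      show ?case unfolding dg gw by (simp add: power2_eq_square algebra_simps)
    qed
  qed
  ultimately show ?thesis by (rule Lim_transform_eventually)
qed

lemma integral_nonneg_continuous_zero:
  fixes h :: "complex \<Rightarrow> real"
  assumes "continuous_on UNIV h" "\<And>z. h z \<ge> 0" "integrable lborel h" "integral\<^sup>L lborel h = 0"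
  shows "h z = 0"
proof (rule ccontr)
  assume "h z \<noteq> 0"
  then have zp: "h z > 0" using assms(2)[of z] by simp
  have "AE z in lborel. h z = 0"
    using integral_nonneg_eq_0_iff_AE[OF assms(3)] assms(2,4) by simp
  then have "{z. h z \<noteq> 0} \<in> null_sets lborel"
    using AE_iff_null_sets[of "{z. h z \<noteq> 0}" lborel] assms(1)
    by (auto simp: borel_open open_Collect_neq)
  then have "negligible {z. h z \<noteq> 0}" using negligible_iff_null_sets null_sets_completionI by blast
  moreover have "open {z. h z \<noteq> 0}" using assms(1) by (intro open_Collect_neq) auto
  ultimately show False using open_not_negligible zp
    by (metis (mono_tags, lifting) empty_iff mem_Collect_eq less_irrefl)
qed

text \<open>
  A continuously differentiable nonincreasing cutoff: 1 up to \<open>L\<close> and 0 from \<open>L + 1\<close> on.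
\<close>

definition plateau :: "real \<Rightarrow> real \<Rightarrow> real" where
  "plateau L t = (max 0 (1 - (max 0 (t - L))\<^sup>2))\<^sup>2"

definition plateau' :: "real \<Rightarrow> real \<Rightarrow> real" where
  "plateau' L t = 2 * max 0 (1 - (max 0 (t - L))\<^sup>2) * (- (2 * max 0 (t - L)))"

lemma plateau_deriv: "(plateau L has_real_derivative plateau' L t) (at t)"
proof -
  have "((\<lambda>t. (max 0 (t - L))\<^sup>2) has_real_derivative 2 * max 0 (t - L) * 1) (at t)"
    by (rule DERIV_chain2[OF has_real_derivative_max_0_squared]) (auto intro!: derivative_eq_intros)
  from DERIV_diff[OF DERIV_const[of 1] this]
  have 1: "((\<lambda>t. 1 - (max 0 (t - L))\<^sup>2) has_real_derivative - (2 * max 0 (t - L))) (at t)"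
    by simp
  show ?thesis unfolding plateau_def plateau'_def
    by (rule DERIV_chain2[OF has_real_derivative_max_0_squared 1])
qed

lemma plateau_props:
  "plateau' L t \<le> 0" "plateau L t \<ge> 0" "t \<le> L \<Longrightarrow> plateau L t = 1" "t \<le> L \<Longrightarrow> plateau' L t = 0"
  "t \<ge> L + 1 \<Longrightarrow> plateau L t = 0" "t \<ge> L + 1 \<Longrightarrow> plateau' L t = 0"
  and continuous_plateau': "continuous_on UNIV (plateau' L)"
proof -
  show "plateau' L t \<le> 0" unfolding plateau'_def by (intro mult_nonneg_nonpos) auto
  show "t \<ge> L + 1 \<Longrightarrow> plateau L t = 0" "t \<ge> L + 1 \<Longrightarrow> plateau' L t = 0"
  proof -
    assume "t \<ge> L + 1"
    then have "(max 0 (t - L))\<^sup>2 \<ge> 1\<^sup>2" by (intro power_mono) auto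
    then show "plateau L t = 0" "plateau' L t = 0" by (auto simp: plateau_def plateau'_def)
  qed
  show "continuous_on UNIV (plateau' L)" unfolding plateau'_def by (intro continuous_intros)
qed (auto simp: plateau_def plateau'_def)

text \<open>
  Otherwise every pole is simple with residue \<open>-1\<close>; this includes the case that there is no pole.
  The invariant function \<open>N = (Im z)\<^sup>2 \<bar>\<psi>\<bar>\<^sup>2\<close> tends to infinity at the poles, so \<open>\<Theta> = plateau(N)
  \<psi>\<close> vanishes near them and \<open>\<Theta> dz\<close> is smooth on the quotient. We have \<open>\<partial>\<Theta>/\<partial>cnj z = plateau'(N) \<psi>
  \<partial>N/\<partial>cnj z - plateau(N) / (4 (Im z)\<^sup>2)\<close>. The second term is nonpositive. The first one is
  different from 0 only near the poles, where \<open>\<psi> \<approx> -1 / (z - z0)\<close> makes the real part of \<open>\<psi>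
  \<partial>N/\<partial>cnj z\<close> positive: here the sign of the residue enters. So \<open>\<partial>\<Theta>/\<partial>cnj z\<close> has nonpositive real
  part, is not identically 0, and has integral 0 over the quotient, a contradiction.
\<close>

theorem exists_pole_residue_not_minus_one:
  assumes disc: "discrete_subgroup \<Gamma>" and co: "cocompact \<Gamma>" and \<phi>: "\<phi> \<in> quasimodular_weight2_delta1 \<Gamma>"
  shows "\<exists>z\<in>uhp. is_pole (eval_mero \<phi>) z \<and> \<not> ((\<lambda>w. (w - z) * eval_mero \<phi> w) \<longlongrightarrow> -1) (at z)"
proof (rule ccontr)
  assume neg: "\<not> ?thesis"
  have G: "subgroup \<Gamma> PSL2R" using disc by (simp add: discrete_subgroup_def)
  obtain K where K: "compact K" "K \<subseteq> uhp" "\<And>z. z \<in> uhp \<Longrightarrow> \<exists>A\<in>matrices_of \<Gamma>. moebius A z \<in> K"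
    using cocompact_fundamental_compact[OF G co] by blast
  obtain q X where "averaging_weight \<Gamma> K q X"
    using averaging_weight_exists[OF disc K] by blast
  then have q: "compact X" "X \<subseteq> uhp" "\<And>z. q z \<ge> 0" "\<And>z. z \<in> K \<Longrightarrow> q z > 0" "\<And>z. z \<notin> X \<Longrightarrow> q z = 0"
      "continuous_on UNIV q"
    and qint: "\<forall>\<Theta> a b. smooth_weight2_form \<Gamma> \<Theta> a b \<longrightarrow> integral\<^sup>L lborel (\<lambda>z. of_real (q z) * b z) = 0"
    unfolding averaging_weight_def by blast+
  let ?f = "eval_mero \<phi>"
  define PL where "PL = {z \<in> uhp. is_pole ?f z}"
  have lim: "((\<lambda>w. (w - z) * ?f w) \<longlongrightarrow> -1) (at z)" if "z \<in> PL" for z using neg that by (auto simp: PL_def)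
  define R where "R = uhp - PL"
  have an: "?f analytic_on R" using analytic_at_nonpole
    by (subst analytic_on_analytic_at) (auto simp: R_def PL_def)
  have Ro: "open R"
    unfolding open_subopen[of R]
  proof
    fix z assume z: "z \<in> R"
    then have "?f analytic_on {z}" using an analytic_on_analytic_at by blast
    then obtain e where e: "e > 0" "?f holomorphic_on ball z e" by (auto simp: analytic_at_ball)
    have "ball z e \<inter> uhp \<subseteq> R"
      using e not_is_pole_holomorphic[of "ball z e"] by (auto simp: R_def PL_def)
    then show "\<exists>T. open T \<and> z \<in> T \<and> T \<subseteq> R" using z e open_uhp
      by (intro exI[of _ "ball z e \<inter> uhp"]) (auto simp: R_def)
  qed
  have fh: "?f holomorphic_on R" using an by (rule analytic_imp_holomorphic)
  have fd: "(?f has_field_derivative deriv ?f z) (at z)" if "z \<in> R" for z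
    by (rule holomorphic_derivI[OF fh Ro that])
  have fc: "continuous_on R ?f" "continuous_on R (deriv ?f)"
    using fh holomorphic_deriv[OF fh Ro] holomorphic_on_imp_continuous_on by blast+
  define \<psi> where "\<psi> = (\<lambda>z. ?f z + inverse (z - cnj z))"
  define \<psi>z where "\<psi>z = (\<lambda>z. deriv ?f z - 1 / (z - cnj z)\<^sup>2)"
  define \<psi>b where "\<psi>b = (\<lambda>z::complex. 1 / (z - cnj z)\<^sup>2)"
  have nzc: "z - cnj z \<noteq> 0" if "z \<in> uhp" for z using that by (simp add: uhp_def complex_eq_iff)
  have nzR: "z - cnj z \<noteq> 0" if "z \<in> R" for z using nzc that by (simp add: R_def)
  have \<psi>w: "wirtinger \<psi> (\<psi>z z) (\<psi>b z) z" if "z \<in> R" for z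
  proof -
    have "wirtinger \<psi> (deriv ?f z + - 1 / (z - cnj z)\<^sup>2) (0 + 1 / (z - cnj z)\<^sup>2) z"
      unfolding \<psi>_def
        by (intro wirtinger_add wirtinger_holomorphic fd wirtinger_inverse_z_minus_cnj)
          (use that in \<open>auto simp: R_def\<close>)
    then show ?thesis by (simp add: \<psi>z_def \<psi>b_def)
  qed
  have \<psi>c: "continuous_on R \<psi>" "continuous_on R \<psi>z" "continuous_on R \<psi>b"
    unfolding \<psi>_def \<psi>z_def \<psi>b_def using nzR by (auto intro!: continuous_intros fc)
  define N where "N = (\<lambda>z. (Im z)\<^sup>2 * (norm (\<psi> z))\<^sup>2)"
  define NN where "NN = (\<lambda>z. complex_of_real (Im z) * of_real (Im z) * (\<psi> z * cnj (\<psi> z)))"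
  have N_NN: "complex_of_real (N z) = NN z" for z
    by (simp add: N_def NN_def complex_norm_square[symmetric] power2_eq_square)
  define Na
      where "Na = (\<lambda>z. (1 / (2 * \<i>) * of_real (Im z) + of_real (Im z) * (1 / (2 * \<i>))) * (\<psi> z * cnj (\<psi>
          z)) +
     of_real (Im z) * of_real (Im z) * (\<psi>z z * cnj (\<psi> z) + \<psi> z * cnj (\<psi>b z)))"
  define Nb
      where "Nb = (\<lambda>z. (- (1 / (2 * \<i>)) * of_real (Im z) + of_real (Im z) * (- (1 / (2 * \<i>)))) * (\<psi> z *
          cnj (\<psi> z)) +
     of_real (Im z) * of_real (Im z) * (\<psi>b z * cnj (\<psi> z) + \<psi> z * cnj (\<psi>z z)))"
  have Nw: "wirtinger (\<lambda>w. of_real (N w)) (Na z) (Nb z) z" if "z \<in> R" for z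
    unfolding N_NN unfolding NN_def Na_def Nb_def
      by (intro wirtinger_mult wirtinger_Im wirtinger_cnj \<psi>w that)
  have Nc: "continuous_on R N" "continuous_on R Na" "continuous_on R Nb"
    unfolding N_def Na_def Nb_def by (intro continuous_intros \<psi>c; simp)+
  have inR: "moebius A z \<in> R \<longleftrightarrow> z \<in> R" if "A \<in> matrices_of \<Gamma>" "z \<in> uhp" for A z
    using pole_moebius[OF G \<phi> that] moebius_in_uhp[OF matrices_of_det[OF that(1)] that(2)] that
      by (auto simp: R_def PL_def)
  have \<psi>inv: "\<psi> (moebius A z) = (automorphy A z)\<^sup>2 * \<psi> z" if A: "A \<in> matrices_of \<Gamma>" and z: "z \<in> R"
      for A z
  proof -
    have zu: "z \<in> uhp" "\<not> is_pole ?f z" using z by (auto simp: R_def PL_def)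
    show ?thesis
      unfolding \<psi>_def quasimodular_law[OF \<phi> A zu] inverse_z_minus_cnj_moebius[OF matrices_of_det[OF A]
        zu(1)]
      by (simp add: algebra_simps)
  qed
  have Ninv: "N (moebius A z) = N z" if A: "A \<in> matrices_of \<Gamma>" and z: "z \<in> R" for A z
  proof -
    have zu: "z \<in> uhp" using z by (auto simp: R_def)
    note d = matrices_of_det[OF A]
    show ?thesis unfolding N_def \<psi>inv[OF A z] Im_moebius[OF d zu]
      using automorphy_nonzero[OF d zu]
        by (simp add: norm_mult norm_power power_mult_distrib power_divide field_simps flip: power_mult)
  qed
  have lim\<psi>: "((\<lambda>w. (w - z0) * \<psi> w) \<longlongrightarrow> -1) (at z0)"
    and lim\<psi>z: "((\<lambda>w. (w - z0)\<^sup>2 * \<psi>z w) \<longlongrightarrow> 1) (at z0)" if z0: "z0 \<in> PL" for z0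
  proof -
    have zu: "z0 \<in> uhp" "is_pole ?f z0" using z0 by (auto simp: PL_def)
    have "((\<lambda>w. (w - z0) * ?f w + (w - z0) * inverse (w - cnj w)) \<longlongrightarrow> -1 + (z0 - z0) * inverse (z0 - cnj
        z0)) (at z0)"
      by (intro tendsto_intros lim[OF z0] nzc[OF zu(1)])
    then show "((\<lambda>w. (w - z0) * \<psi> w) \<longlongrightarrow> -1) (at z0)" by (simp add: \<psi>_def algebra_simps)
    have "((\<lambda>w. (w - z0)\<^sup>2 * deriv ?f w - (w - z0)\<^sup>2 * (1 / (w - cnj w)\<^sup>2)) \<longlongrightarrow> - (-1) - (z0 - z0)\<^sup>2 * (1
        / (z0 - cnj z0)\<^sup>2)) (at z0)"
      by (intro tendsto_intros simple_pole_limits[OF zu lim[OF z0]]) (use nzc[OF zu(1)] in auto)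
    then show "((\<lambda>w. (w - z0)\<^sup>2 * \<psi>z w) \<longlongrightarrow> 1) (at z0)" by (simp add: \<psi>z_def algebra_simps)
  qed
  \<comment> \<open>Up to the positive factor \<open>\<bar>w - z0\<bar>\<^sup>4\<close>, the product \<open>\<psi> \<partial>N/\<partial>cnj z\<close> tends to \<open>- r\<^sup>3 (Im z0)\<^sup>2\<close>
      for the residue
    \<open>r = -1\<close>.\<close>
  have sign: "\<forall>\<^sub>F w in at z0. Re (\<psi> w * Nb w) \<ge> 0" if z0: "z0 \<in> PL" for z0
  proof -
    have zu: "z0 \<in> uhp" using z0 by (auto simp: PL_def)
    define E where
        "E = (\<lambda>w. \<i> * of_real (Im w) * ((w - z0) * \<psi> w)\<^sup>2 * cnj ((w - z0) * \<psi> w) * cnj (w - z0)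
        + (of_real (Im w))\<^sup>2 * \<psi>b w * ((w - z0) * \<psi> w) * cnj ((w - z0) * \<psi> w) * (w - z0) * cnj (w - z0)
        + (of_real (Im w))\<^sup>2 * ((w - z0) * \<psi> w)\<^sup>2 * cnj ((w - z0)\<^sup>2 * \<psi>z w))"
    have EN: "E w = of_real ((norm (w - z0))^4) * (\<psi> w * Nb w)" for w
    proof -
      have n4: "complex_of_real ((norm (w - z0))^4) = (w - z0)\<^sup>2 * (cnj (w - z0))\<^sup>2"
      proof -
        have "complex_of_real ((norm (w - z0))^4) = (complex_of_real ((norm (w - z0))\<^sup>2))\<^sup>2"
          by (simp flip: power_mult)
        then show ?thesis by (simp only: complex_norm_square power_mult_distrib)
      qed
      have i: "- (1 / (2 * \<i>)) = \<i> / 2" by (simp add: complex_eq_iff)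
      show ?thesis unfolding n4 E_def Nb_def i
        by (simp add: power2_eq_square algebra_simps)
    qed
    have "(E \<longlongrightarrow> \<i> * of_real (Im z0) * (-1)\<^sup>2 * cnj (-1) * cnj (z0 - z0)
        + (of_real (Im z0))\<^sup>2 * \<psi>b z0 * (-1) * cnj (-1) * (z0 - z0) * cnj (z0 - z0)
        + (of_real (Im z0))\<^sup>2 * (-1)\<^sup>2 * cnj 1) (at z0)"
      unfolding E_def \<psi>b_def by (intro tendsto_intros lim\<psi>[OF z0] lim\<psi>z[OF z0]) (use nzc[OF zu] in auto)
    then have "(E \<longlongrightarrow> of_real ((Im z0)\<^sup>2)) (at z0)" by simp
    then have "((\<lambda>w. Re (E w)) \<longlongrightarrow> (Im z0)\<^sup>2) (at z0)" using tendsto_Re by fastforce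
    moreover have "0 < (Im z0)\<^sup>2" using zu by (simp add: uhp_def)
    ultimately have "\<forall>\<^sub>F w in at z0. 0 < Re (E w)" by (rule order_tendstoD)
    then show ?thesis
      by eventually_elim (simp add: EN zero_less_mult_iff)
  qed
  have Nbig: "\<forall>\<^sub>F w in at z0. N w > C" if z0: "z0 \<in> PL" for z0 C
  proof -
    have zu: "z0 \<in> uhp" "is_pole ?f z0" using z0 by (auto simp: PL_def)
    have "filterlim (\<lambda>w. inverse (w - cnj w) + ?f w) at_infinity (at z0)"
      by (rule tendsto_add_filterlim_at_infinity[where c="inverse (z0 - cnj z0)"])
         (use zu nzc[OF zu(1)] in \<open>auto intro!: tendsto_intros simp: is_pole_def\<close>)
    then have "filterlim (\<lambda>w. norm (\<psi> w)) at_top (at z0)"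
      unfolding \<psi>_def
        by (simp add: filterlim_norm_at_top_imp_at_infinity filterlim_at_infinity_imp_norm_at_top
          add.commute)
    moreover have "((\<lambda>w. Im w) \<longlongrightarrow> Im z0) (at z0)" by (intro tendsto_intros)
    moreover have "0 < Im z0" using zu by (simp add: uhp_def)
    ultimately have "filterlim (\<lambda>w. Im w * norm (\<psi> w)) at_top (at z0)"
      by (intro filterlim_tendsto_pos_mult_at_top)
    then have "\<forall>\<^sub>F w in at z0. Im w * norm (\<psi> w) > max 1 C"
      unfolding filterlim_at_top_dense by blast
    then show ?thesis
    proof eventually_elim
      case (elim w)
      have "max 1 C * 1 \<le> (Im w * norm (\<psi> w)) * (Im w * norm (\<psi> w))" using elim
        by (intro mult_mono) auto
      moreover have "(Im w * norm (\<psi> w)) * 1 < (Im w * norm (\<psi> w)) * (Im w * norm (\<psi> w))"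
        using elim by (intro mult_strict_left_mono) auto
      ultimately show ?case using elim by (simp add: N_def power2_eq_square mult_ac)
    qed
  qed
  obtain z1 where z1: "z1 \<in> K" "z1 \<in> R"
  proof -
    have "\<forall>\<^sub>F w in at \<i>. w \<in> uhp \<and> \<not> is_pole ?f w"
      using eventually_not_pole[OF i_in_uhp, of \<phi>] eventually_at_in_open'[OF open_uhp i_in_uhp]
        by eventually_elim simp
    then obtain w where "w \<in> R" using eventually_happens[of _ "at \<i>"] by (auto simp: R_def PL_def)
    then show ?thesis using K(3)[of w] inR that by (metis DiffD1 R_def)
  qed
  have "\<forall>z0\<in>PL. \<exists>W. open W \<and> z0 \<in> W \<and> (\<forall>w\<in>W - {z0}. Re (\<psi> w * Nb w) \<ge> 0)"
  proof
    fix z0 assume "z0 \<in> PL"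
    from sign[OF this] obtain S where "open S" "z0 \<in> S" "\<forall>w\<in>S. w \<noteq> z0 \<longrightarrow> Re (\<psi> w * Nb w) \<ge> 0"
      unfolding eventually_at_topological by auto
    then show "\<exists>W. open W \<and> z0 \<in> W \<and> (\<forall>w\<in>W - {z0}. Re (\<psi> w * Nb w) \<ge> 0)"
      by (intro exI[of _ S]) blast
  qed
  then obtain W
      where W: "\<And>z0. z0 \<in> PL \<Longrightarrow> open (W z0) \<and> z0 \<in> W z0 \<and> (\<forall>w\<in>W z0 - {z0}. Re (\<psi> w * Nb w) \<ge> 0)"
    by metis
  define X' where "X' = X - (\<Union>z0\<in>PL. W z0)"
  have X': "compact X'" "X' \<subseteq> R"
  proof -
    have "compact (X \<inter> - (\<Union>z0\<in>PL. W z0))"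
      by (rule compact_Int_closed[OF q(1)]) (use W in \<open>auto simp: closed_Compl\<close>)
    then show "compact X'" by (simp add: X'_def Diff_eq)
    show "X' \<subseteq> R" using W q(2) by (auto simp: X'_def R_def)
  qed
  have "bounded (N ` X')" using Nc(1) X'
    by (intro compact_imp_bounded compact_continuous_image) (auto intro: continuous_on_subset)
  then obtain L0 where L0: "\<And>z. z \<in> X' \<Longrightarrow> norm (N z) \<le> L0" by (auto simp: bounded_iff)
  \<comment> \<open>Where \<open>N\<close> exceeds \<open>L\<close>, the sign is known; at \<open>z1\<close> the cutoff is 1.\<close>
  define L where "L = max L0 (N z1)"
  have NL: "N z \<le> L" if "z \<in> X'" for z using L0[OF that] by (simp add: L_def)
  define \<Theta> where "\<Theta> = (\<lambda>z. if z \<in> PL then 0 else of_real (plateau L (N z)) * \<psi> z)"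
  define a where
      "a = (\<lambda>z. if z \<in> PL then 0 else of_real (plateau' L (N z)) * Na z * \<psi> z + of_real (plateau L (N
          z)) * \<psi>z z)"
  define b where
      "b = (\<lambda>z. if z \<in> PL then 0 else of_real (plateau' L (N z)) * Nb z * \<psi> z + of_real (plateau L (N
          z)) * \<psi>b z)"
  have nearPL: "\<exists>T. open T \<and> z \<in> T \<and> (\<forall>w\<in>T. \<Theta> w = 0 \<and> a w = 0 \<and> b w = 0)" if z: "z \<in> PL" for z
  proof -
    obtain T where "open T" "z \<in> T" "\<And>w. w \<in> T - {z} \<Longrightarrow> N w > L + 1" using Nbig[OF z, of "L + 1"]
      by (auto simp: eventually_at_topological)
    then show ?thesis using z plateau_props(5,6)[of L]
      by (intro exI[of _ T]) (force simp: \<Theta>_def a_def b_def)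
  qed
  have pc: "continuous_on UNIV (plateau L)" using plateau_deriv
    by (meson DERIV_isCont continuous_at_imp_continuous_on)
  have comp: "continuous_on R (\<lambda>z. complex_of_real (h (N z)))" if "continuous_on UNIV h" for h
    by (intro continuous_intros continuous_on_compose2[OF that Nc(1)]) auto
  have abR: "continuous_on R a" "continuous_on R b"
  proof -
    have ca: "continuous_on R (\<lambda>z. of_real (plateau' L (N z)) * Na z * \<psi> z + of_real (plateau L (N z)) *
        \<psi>z z)"
      and cb: "continuous_on R (\<lambda>z. of_real (plateau' L (N z)) * Nb z * \<psi> z + of_real (plateau L (N z))
          * \<psi>b z)"
      by (intro continuous_intros comp[OF pc] comp[OF continuous_plateau'] \<psi>c Nc)+
    show "continuous_on R a" by (rule continuous_on_eq[OF ca]) (simp add: a_def R_def)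
    show "continuous_on R b" by (rule continuous_on_eq[OF cb]) (simp add: b_def R_def)
  qed
  have cont: "continuous_on uhp g"
      if cR: "continuous_on R g" and zP: "\<And>z. z \<in> PL \<Longrightarrow> \<exists>T. open T \<and> z \<in> T \<and> (\<forall>w\<in>T. g w = 0)"
          for g :: "complex \<Rightarrow> complex"
  proof (rule continuous_at_imp_continuous_on, rule ballI)
    fix z assume z: "z \<in> uhp"
    show "isCont g z"
    proof (cases "z \<in> PL")
      case True
      then obtain T where T: "open T" "z \<in> T" "\<forall>w\<in>T. g w = 0" using zP by blast
      have "continuous_on T g" using T(3) by (simp cong: continuous_on_cong)
      then show ?thesis using T continuous_on_eq_continuous_at by blast
    next
      case False
      then show ?thesis using z cR Ro continuous_on_eq_continuous_at[of R g] by (auto simp: R_def)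
    qed
  qed
  have ac: "continuous_on uhp a" "continuous_on uhp b"
  proof -
    have na: "\<exists>T. open T \<and> z \<in> T \<and> (\<forall>w\<in>T. a w = 0)" and nb: "\<exists>T. open T \<and> z \<in> T \<and> (\<forall>w\<in>T. b w = 0)"
      if z: "z \<in> PL" for z
    proof -
      obtain T where "open T" "z \<in> T" "\<forall>w\<in>T. \<Theta> w = 0 \<and> a w = 0 \<and> b w = 0" using nearPL[OF z] by blast
      then show "\<exists>T. open T \<and> z \<in> T \<and> (\<forall>w\<in>T. a w = 0)" "\<exists>T. open T \<and> z \<in> T \<and> (\<forall>w\<in>T. b w = 0)" by auto
    qed
    show "continuous_on uhp a" by (rule cont[OF abR(1) na])
    show "continuous_on uhp b" by (rule cont[OF abR(2) nb])
  qed
  have \<Theta>w: "wirtinger \<Theta> (a z) (b z) z" if z: "z \<in> uhp" for z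
  proof (cases "z \<in> PL")
    case True
    then obtain T where T: "open T" "z \<in> T" "\<forall>w\<in>T. \<Theta> w = 0 \<and> a w = 0 \<and> b w = 0" using nearPL by blast
    have "wirtinger (\<lambda>_. 0) 0 0 z" by (rule wirtinger_const)
    then have "wirtinger \<Theta> 0 0 z" by (rule wirtinger_transform[OF _ T(1,2)]) (use T in auto)
    then show ?thesis using T by auto
  next
    case False
    then have zR: "z \<in> R" using z by (simp add: R_def)
    have "wirtinger (\<lambda>w. of_real (plateau L (N w)) * \<psi> w) (of_real (plateau' L (N z)) * Na z * \<psi> z +
        of_real (plateau L (N z)) * \<psi>z z)
        (of_real (plateau' L (N z)) * Nb z * \<psi> z + of_real (plateau L (N z)) * \<psi>b z) z"
      by (intro wirtinger_mult wirtinger_real_compose[OF Nw plateau_deriv] \<psi>w zR)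
    then have "wirtinger \<Theta> (of_real (plateau' L (N z)) * Na z * \<psi> z + of_real (plateau L (N z)) * \<psi>z z)
        (of_real (plateau' L (N z)) * Nb z * \<psi> z + of_real (plateau L (N z)) * \<psi>b z) z"
      by (rule wirtinger_transform[OF _ Ro zR]) (auto simp: \<Theta>_def R_def)
    then show ?thesis using False by (simp add: a_def b_def)
  qed
  have \<Theta>inv: "\<Theta> (moebius A z) = (automorphy A z)\<^sup>2 * \<Theta> z" if A: "A \<in> matrices_of \<Gamma>" and z: "z \<in> uhp"
      for A z
  proof (cases "z \<in> R")
    case True
    then show ?thesis using inR[OF A z] \<psi>inv[OF A] Ninv[OF A] by (simp add: \<Theta>_def R_def)
  next
    case False
    then show ?thesis using inR[OF A z] moebius_in_uhp[OF matrices_of_det[OF A] z] z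
      by (simp add: \<Theta>_def R_def)
  qed
  have "smooth_weight2_form \<Gamma> \<Theta> a b" using \<Theta>w ac \<Theta>inv by (simp add: smooth_weight2_form_def)
  then have int0: "integral\<^sup>L lborel (\<lambda>z. of_real (q z) * b z) = 0" using qint by blast
  have \<psi>b: "\<psi>b z = of_real (- (1 / (4 * (Im z)\<^sup>2)))" if "z \<in> uhp" for z
    unfolding \<psi>b_def complex_diff_cnj by (simp add: power_mult_distrib)
  have Reb: "Re (b z) \<le> 0" if z: "z \<in> X" for z
  proof (cases "z \<in> PL")
    case False
    have zu: "z \<in> uhp" using z q(2) by auto
    have t2: "Re (of_real (plateau L (N z)) * \<psi>b z) \<le> 0"
      unfolding \<psi>b[OF zu] using plateau_props(2)[of L "N z"] by (simp flip: of_real_mult)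
    have "Re (of_real (plateau' L (N z)) * (\<psi> z * Nb z)) \<le> 0"
    proof (cases "z \<in> X'")
      case True
      then show ?thesis using NL plateau_props(4) by simp
    next
      case F2: False
      then obtain z0 where z0: "z0 \<in> PL" "z \<in> W z0" using z by (auto simp: X'_def)
      then have "Re (\<psi> z * Nb z) \<ge> 0" using W[OF z0(1)] False by blast
      then show ?thesis using plateau_props(1)[of L "N z"]
        by (simp only: Re_complex_of_real times_complex.sel complex_Re_of_int Im_complex_of_real)
          (simp add: mult_nonpos_nonneg)
    qed
    then show ?thesis using t2 False by (simp add: b_def mult_ac)
  qed (simp add: b_def)
  have bX: "continuous_on UNIV (\<lambda>z. of_real (q z) * b z)"
  proof -
    have "continuous_on UNIV (\<lambda>z. if z \<in> uhp then of_real (q z) * b z else 0)"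
      by (rule continuous_zero_extension[OF open_uhp q(1,2)])
        (use q(5) in \<open>auto intro!: continuous_intros ac continuous_on_subset[OF q(6)]\<close>)
    moreover have "(\<lambda>z. if z \<in> uhp then of_real (q z) * b z else 0) = (\<lambda>z. of_real (q z) * b z)"
      using q(2,5) by (auto simp: fun_eq_iff)
    ultimately show ?thesis by (simp only:)
  qed
  have bi: "integrable lborel (\<lambda>z. of_real (q z) * b z)"
    by (rule integrable_compact_support[OF bX q(1)]) (use q(5) in auto)
  define h where "h = (\<lambda>z. - Re (of_real (q z) * b z))"
  have "h z1 = 0"
  proof (rule integral_nonneg_continuous_zero)
    show "continuous_on UNIV h" unfolding h_def by (intro continuous_intros bX)
    show "h z \<ge> 0" for z
      unfolding h_def using Reb[of z] q(3)[of z] q(5)[of z]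
        by (cases "z \<in> X") (auto simp: mult_nonneg_nonpos)
    show "integrable lborel h" unfolding h_def
      by (intro Bochner_Integration.integrable_minus integrable_Re bi)
    show "integral\<^sup>L lborel h = 0" unfolding h_def using int0 integral_Re[OF bi] by simp
  qed
  moreover have "h z1 > 0"
  proof -
    have "z1 \<in> uhp" "z1 \<notin> PL" using z1 by (auto simp: R_def)
    moreover have "N z1 \<le> L" by (simp add: L_def)
    ultimately have "b z1 = of_real (- (1 / (4 * (Im z1)\<^sup>2)))"
      using plateau_props(3,4)[of "N z1" L] \<psi>b[of z1] by (simp add: b_def)
    then have "Re (b z1) < 0" using \<open>z1 \<in> uhp\<close> by (simp add: uhp_def)
    then show ?thesis using q(4)[OF z1(1)] by (simp add: h_def mult_pos_neg)
  qed
  ultimately show False by simp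
qed

section \<open>Subsequences of natural numbers\<close>

text \<open>
  A nonincreasing sequence of natural numbers is eventually constant.
\<close>

lemma monotone_nat_subsequence:
  fixes s :: "nat \<Rightarrow> nat"
  obtains f :: "nat \<Rightarrow> nat" where "strict_mono f" "mono (s \<circ> f)"
proof -
  obtain f where f: "strict_mono f" "monoseq (\<lambda>n. s (f n))" using seq_monosub by blast
  show ?thesis
  proof (cases "incseq (\<lambda>n. s (f n))")
    case True
    then have "mono (s \<circ> f)" by (simp add: mono_def incseq_def)
    then show ?thesis using f(1) that by blast
  next
    case False
    then have dec: "decseq (\<lambda>n. s (f n))" using f(2) monoseq_iff by blast
    obtain m where m: "\<And>n. s (f m) \<le> s (f n)"
      using ex_has_least_nat[of "\<lambda>_. True" 0 "\<lambda>n. s (f n)"] by auto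
    have "s (f (n + m)) = s (f m)" for n using m decseqD[OF dec, of m "n + m"] by (simp add: antisym)
    moreover have "strict_mono (\<lambda>n. f (n + m))" using f(1) by (simp add: strict_mono_def)
    ultimately show ?thesis by (intro that[of "\<lambda>n. f (n + m)"]) (auto simp: mono_def)
  qed
qed

text \<open>
  Dickson's lemma for pairs, with an additional colouring by finitely many colours.
\<close>

lemma dickson_pair:
  fixes c :: "nat \<Rightarrow> 'a" and x y :: "nat \<Rightarrow> nat"
  assumes "finite (range c)"
  obtains i i' where "i < i'" "c i = c i'" "x i \<le> x i'" "y i \<le> y i'"
proof -
  obtain i0 where "infinite {i. c i = c i0}"
    using pigeonhole_infinite[of UNIV c] assms by auto
  from infinite_enumerate[OF this] obtain r :: "nat \<Rightarrow> nat"
    where r: "strict_mono r" "\<And>n. c (r n) = c i0" by auto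
  obtain f :: "nat \<Rightarrow> nat" where f: "strict_mono f" "mono ((\<lambda>n. x (r n)) \<circ> f)"
    by (rule monotone_nat_subsequence)
  obtain m where m: "\<And>n. y (r (f m)) \<le> y (r (f n))"
    using ex_has_least_nat[of "\<lambda>_. True" 0 "\<lambda>n. y (r (f n))"] by auto
  show ?thesis
  proof (rule that[of "r (f m)" "r (f (Suc m))"])
    show "r (f m) < r (f (Suc m))" using r f by (simp add: strict_mono_def)
    show "x (r (f m)) \<le> x (r (f (Suc m)))" using f(2) by (simp add: mono_def)
  qed (use r m in auto)
qed

section \<open>Graded algebras\<close>

lemma graded_induct [case_names zero single add]:
  assumes "P 0" "\<And>k g. P (Poly_Mapping.single k g)" "\<And>F G. P F \<Longrightarrow> P G \<Longrightarrow> P (F + G)"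
  shows "P (F :: graded)"
proof (induction F rule: update_induct)
  case (update F k g)
  have "Poly_Mapping.update k g F = F + Poly_Mapping.single k g"
    using update(1)
      by (intro poly_mapping_eqI) (auto simp: lookup_update lookup_add lookup_single when_def
        in_keys_iff)
  then show ?case using assms update by simp
qed (rule assms(1))

lemma D_0: "D \<phi> 0 = 0" using D_single[of \<phi> 0 0] by (simp add: mero_deriv_0)

lemma D_mult: "D \<phi> (F * G) = D \<phi> F * G + F * D \<phi> G"
proof (induction F rule: graded_induct)
  case (single k f)
  show ?case
  proof (induction G rule: graded_induct)
    case (single l g)
    have "D \<phi> (Poly_Mapping.single k f * Poly_Mapping.single l g) =
       Poly_Mapping.single (k + l + 2) (mero_deriv (f * g) - of_int (k + l) * \<phi> * (f * g))"
      by (simp add: mult_single D_single)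
    also have "mero_deriv (f * g) - of_int (k + l) * \<phi> * (f * g) =
       (mero_deriv f - of_int k * \<phi> * f) * g + f * (mero_deriv g - of_int l * \<phi> * g)"
      by (simp add: mero_deriv_mult algebra_simps)
    finally have "D \<phi> (Poly_Mapping.single k f * Poly_Mapping.single l g) =
       Poly_Mapping.single (k + l + 2) ((mero_deriv f - of_int k * \<phi> * f) * g) +
       Poly_Mapping.single (k + l + 2) (f * (mero_deriv g - of_int l * \<phi> * g))"
      by (simp only: single_add)
    moreover have "D \<phi> (Poly_Mapping.single k f) * Poly_Mapping.single l g =
       Poly_Mapping.single (k + l + 2) ((mero_deriv f - of_int k * \<phi> * f) * g)"
      by (simp only: D_single mult_single) (simp add: add_ac)
    moreover have "Poly_Mapping.single k f * D \<phi> (Poly_Mapping.single l g) =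
       Poly_Mapping.single (k + l + 2) (f * (mero_deriv g - of_int l * \<phi> * g))"
      by (simp only: D_single mult_single) (simp add: add_ac)
    ultimately show ?case by (simp only:)
  next
    case (add G H)
    then show ?case by (simp add: D_add algebra_simps)
  qed (simp add: D_0)
next
  case (add F H)
  then show ?case by (simp add: D_add algebra_simps)
qed (simp add: D_0)

lemma D_const: "D \<phi> (graded_const c) = 0"
  by (simp add: graded_const_def D_single mero_deriv_const)

lemma generated_algebra_0: "0 \<in> generated_algebra S"
  using generated_algebra.const[of 0 S] by (simp add: graded_const_def mero_const_0)

lemma generated_algebra_mono: "S \<subseteq> generated_algebra T \<Longrightarrow> generated_algebra S \<subseteq> generated_algebra T"
proof
  fix F assume S: "S \<subseteq> generated_algebra T" and "F \<in> generated_algebra S"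
  from this(2) show "F \<in> generated_algebra T"
    by induction (use S in \<open>auto intro: generated_algebra.intros\<close>)
qed

lemma generated_algebra_D_closed:
  assumes S: "\<And>F. F \<in> S \<Longrightarrow> D \<phi> F \<in> generated_algebra S" and F: "F \<in> generated_algebra S"
  shows "D \<phi> F \<in> generated_algebra S"
  using F
proof induction
  case (const c)
  then show ?case by (simp add: D_const generated_algebra_0)
qed (auto simp: S D_add D_mult intro: generated_algebra.intros)

text \<open>
  Only even weights matter, because \<open>- mat 1\<close> belongs to the group; \<open>j\<close> is half the weight.
\<close>

definition component :: "graded set \<Rightarrow> int \<Rightarrow> mero_uhp set" where
  "component R j = {f. Poly_Mapping.single (2 * j) f \<in> R}"

lemma component_add: "f \<in> component (generated_algebra S) j \<Longrightarrow> g \<in> component (generated_algebra S) j \<Longrightarrow>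
    f + g \<in> component (generated_algebra S) j"
  unfolding component_def by (simp add: single_add generated_algebra.add)

lemma component_mult: "f \<in> component (generated_algebra S) j \<Longrightarrow> g \<in> component (generated_algebra S) l \<Longrightarrow>
    f * g \<in> component (generated_algebra S) (j + l)"
  using generated_algebra.mult[of "Poly_Mapping.single (2 * j) f" S "Poly_Mapping.single (2 * l) g"]
  unfolding component_def by (simp add: mult_single algebra_simps)

lemma component_const: "mero_const c \<in> component (generated_algebra S) 0"
  using generated_algebra.const[of c S] by (simp add: component_def graded_const_def)

lemma component_cmult:
    "f \<in> component (generated_algebra S) j \<Longrightarrow> mero_const c * f \<in> component (generated_algebra S) j"
  using component_mult[OF component_const] by fastforce

lemma component_power:
    "f \<in> component (generated_algebra S) j \<Longrightarrow> f ^ n \<in> component (generated_algebra S) (int n * j)"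
proof (induction n)
  case 0
  then show ?case using component_const[of 1] by (simp add: mero_const_1)
next
  case (Suc n)
  then show ?case using component_mult[OF Suc.prems Suc.IH[OF Suc.prems]] by (simp add: algebra_simps)
qed

section \<open>The graded ring of functions with bounded poles\<close>

text \<open>
  Differentiating the law of weight \<open>k\<close> produces the term \<open>k c (c z + d)\<^bsup>k + 1\<^esup> f\<close>, which the
  inhomogeneous term in the law of \<open>\<phi>\<close> cancels.
\<close>

lemma has_weight_covariant_derivative:
  assumes \<phi>: "\<And>A. A \<in> matrices_of \<Gamma> \<Longrightarrow> \<forall>\<^sub>\<approx>z\<in>uhp. eval_mero \<phi> (moebius A z)
      = (automorphy A z)\<^sup>2 * eval_mero \<phi> z + of_real (A$2$1) * automorphy A z"
    and f: "has_weight \<Gamma> k f"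
  shows "has_weight \<Gamma> (k + 2) (mero_deriv f - of_int k * \<phi> * f)"
  unfolding has_weight_def
proof
  fix A assume A: "A \<in> matrices_of \<Gamma>"
  note d = matrices_of_det[OF A]
  let ?F = "eval_mero f" and ?P = "eval_mero \<phi>" and ?g = "mero_deriv f - of_int k * \<phi> * f"
  have g: "\<forall>\<^sub>\<approx>z\<in>uhp. eval_mero ?g z = deriv ?F z - of_int k * ?P z * ?F z"
    using eval_mero_ops_cosparse(4)[of "mero_deriv f" "of_int k * \<phi> * f"] eval_mero_deriv_cosparse[of f]
      eval_mero_ops_cosparse(6)[of "of_int k * \<phi>" f] eval_mero_ops_cosparse(6)[of "of_int k" \<phi>]
      eval_mero_const_cosparse[of "of_int k", unfolded mero_const_of_int]
    by eventually_elim simp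
  show "\<forall>\<^sub>\<approx>z\<in>uhp. eval_mero ?g (moebius A z) = automorphy A z powi (k + 2) * eval_mero ?g z"
    using g cosparse_uhp_moebius[OF d g] \<phi>[OF A]
      cosparse_uhp_nhds[OF bspec[OF f[unfolded has_weight_def] A]]
      cosparse_analytic[of f] cosparse_uhp_moebius[OF d cosparse_analytic[of f]]
      eventually_in_cosparse[OF subset_refl open_uhp]
  proof eventually_elim
    case (elim z)
    let ?j = "automorphy A z" and ?c = "complex_of_real (A$2$1)"
    have j: "?j \<noteq> 0" by (rule automorphy_nonzero[OF d elim(7)])
    have fz: "(?F has_field_derivative deriv ?F z) (at z)"
        "(?F has_field_derivative deriv ?F (moebius A z)) (at (moebius A z))"
      using elim(5,6) analytic_on_imp_differentiable_at DERIV_deriv_iff_field_differentiable by blast+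
    have "((\<lambda>w. ?F (moebius A w)) has_field_derivative deriv ?F (moebius A z) * (1 / ?j\<^sup>2)) (at z)"
      by (rule DERIV_chain2[OF fz(2) has_field_derivative_moebius[OF d elim(7)]])
    moreover have "((\<lambda>w. ?F (moebius A w)) has_field_derivative
        of_int k * ?j powi (k - 1) * ?c * ?F z + ?j powi k * deriv ?F z) (at z)"
    proof -
      have "((\<lambda>w. automorphy A w powi k * ?F w) has_field_derivative
        of_int k * ?j powi (k - 1) * ?c * ?F z + ?j powi k * deriv ?F z) (at z)"
        by (rule derivative_eq_intros fz(1) j refl | simp add: j mult_ac)+
      moreover have "\<forall>\<^sub>F w in nhds z. automorphy A w powi k * ?F w = ?F (moebius A w)"
        using elim(4) by eventually_elim simp
      ultimately show ?thesis by (rule DERIV_cong_ev[OF refl _ refl, THEN iffD1, rotated])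
    qed
    ultimately have
        "deriv ?F (moebius A z) * (1 / ?j\<^sup>2) = of_int k * ?j powi (k - 1) * ?c * ?F z + ?j powi k *
            deriv ?F z"
      by (rule DERIV_unique)
    then have dF:
        "deriv ?F (moebius A z) = ?j\<^sup>2 * (of_int k * ?j powi (k - 1) * ?c * ?F z + ?j powi k * deriv ?F
            z)"
      using j by (simp add: field_simps)
    have Fm: "?F (moebius A z) = ?j powi k * ?F z" using eventually_nhds_x_imp_x[OF elim(4)] .
    have p1: "?j powi k = ?j powi (k - 1) * ?j" using power_int_add_1[of ?j "k - 1"] j by simp
    have p2: "?j powi (k + 2) = ?j powi k * ?j\<^sup>2" using j by (simp add: power_int_add)
    show ?case unfolding elim(2) elim(1) dF Fm elim(3) p2 p1
      by (simp add: power2_eq_square algebra_simps)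
  qed
qed

lemma has_weight_omega:
  assumes \<phi>: "\<And>A. A \<in> matrices_of \<Gamma> \<Longrightarrow> \<forall>\<^sub>\<approx>z\<in>uhp. eval_mero \<phi> (moebius A z)
      = (automorphy A z)\<^sup>2 * eval_mero \<phi> z + of_real (A$2$1) * automorphy A z"
  shows "has_weight \<Gamma> 4 (omega \<phi>)"
  unfolding has_weight_def
proof
  fix A assume A: "A \<in> matrices_of \<Gamma>"
  note d = matrices_of_det[OF A]
  let ?P = "eval_mero \<phi>"
  have g: "\<forall>\<^sub>\<approx>z\<in>uhp. eval_mero (omega \<phi>) z = deriv ?P z - ?P z * ?P z"
    using eval_mero_ops_cosparse(4)[of "mero_deriv \<phi>" "\<phi> * \<phi>"] eval_mero_deriv_cosparse[of \<phi>]
      eval_mero_ops_cosparse(6)[of \<phi> \<phi>]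
    by eventually_elim (simp add: omega_def power2_eq_square)
  show "\<forall>\<^sub>\<approx>z\<in>uhp. eval_mero (omega \<phi>) (moebius A z) = automorphy A z powi 4 * eval_mero (omega \<phi>) z"
    using g cosparse_uhp_moebius[OF d g] cosparse_uhp_nhds[OF \<phi>[OF A]]
      cosparse_analytic[of \<phi>] cosparse_uhp_moebius[OF d cosparse_analytic[of \<phi>]]
      eventually_in_cosparse[OF subset_refl open_uhp]
  proof eventually_elim
    case (elim z)
    let ?j = "automorphy A z" and ?c = "complex_of_real (A$2$1)"
    have j: "?j \<noteq> 0" by (rule automorphy_nonzero[OF d elim(6)])
    have fz: "(?P has_field_derivative deriv ?P z) (at z)"
        "(?P has_field_derivative deriv ?P (moebius A z)) (at (moebius A z))"
      using elim(4,5) analytic_on_imp_differentiable_at DERIV_deriv_iff_field_differentiable by blast+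
    have "((\<lambda>w. ?P (moebius A w)) has_field_derivative deriv ?P (moebius A z) * (1 / ?j\<^sup>2)) (at z)"
      by (rule DERIV_chain2[OF fz(2) has_field_derivative_moebius[OF d elim(6)]])
    moreover have "((\<lambda>w. ?P (moebius A w)) has_field_derivative
        2 * ?j * ?c * ?P z + ?j\<^sup>2 * deriv ?P z + ?c * ?c) (at z)"
    proof -
      have "((\<lambda>w. (automorphy A w)\<^sup>2 * ?P w + ?c * automorphy A w) has_field_derivative
        2 * ?j * ?c * ?P z + ?j\<^sup>2 * deriv ?P z + ?c * ?c) (at z)"
        by (rule derivative_eq_intros fz(1) refl | simp add: mult_ac)+
      moreover have "\<forall>\<^sub>F w in nhds z. (automorphy A w)\<^sup>2 * ?P w + ?c * automorphy A w
          = ?P (moebius A w)"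
        using elim(3) by eventually_elim simp
      ultimately show ?thesis by (rule DERIV_cong_ev[OF refl _ refl, THEN iffD1, rotated])
    qed
    ultimately have
        "deriv ?P (moebius A z) * (1 / ?j\<^sup>2) = 2 * ?j * ?c * ?P z + ?j\<^sup>2 * deriv ?P z + ?c * ?c"
      by (rule DERIV_unique)
    then have dF: "deriv ?P (moebius A z) = ?j\<^sup>2 * (2 * ?j * ?c * ?P z + ?j\<^sup>2 * deriv ?P z + ?c * ?c)"
      using j by (simp add: field_simps)
    have Pm: "?P (moebius A z) = ?j\<^sup>2 * ?P z + ?c * ?j" using eventually_nhds_x_imp_x[OF elim(3)] .
    show ?case unfolding elim(2) elim(1) dF Pm
      by (simp add: power2_eq_square power4_eq_xxxx algebra_simps)
  qed
qed

locale quasimodular_setting =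
  fixes \<Gamma> :: "(real^2^2) set set" and \<phi> :: mero_uhp
  assumes disc: "discrete_subgroup \<Gamma>" and cocomp: "cocompact \<Gamma>" and quasi:
      "\<phi> \<in> quasimodular_weight2_delta1 \<Gamma>"
begin

lemma subgroup_Gamma: "subgroup \<Gamma> PSL2R" using disc by (simp add: discrete_subgroup_def)

definition fundamental_compact :: "complex set" where
  "fundamental_compact = (SOME K. compact K \<and> K \<subseteq> uhp \<and> (\<forall>z\<in>uhp. \<exists>A\<in>matrices_of \<Gamma>. moebius A z \<in> K))"

lemma fundamental_compact: "compact fundamental_compact" "fundamental_compact \<subseteq> uhp"
    "\<And>z. z \<in> uhp \<Longrightarrow> \<exists>A\<in>matrices_of \<Gamma>. moebius A z \<in> fundamental_compact"
proof -
  have "\<exists>K. compact K \<and> K \<subseteq> uhp \<and> (\<forall>z\<in>uhp. \<exists>A\<in>matrices_of \<Gamma>. moebius A z \<in> K)"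
  proof (rule cocompact_fundamental_compact[OF subgroup_Gamma cocomp])
    fix K assume "compact K" "K \<subseteq> uhp" "\<And>z. z \<in> uhp \<Longrightarrow> \<exists>A\<in>matrices_of \<Gamma>. moebius A z \<in> K"
    then show ?thesis by blast
  qed
  then have "compact fundamental_compact \<and> fundamental_compact \<subseteq> uhp
      \<and> (\<forall>z\<in>uhp. \<exists>A\<in>matrices_of \<Gamma>. moebius A z \<in> fundamental_compact)"
    unfolding fundamental_compact_def by (rule someI_ex)
  then show "compact fundamental_compact" "fundamental_compact \<subseteq> uhp"
      "\<And>z. z \<in> uhp \<Longrightarrow> \<exists>A\<in>matrices_of \<Gamma>. moebius A z \<in> fundamental_compact" by blast+
qed

lemma quasimodular_cosparse:
  assumes "A \<in> matrices_of \<Gamma>"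
  shows "\<forall>\<^sub>\<approx>z\<in>uhp. eval_mero \<phi> (moebius A z) = (automorphy A z)\<^sup>2 * eval_mero \<phi> z + of_real (A$2$1) *
      automorphy A z"
  using meromorphic_on_imp_not_pole_cosparse[OF eval_mero_meromorphic[of \<phi>]]
    eventually_in_cosparse[OF subset_refl open_uhp]
  by eventually_elim (rule quasimodular_law[OF quasi assms])

definition pole_order :: "complex \<Rightarrow> int" where
  "pole_order z = (if is_pole (eval_mero \<phi>) z then - ord \<phi> z else 0)"

lemma pole_order_nonneg: "z \<in> uhp \<Longrightarrow> pole_order z \<ge> 0"
  using is_pole_iff_ord by (simp add: pole_order_def)

lemma ord_ge_phi: "z \<in> uhp \<Longrightarrow> ord_ge \<phi> z (- pole_order z)"
  using ord_ge_0_iff[of z \<phi>] by (auto simp: pole_order_def ord_ge_iff)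

lemma phi_nonzero: "\<phi> \<noteq> 0"
proof
  assume 0: "\<phi> = 0"
  obtain z where "z \<in> uhp" "is_pole (eval_mero \<phi>) z"
    using exists_pole_residue_not_minus_one[OF disc cocomp quasi] by blast
  then show False using ord_ge_0_iff[of z \<phi>] ord_ge_0[of z 0] 0 by simp
qed

text \<open>
  At a pole the inhomogeneous term of the transformation law is of smaller size than \<open>\<phi>\<close>.
\<close>

lemma pole_order_moebius:
  assumes A: "A \<in> matrices_of \<Gamma>" and z: "z \<in> uhp"
  shows "pole_order (moebius A z) = pole_order z"
proof (cases "is_pole (eval_mero \<phi>) z")
  case False
  then show ?thesis using pole_moebius[OF subgroup_Gamma quasi A z] by (simp add: pole_order_def)
next
  case True
  note d = matrices_of_det[OF A]
  obtain a where a: "a \<noteq> 0" "\<forall>\<^sub>\<approx>z\<in>uhp. eval_mero a z = automorphy A z powi 2" "\<forall>z\<in>uhp. ord a z = 0"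
    by (rule automorphy_power_mero[OF d, of 2])
  obtain b where b: "b \<noteq> 0" "\<forall>\<^sub>\<approx>z\<in>uhp. eval_mero b z = automorphy A z powi 1" "\<forall>z\<in>uhp. ord b z = 0"
    by (rule automorphy_power_mero[OF d, of 1])
  define g where "g = a * \<phi> + mero_const (of_real (A$2$1)) * b"
  have neg: "ord \<phi> z < 0" using True is_pole_iff_ord[OF z] by blast
  have oa: "a * \<phi> \<noteq> 0" "ord (a * \<phi>) z = ord \<phi> z"
    using a(1,3) z phi_nonzero ord_mult[OF z a(1) phi_nonzero] by (simp_all add: mero_no_zero_divisors)
  have ob: "ord_ge (mero_const (of_real (A$2$1)) * b) z (ord (a * \<phi>) z + 1)"
  proof (rule ord_ge_mono[OF ord_ge_cmult[OF z]])
    show "ord_ge b z 0" using b z by (simp add: ord_ge_iff)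
  qed (use neg oa in simp)
  have og: "g \<noteq> 0" "ord g z = ord \<phi> z" using ord_add_less[OF z oa(1) ob] oa(2) by (simp_all add: g_def)
  have "\<forall>\<^sub>\<approx>z\<in>uhp. eval_mero \<phi> (moebius A z) = eval_mero g z"
    using quasimodular_cosparse[OF A] a(2) b(2) eval_mero_ops_cosparse(6)[of a \<phi>]
      eval_mero_ops_cosparse(3)[of "a * \<phi>" "mero_const (of_real (A$2$1)) * b"]
          eval_mero_ops_cosparse(6)[of "mero_const (of_real (A$2$1))" b]
      eval_mero_const_cosparse[of "of_real (A$2$1)"]
    by eventually_elim (simp add: g_def)
  then have "zorder (\<lambda>w. eval_mero \<phi> (moebius A w)) z = zorder (eval_mero g) z"
    using z unfolding cosparse_uhp_iff by (intro zorder_cong) auto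
  then have "ord \<phi> (moebius A z) = ord \<phi> z"
    using zorder_moebius[OF d z phi_nonzero] ord_eq_zorder[OF z og(1)] og(2) by simp
  then show ?thesis using pole_moebius[OF subgroup_Gamma quasi A z] by (simp add: pole_order_def)
qed

text \<open>
  Sections of the \<open>j\<close>-th power of a line bundle: a pole of \<open>j\<close> times the order of the pole of \<open>\<phi>\<close>
  is admitted. This growth rate is the one that \<open>D\<close> preserves.
\<close>

definition forms :: "int \<Rightarrow> mero_uhp set" where
  "forms j = {f. has_weight \<Gamma> (2 * j) f \<and> (\<forall>z\<in>uhp. ord_ge f z (- (j * pole_order z)))}"

lemma forms_0: "0 \<in> forms j" by (simp add: forms_def has_weight_0 ord_ge_0)

lemma forms_const: "mero_const c \<in> forms 0" by (simp add: forms_def has_weight_const ord_ge_const)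

lemma forms_add: "f \<in> forms j \<Longrightarrow> g \<in> forms j \<Longrightarrow> f + g \<in> forms j"
  and forms_diff: "f \<in> forms j \<Longrightarrow> g \<in> forms j \<Longrightarrow> f - g \<in> forms j"
  by (auto simp: forms_def intro: has_weight_add has_weight_diff ord_ge_add ord_ge_diff)

lemma forms_mult: "f \<in> forms j \<Longrightarrow> g \<in> forms l \<Longrightarrow> f * g \<in> forms (j + l)"
  using ord_ge_mult[of _ f _ g] has_weight_mult[of \<Gamma> "2*j" f "2*l" g]
    by (fastforce simp: forms_def algebra_simps)

lemma forms_cmult: "f \<in> forms j \<Longrightarrow> mero_const c * f \<in> forms j"
  using forms_mult[OF forms_const] by fastforce

lemma modular_forms_subset_forms:
  assumes "f \<in> modular_forms \<Gamma> (2 * j)" "j \<ge> 0" shows "f \<in> forms j"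
proof -
  have "ord_ge f z (- (j * pole_order z))" if z: "z \<in> uhp" for z
  proof (rule ord_ge_mono)
    have "\<not> is_pole (eval_mero f) z"
      using not_is_pole_holomorphic[OF open_uhp z] assms by (simp add: modular_forms_def)
    then show "ord_ge f z 0" using ord_ge_0_iff[OF z] by blast
  qed (use assms(2) pole_order_nonneg[OF z] in simp)
  then show ?thesis using modular_forms_has_weight[OF assms(1)] by (simp add: forms_def)
qed

text \<open>
  Where \<open>\<phi>\<close> has a pole of order \<open>n \<ge> 1\<close>, the derivative increases the order of a pole by \<open>1 \<le> n\<close>
  and the multiplication by \<open>\<phi>\<close> by \<open>n\<close>.
\<close>

lemma covariant_derivative_forms:
  assumes f: "f \<in> forms j"
  shows "mero_deriv f - of_int (2 * j) * \<phi> * f \<in> forms (j + 1)"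
proof -
  have "has_weight \<Gamma> (2 * j + 2) (mero_deriv f - of_int (2 * j) * \<phi> * f)"
    by (rule has_weight_covariant_derivative[OF quasimodular_cosparse])
      (use f in \<open>auto simp: forms_def\<close>)
  moreover have "ord_ge (mero_deriv f - of_int (2 * j) * \<phi> * f) z (- ((j + 1) * pole_order z))"
      if z: "z \<in> uhp" for z
  proof (rule ord_ge_diff[OF z])
    have fz: "ord_ge f z (- (j * pole_order z))" using f z by (simp add: forms_def)
    have "ord_ge (of_int (2 * j) * \<phi>) z (- pole_order z)"
      by (rule ord_ge_of_int_mult[OF z ord_ge_phi[OF z]])
    from ord_ge_mult[OF z this fz] show "ord_ge (of_int (2 * j) * \<phi> * f) z (- ((j + 1) * pole_order z))"
      by (simp add: algebra_simps)
    show "ord_ge (mero_deriv f) z (- ((j + 1) * pole_order z))"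
    proof (cases "pole_order z = 0")
      case True
      then show ?thesis using ord_ge_deriv_0[OF z, of f] fz by simp
    next
      case False
      then have "pole_order z \<ge> 1" using pole_order_nonneg[OF z] by linarith
      then show ?thesis using ord_ge_mono[OF ord_ge_deriv[OF z fz]] by (simp add: algebra_simps)
    qed
  qed
  ultimately show ?thesis by (simp add: forms_def algebra_simps)
qed

lemma omega_forms: "omega \<phi> \<in> forms 2"
proof -
  have "ord_ge (omega \<phi>) z (- (2 * pole_order z))" if z: "z \<in> uhp" for z
    unfolding omega_def power2_eq_square
  proof (rule ord_ge_diff[OF z])
    show "ord_ge (\<phi> * \<phi>) z (- (2 * pole_order z))"
      using ord_ge_mult[OF z ord_ge_phi[OF z] ord_ge_phi[OF z]] by simp
    show "ord_ge (mero_deriv \<phi>) z (- (2 * pole_order z))"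
    proof (cases "pole_order z = 0")
      case True
      then show ?thesis using ord_ge_deriv_0[OF z] ord_ge_phi[OF z] by simp
    next
      case False
      then have "pole_order z \<ge> 1" using pole_order_nonneg[OF z] by linarith
      then show ?thesis using ord_ge_mono[OF ord_ge_deriv[OF z ord_ge_phi[OF z]]] by simp
    qed
  qed
  then show ?thesis using has_weight_omega[OF quasimodular_cosparse] by (simp add: forms_def)
qed

text \<open>
  The order of vanishing of \<open>f\<close> as a section, measured against the admitted pole.
\<close>

definition rel_ord :: "int \<Rightarrow> mero_uhp \<Rightarrow> complex \<Rightarrow> int" where
  "rel_ord j f z = ord f z + j * pole_order z"

lemma rel_ord_nonneg: "f \<in> forms j \<Longrightarrow> f \<noteq> 0 \<Longrightarrow> z \<in> uhp \<Longrightarrow> rel_ord j f z \<ge> 0"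
  using ord_ge_iff[of z f] by (force simp: forms_def rel_ord_def)

lemma rel_ord_mult: "z \<in> uhp \<Longrightarrow> f \<noteq> 0 \<Longrightarrow> g \<noteq> 0 \<Longrightarrow> rel_ord (j + l) (f * g) z
    = rel_ord j f z + rel_ord l g z"
  by (simp add: rel_ord_def ord_mult algebra_simps)

lemma rel_ord_moebius:
  "f \<in> forms j \<Longrightarrow> f \<noteq> 0 \<Longrightarrow> A \<in> matrices_of \<Gamma> \<Longrightarrow> z \<in> uhp \<Longrightarrow> rel_ord j f (moebius A z) = rel_ord j f z"
  using ord_has_weight_moebius[of A \<Gamma> "2*j" f z] pole_order_moebius[of A z]
    by (auto simp: rel_ord_def forms_def)

text \<open>
  A quotient of forms is a form as soon as the orders allow it on a set that meets all orbits.
\<close>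

lemma forms_divide:
  assumes f: "f \<in> forms j" and g: "g \<in> forms l" "g \<noteq> 0"
    and le: "\<And>z. z \<in> fundamental_compact \<Longrightarrow> f \<noteq> 0 \<Longrightarrow> rel_ord l g z \<le> rel_ord j f z"
  obtains h where "h \<in> forms (j - l)" "f = g * h"
proof -
  obtain h where h: "f = g * h" using mero_divide[OF g(2)] by blast
  have "h \<in> forms (j - l)"
  proof (cases "f = 0")
    case True
    then have "h = 0" using h g(2) mero_no_zero_divisors by auto
    then show ?thesis by (simp add: forms_0)
  next
    case False
    then have h0: "h \<noteq> 0" using h mero_no_zero_divisors by auto
    have wt: "has_weight \<Gamma> (2 * (j - l)) h"
      using has_weight_divide[OF _ _ g(2) h] f g(1) by (simp add: forms_def right_diff_distrib)
    have "ord_ge h z (- ((j - l) * pole_order z))" if z: "z \<in> uhp" for z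
    proof -
      obtain A where A: "A \<in> matrices_of \<Gamma>" "moebius A z \<in> fundamental_compact"
        using fundamental_compact(3)[OF z] by blast
      have "rel_ord l g z \<le> rel_ord j f z"
        using le[OF A(2) False] rel_ord_moebius[OF f False A(1) z] rel_ord_moebius[OF g A(1) z] by simp
      moreover have "ord f z = ord g z + ord h z" unfolding h by (rule ord_mult[OF z g(2) h0])
      ultimately show ?thesis using z by (simp add: ord_ge_iff rel_ord_def algebra_simps)
    qed
    then show ?thesis using wt by (simp add: forms_def)
  qed
  then show ?thesis using h that by blast
qed

text \<open>
  Let \<open>c\<close> be the leading coefficient and \<open>n\<close> the order of the pole. If \<open>n \<ge> 2\<close>, the term \<open>- \<phi>\<^sup>2\<close>
  dominates. If \<open>n = 1\<close>, the coefficient of order \<open>-2\<close> is \<open>- c - c\<^sup>2 = - c (1 + c)\<close>.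
\<close>

lemma omega_exact_at_pole:
  assumes z: "z \<in> uhp" "is_pole (eval_mero \<phi>) z"
    and res: "\<not> ((\<lambda>w. (w - z) * eval_mero \<phi> w) \<longlongrightarrow> -1) (at z)"
  shows "omega \<phi> \<noteq> 0" "rel_ord 2 (omega \<phi>) z = 0"
proof -
  define n where "n = pole_order z"
  have n: "ord \<phi> z = - n" "n \<ge> 1" using z is_pole_iff_ord[OF z(1)] by (auto simp: n_def pole_order_def)
  let ?L = "laurent_at \<phi> z"
  have Lw: "laurent_at (omega \<phi>) z = fls_deriv ?L - ?L * ?L"
    by (simp add: omega_def power2_eq_square laurent_at_diff laurent_at_deriv laurent_at_mult z)
  have L0: "?L \<noteq> 0" using laurent_at_eq_0_iff[OF z(1)] phi_nonzero by blast
  have sub: "fls_subdegree ?L = - n" using n by (simp add: ord_def)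
  have low: "fls_nth ?L k = 0" if "k < - n" for k using that sub by simp
  have top: "fls_nth ?L (- n) \<noteq> 0" using L0 sub by (metis nth_fls_subdegree_nonzero)
  have LL: "fls_nth (?L * ?L) (- (2 * n)) = fls_nth ?L (- n) * fls_nth ?L (- n)"
    using fls_times_base[of ?L ?L] sub by simp
  have nz: "fls_nth (laurent_at (omega \<phi>) z) (- (2 * n)) \<noteq> 0"
  proof (cases "n = 1")
    case False
    then have d0: "fls_nth (fls_deriv ?L) (- (2 * n)) = 0" using n low by simp
    show ?thesis unfolding Lw fls_minus_nth LL d0 using top by simp
  next
    case True
    have "fls_nth ?L (-1) \<noteq> -1"
    proof
      assume m: "fls_nth ?L (-1) = -1"
      have "(\<lambda>w. (z + w - z) * eval_mero \<phi> (z + w)) has_laurent_expansion fls_X * ?L"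
        by (simp, intro has_laurent_expansion_mult has_laurent_expansion_fps_X
          has_laurent_expansion_laurent_at z)
      from has_laurent_expansion_imp_tendsto[OF this]
      have "((\<lambda>w. (w - z) * eval_mero \<phi> w) \<longlongrightarrow> fls_nth (fls_X * ?L) 0) (at z)"
        using L0 sub True by (simp add: fls_subdegree_mult_fls_X)
      then show False using res m by (simp add: fls_X_times_conv_shift)
    qed
    then have "fls_nth ?L (-1) * (1 + fls_nth ?L (-1)) \<noteq> 0" using top True by (simp add: add_eq_0_iff)
    moreover have
        "fls_nth (laurent_at (omega \<phi>) z) (- (2 * n)) = - (fls_nth ?L (-1) * (1 + fls_nth ?L (-1)))"
      unfolding Lw using LL True by (simp add: algebra_simps)
    ultimately show ?thesis by simp
  qed
  then show "omega \<phi> \<noteq> 0" using laurent_at_0[OF z(1)] by fastforce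
  have "ord_ge (omega \<phi>) z (- (2 * n))" using omega_forms z(1) by (simp add: forms_def n_def)
  then have "fls_nth (laurent_at (omega \<phi>) z) k = 0" if "k < - (2 * n)" for k using that
    by (simp add: ord_ge_def)
  then have "ord (omega \<phi>) z = - (2 * n)" unfolding ord_def using nz by (intro fls_subdegree_eqI) auto
  then show "rel_ord 2 (omega \<phi>) z = 0" by (simp add: rel_ord_def n_def)
qed

lemma omega_nonzero: "omega \<phi> \<noteq> 0"
  using exists_pole_residue_not_minus_one[OF disc cocomp quasi] omega_exact_at_pole(1) by blast

text \<open>
  All poles lie in one orbit, on which the relative order of \<open>\<omega>\<close> is constant.
\<close>

lemma omega_rel_ord_pole:
  assumes z: "z \<in> uhp" "is_pole (eval_mero \<phi>) z" shows "rel_ord 2 (omega \<phi>) z = 0"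
proof -
  obtain z0
      where z0: "z0 \<in> uhp" "is_pole (eval_mero \<phi>) z0" "\<not> ((\<lambda>w. (w - z0) * eval_mero \<phi> w) \<longlongrightarrow> -1) (at z0)"
    using exists_pole_residue_not_minus_one[OF disc cocomp quasi] by blast
  have orb: "y \<in> orbit \<Gamma> \<i>" if "y \<in> uhp" "is_pole (eval_mero \<phi>) y" for y
    using quasi that by (simp add: quasimodular_weight2_delta1_def)
  obtain A where A: "A \<in> matrices_of \<Gamma>" "z = moebius A \<i>" using orb[OF z] by (auto simp: orbit_def)
  obtain B where B: "B \<in> matrices_of \<Gamma>" "z0 = moebius B \<i>" using orb[OF z0(1,2)]
    by (auto simp: orbit_def)
  have "rel_ord 2 (omega \<phi>) z = rel_ord 2 (omega \<phi>) z0"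
    using rel_ord_moebius[OF omega_forms omega_nonzero _ i_in_uhp] A B by simp
  then show ?thesis using omega_exact_at_pole(2)[OF z0] by simp
qed

text \<open>
  A form of weight \<open>- 2 n\<close> is holomorphic, as its admitted poles have order at most 0. The
  function \<open>u = \<bar>f\<bar> / (Im z)\<^sup>n\<close> is invariant, so it has a maximum, at \<open>z0\<close> say. Since \<open>4 Im z Im
  z0 = \<bar>z - cnj z0\<bar>\<^sup>2 - \<bar>z - z0\<bar>\<^sup>2\<close>, the quotient \<open>Im z / \<bar>z - cnj z0\<bar>\<^sup>2\<close> has a strict maximum at
  \<open>z0\<close>. Hence \<open>f / (z - cnj z0)\<^bsup>2 n\<^esup>\<close> has a strict maximum of its modulus at \<open>z0\<close> unless \<open>f = 0\<close>.
\<close>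

lemma forms_negative:
  assumes j: "j < 0" and f: "f \<in> forms j" shows "f = 0"
proof (rule ccontr)
  assume nz: "f \<noteq> 0"
  let ?F = "eval_mero f"
  define n where "n = nat (- j)"
  have jn: "j = - int n" "n > 0" using j by (auto simp: n_def)
  have np: "\<not> is_pole ?F z" if z: "z \<in> uhp" for z
  proof -
    have "ord_ge f z (- (j * pole_order z))" using f z by (simp add: forms_def)
    then have "ord_ge f z 0"
      by (rule ord_ge_mono) (use j pole_order_nonneg[OF z] in \<open>simp add: mult_nonpos_nonneg\<close>)
    then show ?thesis using ord_ge_0_iff[OF z] by blast
  qed
  have an: "?F analytic_on uhp" using analytic_at_nonpole np by (subst analytic_on_analytic_at) auto
  have holo: "?F holomorphic_on uhp" using an by (rule analytic_imp_holomorphic)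
  have cont: "isCont ?F z" if "z \<in> uhp" for z using holo that open_uhp
    by (meson continuous_on_eq_continuous_at holomorphic_on_imp_continuous_on)
  have law: "?F (moebius A z) * automorphy A z ^ (2 * n) = ?F z"
      if A: "A \<in> matrices_of \<Gamma>" and z: "z \<in> uhp" for A z
  proof (rule LIM_unique)
    note d = matrices_of_det[OF A]
    have "isCont (\<lambda>z. ?F (moebius A z)) z"
      by (rule isCont_o2[OF DERIV_isCont[OF has_field_derivative_moebius[OF d z]]])
        (rule cont[OF moebius_in_uhp[OF d z]])
    then have "isCont (\<lambda>z. ?F (moebius A z) * automorphy A z ^ (2 * n)) z"
      unfolding automorphy_def by (intro continuous_intros)
    then show
        "((\<lambda>z. ?F (moebius A z) * automorphy A z ^ (2 * n)) \<longlongrightarrow> ?F (moebius A z) * automorphy A z ^ (2 *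
            n)) (at z)"
      by (simp add: isCont_def)
    show "((\<lambda>z. ?F (moebius A z) * automorphy A z ^ (2 * n)) \<longlongrightarrow> ?F z) (at z)"
    proof (rule Lim_transform_eventually)
      show "(?F \<longlongrightarrow> ?F z) (at z)" using cont[OF z] by (simp add: isCont_def)
      have "\<forall>\<^sub>F w in at z. ?F (moebius A w) = automorphy A w powi (2 * j) * ?F w"
        using f A z unfolding forms_def has_weight_def cosparse_uhp_iff by auto
      moreover have "\<forall>\<^sub>F w in at z. w \<in> uhp" by (rule eventually_at_in_open'[OF open_uhp z])
      ultimately show "\<forall>\<^sub>F w in at z. ?F w = ?F (moebius A w) * automorphy A w ^ (2 * n)"
      proof eventually_elim
        case (elim w)
        have "automorphy A w \<noteq> 0" by (rule automorphy_nonzero[OF d elim(2)])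
        moreover have "2 * j = - int (2 * n)" using jn by simp
        ultimately show ?case unfolding elim(1)
          by (simp add: power_int_minus power_int_of_nat del: of_nat_mult)
      qed
    qed
  qed
  define u where "u = (\<lambda>z. norm (?F z) / (Im z) ^ n)"
  have uinv: "u (moebius A z) = u z" if A: "A \<in> matrices_of \<Gamma>" and z: "z \<in> uhp" for A z
  proof -
    note d = matrices_of_det[OF A]
    have "norm (?F z) = norm (?F (moebius A z)) * norm (automorphy A z) ^ (2 * n)"
      using law[OF A z] by (metis norm_mult norm_power)
    then show ?thesis unfolding u_def Im_moebius[OF d z]
      using automorphy_nonzero[OF d z] z
        by (simp add: power_divide uhp_def field_simps flip: power_mult)
  qed
  have "fundamental_compact \<noteq> {}" using fundamental_compact(3)[OF i_in_uhp] by auto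
  moreover have "continuous_on fundamental_compact u"
    unfolding u_def using holomorphic_on_imp_continuous_on[OF holo] fundamental_compact(2)
    by (intro continuous_intros) (auto intro: continuous_on_subset simp: uhp_def)
  ultimately obtain z0 where z0: "z0 \<in> fundamental_compact" "\<And>z. z \<in> fundamental_compact \<Longrightarrow> u z \<le> u z0"
    using continuous_attains_sup[OF fundamental_compact(1)] by blast
  have z0u: "z0 \<in> uhp" using z0 fundamental_compact(2) by auto
  have max: "u z \<le> u z0" if z: "z \<in> uhp" for z
    using fundamental_compact(3)[OF z] uinv[OF _ z] z0(2) by metis
  define g where "g = (\<lambda>z. ?F z / (z - cnj z0) ^ (2 * n))"
  have y0: "Im z0 > 0" using z0u by (simp add: uhp_def)
  have dz: "z - cnj z0 \<noteq> 0" if "z \<in> uhp" for z using that y0 by (auto simp: uhp_def complex_eq_iff)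
  have gh: "g holomorphic_on uhp" unfolding g_def using dz by (intro holomorphic_intros holo) auto
  have id4: "(norm (z - cnj z0))\<^sup>2 = (norm (z - z0))\<^sup>2 + 4 * Im z * Im z0" for z
    unfolding cmod_power2 by (simp add: power2_eq_square algebra_simps)
  have ug: "norm (g z) = u z * (Im z / (norm (z - cnj z0))\<^sup>2) ^ n" if "z \<in> uhp" for z
    using that dz[OF that]
      by (simp add: g_def u_def norm_divide norm_power power_divide power_mult uhp_def)
  have q0: "Im z0 / (norm (z0 - cnj z0))\<^sup>2 = 1 / (4 * Im z0)" using id4[of z0] y0 by simp
  have qz: "Im z / (norm (z - cnj z0))\<^sup>2 \<le> 1 / (4 * Im z0)" if "z \<in> uhp" for z
  proof -
    have "0 < (norm (z - cnj z0))\<^sup>2" using dz[OF that] by simp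
    moreover have "Im z \<le> 1 / (4 * Im z0) * (norm (z - cnj z0))\<^sup>2"
      unfolding id4[of z] using y0 by (simp add: field_simps)
    ultimately show ?thesis by (simp add: pos_divide_le_eq)
  qed
  have gmax: "norm (g z) \<le> norm (g z0)" if z: "z \<in> uhp" for z
    unfolding ug[OF z] ug[OF z0u] q0
    using max[OF z] qz[OF z] z y0 by (intro mult_mono power_mono) (auto simp: u_def uhp_def)
  have "g constant_on uhp"
    by (rule maximum_modulus_principle[OF gh open_uhp connected_uhp open_uhp subset_refl z0u gmax])
  then obtain c where c: "\<And>z. z \<in> uhp \<Longrightarrow> g z = c" by (auto simp: constant_on_def)
  have uz0: "u z0 \<noteq> 0"
  proof
    assume "u z0 = 0"
    then have "norm (g z0) = 0" using ug[OF z0u] by simp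
    then have "c = 0" using c[OF z0u] by simp
    then have "?F z = 0" if "z \<in> uhp" for z
      using c[OF that] dz[OF that] by (auto simp: g_def)
    moreover have "\<forall>\<^sub>F w in at \<i>. ?F w \<noteq> 0 \<and> w \<in> uhp"
      using eventually_nonzero[OF nz] i_in_uhp eventually_at_in_open'[OF open_uhp i_in_uhp]
      unfolding cosparse_uhp_iff by (auto intro: eventually_conj)
    ultimately show False using eventually_happens[of _ "at \<i>"] by fastforce
  qed
  define z1 where "z1 = z0 + \<i>"
  have z1u: "z1 \<in> uhp" using y0 by (simp add: z1_def uhp_def)
  have "Im z1 / (norm (z1 - cnj z0))\<^sup>2 < 1 / (4 * Im z0)"
    using id4[of z1] y0 z1u by (simp add: z1_def field_simps uhp_def add_pos_pos)
  then have "(Im z1 / (norm (z1 - cnj z0))\<^sup>2) ^ n < (1 / (4 * Im z0)) ^ n"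
    using jn(2) z1u by (intro power_strict_mono) (auto simp: uhp_def)
  moreover have "u z1 \<le> u z0" "u z0 > 0" "u z1 \<ge> 0" using max[OF z1u] uz0 y0 z1u
    by (auto simp: u_def uhp_def)
  ultimately have "norm (g z1) < norm (g z0)"
    unfolding ug[OF z1u] ug[OF z0u] q0
    by (smt (verit) mult_less_cancel_left_pos mult_right_mono zero_le_power divide_nonneg_nonneg y0 z1u
      uhp_iff zero_le_power2)
  then show False using c[OF z1u] c[OF z0u] by simp
qed

section \<open>Derivatives of omega without common zeros\<close>

lemma forms_power: "f \<in> forms j \<Longrightarrow> f ^ n \<in> forms (int n * j)"
proof (induction n)
  case 0
  then show ?case using forms_const[of 1] by (simp add: mero_const_1)
next
  case (Suc n)
  then show ?case using forms_mult[OF Suc.prems Suc.IH[OF Suc.prems]] by (simp add: algebra_simps)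
qed

lemma mero_power_nonzero: "f \<noteq> 0 \<Longrightarrow> f ^ n \<noteq> (0 :: mero_uhp)"
proof (induction n)
  case 0
  have "(1 :: mero_uhp) \<noteq> 0" by (metis zero_neq_one)
  then show ?case by simp
qed (simp add: mero_no_zero_divisors)

lemma rel_ord_1: "z \<in> uhp \<Longrightarrow> rel_ord 0 1 z = 0"
  using ord_const[of z 1] by (simp add: rel_ord_def mero_const_1)

lemma rel_ord_power: "z \<in> uhp \<Longrightarrow> f \<noteq> 0 \<Longrightarrow> rel_ord (int n * j) (f ^ n) z = int n * rel_ord j f z"
proof (induction n)
  case 0
  then show ?case by (simp add: rel_ord_1)
next
  case (Suc n)
  have "rel_ord (j + int n * j) (f * f ^ n) z = rel_ord j f z + rel_ord (int n * j) (f ^ n) z"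
    using Suc.prems by (intro rel_ord_mult mero_power_nonzero)
  then show ?case using Suc by (simp add: algebra_simps)
qed

definition covariant_deriv :: "int \<Rightarrow> mero_uhp \<Rightarrow> mero_uhp" where
  "covariant_deriv j f = mero_deriv f - of_int (2 * j) * \<phi> * f"

lemma D_single_covariant_deriv:
    "D \<phi> (Poly_Mapping.single (2 * j) f) = Poly_Mapping.single (2 * (j + 1)) (covariant_deriv j f)"
  by (simp add: D_single covariant_deriv_def algebra_simps)

fun omega_iter :: "nat \<Rightarrow> mero_uhp" where
  "omega_iter 0 = omega \<phi>"
| "omega_iter (Suc l) = covariant_deriv (2 + int l) (omega_iter l)"

lemma D_power_omega:
    "(D \<phi> ^^ l) (Poly_Mapping.single 4 (omega \<phi>)) = Poly_Mapping.single (2 * (2 + int l)) (omega_iter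
        l)"
proof (induction l)
  case (Suc l)
  then show ?case using D_single_covariant_deriv[of "2 + int l" "omega_iter l"]
    by (simp add: algebra_simps)
qed simp

lemma omega_iter_forms: "omega_iter l \<in> forms (2 + int l)"
proof (induction l)
  case 0
  then show ?case using omega_forms by simp
next
  case (Suc l)
  then show ?case using covariant_derivative_forms[OF Suc]
    by (simp add: covariant_deriv_def algebra_simps)
qed

lemma D_power_single_forms:
  assumes "g \<in> forms j"
  shows "\<exists>h\<in>forms (j + int l). (D \<phi> ^^ l) (Poly_Mapping.single (2 * j) g)
      = Poly_Mapping.single (2 * (j + int l)) h"
proof (induction l)
  case 0
  then show ?case using assms by auto
next
  case (Suc l)
  then obtain h
      where h: "h \<in> forms (j + int l)"
          "(D \<phi> ^^ l) (Poly_Mapping.single (2 * j) g) = Poly_Mapping.single (2 * (j + int l)) h"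
            by blast
  have "covariant_deriv (j + int l) h \<in> forms (j + int l + 1)" using covariant_derivative_forms[OF h(1)]
    by (simp add: covariant_deriv_def)
  moreover have
      "(D \<phi> ^^ Suc l) (Poly_Mapping.single (2 * j) g)
          = Poly_Mapping.single (2 * (j + int l + 1)) (covariant_deriv (j + int l) h)"
    by (simp only: funpow.simps(2) o_apply h(2) D_single_covariant_deriv)
  ultimately show ?case
    by (intro bexI[of _ "covariant_deriv (j + int l) h"]) (simp_all add: algebra_simps)
qed

text \<open>
  Where \<open>\<phi>\<close> has no pole, \<open>f'\<close> vanishes to exactly one order less than \<open>f\<close>, and \<open>\<phi> f\<close> to no smaller
  order than \<open>f\<close>.
\<close>

lemma omega_iter_rel_ord:
  assumes z: "z \<in> uhp" and m: "rel_ord 2 (omega \<phi>) z = int m" and np: "\<not> is_pole (eval_mero \<phi>) z"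
  shows "l \<le> m \<Longrightarrow> omega_iter l \<noteq> 0 \<and> ord (omega_iter l) z = int m - int l"
proof (induction l)
  case 0
  then show ?case using omega_nonzero m np by (simp add: rel_ord_def pole_order_def)
next
  case (Suc l)
  let ?f = "omega_iter l"
  have f: "?f \<noteq> 0" "ord ?f z = int m - int l" "ord ?f z \<noteq> 0" using Suc by auto
  note d = ord_deriv[OF z f(1,3)]
  have "ord_ge (of_int (2 * (2 + int l)) * \<phi>) z 0"
    using ord_ge_of_int_mult[OF z] ord_ge_0_iff[OF z] np by blast
  moreover have "ord_ge ?f z (ord ?f z)" using z by (simp add: ord_ge_iff)
  ultimately have "ord_ge (of_int (2 * (2 + int l)) * \<phi> * ?f) z (0 + ord ?f z)"
    by (rule ord_ge_mult[OF z])
  from ord_ge_diff[OF z ord_ge_0[OF z] this]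
  have g: "ord_ge (- (of_int (2 * (2 + int l)) * \<phi> * ?f)) z (ord (mero_deriv ?f) z + 1)" using d(2)
    by simp
  have "omega_iter (Suc l) = mero_deriv ?f + - (of_int (2 * (2 + int l)) * \<phi> * ?f)"
    by (simp add: covariant_deriv_def)
  then show ?case using ord_add_less[OF z d(1) g] d(2) f(2) by simp
qed

text \<open>
  Zeros in the sense of sections. A compact set that meets every orbit may contain several points
  of an orbit; counting such zeros repeatedly does no harm.
\<close>

definition omega_zeros :: "complex set"
    where "omega_zeros = {z \<in> fundamental_compact. rel_ord 2 (omega \<phi>) z > 0}"

lemma zeros_not_pole: "z \<in> omega_zeros \<Longrightarrow> \<not> is_pole (eval_mero \<phi>) z"
  using omega_rel_ord_pole[of z] fundamental_compact(2) by (auto simp: omega_zeros_def)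

lemma zeros_uhp: "z \<in> omega_zeros \<Longrightarrow> z \<in> uhp" using fundamental_compact(2)
  by (auto simp: omega_zeros_def)

lemma finite_zeros: "finite omega_zeros"
proof -
  have "\<forall>\<^sub>\<approx>z\<in>uhp. ord (omega \<phi>) z = 0"
    using cosparse_analytic[of "omega \<phi>"] eventually_nonzero[OF omega_nonzero]
      eventually_in_cosparse[OF subset_refl open_uhp]
  proof eventually_elim
    case (elim z)
    then show ?case using ord_eq_zorder[OF elim(3) omega_nonzero] zorder_eq_0I by simp
  qed
  then have "{z. ord (omega \<phi>) z \<noteq> 0} sparse_in uhp" by (simp add: eventually_cosparse)
  then have "{z. ord (omega \<phi>) z \<noteq> 0} sparse_in fundamental_compact"
    by (rule sparse_in_subset[OF _ fundamental_compact(2)])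
  then have "finite (fundamental_compact \<inter> {z. ord (omega \<phi>) z \<noteq> 0})"
    by (rule sparse_in_compact_finite[OF _ fundamental_compact(1)])
  moreover have "omega_zeros \<subseteq> fundamental_compact \<inter> {z. ord (omega \<phi>) z \<noteq> 0}"
    using zeros_not_pole by (force simp: omega_zeros_def rel_ord_def pole_order_def)
  ultimately show ?thesis by (rule rev_finite_subset)
qed

lemma pole_order_zeros: "z \<in> omega_zeros \<Longrightarrow> pole_order z = 0" using zeros_not_pole
  by (simp add: pole_order_def)

definition constant_coeff :: "complex \<Rightarrow> mero_uhp \<Rightarrow> complex"
    where "constant_coeff z f = fls_nth (laurent_at f z) 0"

lemma constant_coeff_nonzero_iff:
  assumes "z \<in> omega_zeros" "f \<in> forms j"
  shows "constant_coeff z f \<noteq> 0 \<longleftrightarrow> f \<noteq> 0 \<and> rel_ord j f z = 0"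
proof -
  have z: "z \<in> uhp" by (rule zeros_uhp[OF assms(1)])
  have ge: "ord_ge f z 0" using assms z pole_order_zeros[OF assms(1)] by (auto simp: forms_def)
  show ?thesis
  proof
    assume l: "constant_coeff z f \<noteq> 0"
    then have nz: "f \<noteq> 0" using laurent_at_0[OF z] by (auto simp: constant_coeff_def)
    have "ord f z = 0" unfolding ord_def
      by (rule fls_subdegree_eqI) (use l ge in \<open>auto simp: constant_coeff_def ord_ge_def\<close>)
    then show "f \<noteq> 0 \<and> rel_ord j f z = 0" using nz pole_order_zeros[OF assms(1)]
      by (simp add: rel_ord_def)
  next
    assume f: "f \<noteq> 0 \<and> rel_ord j f z = 0"
    then have "laurent_at f z \<noteq> 0" "fls_subdegree (laurent_at f z) = 0"
      using laurent_at_eq_0_iff[OF z] pole_order_zeros[OF assms(1)] by (auto simp: rel_ord_def ord_def)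
    then show "constant_coeff z f \<noteq> 0" unfolding constant_coeff_def by (metis nth_fls_subdegree_nonzero)
  qed
qed

text \<open>
  A vector space over an infinite field is not a finite union of proper subspaces.
\<close>

lemma nonvanishing_combination:
  assumes "finite Z" "Z \<subseteq> uhp" "\<And>z. z \<in> Z \<Longrightarrow> \<exists>y\<in>Y. constant_coeff z y \<noteq> 0" "0 \<in> Y"
    and add: "\<And>f g. f \<in> Y \<Longrightarrow> g \<in> Y \<Longrightarrow> f + g \<in> Y" and cmult: "\<And>c f. f \<in> Y \<Longrightarrow> mero_const c * f \<in> Y"
  shows "\<exists>f\<in>Y. \<forall>z\<in>Z. constant_coeff z f \<noteq> 0"
  using assms(1-3)
proof (induction Z rule: finite_induct)
  case empty
  then show ?case using assms(4) by auto
next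
  case (insert z Z)
  then obtain f where f: "f \<in> Y" "\<forall>z\<in>Z. constant_coeff z f \<noteq> 0" by auto
  obtain y where y: "y \<in> Y" "constant_coeff z y \<noteq> 0" using insert.prems(2)[of z] by blast
  show ?case
  proof (cases "constant_coeff z f = 0")
    case False
    then show ?thesis using f by auto
  next
    case True
    have "finite (insert 0 ((\<lambda>w. - constant_coeff w f / constant_coeff w y) ` Z))" using insert(1)
      by simp
    then obtain c where c: "c \<notin> insert 0 ((\<lambda>w. - constant_coeff w f / constant_coeff w y) ` Z)"
      using ex_new_if_finite[OF infinite_UNIV_char_0] by blast
    have lin: "constant_coeff w (f + mero_const c * y) = constant_coeff w f + c * constant_coeff w y"
        if "w \<in> uhp" for w
      using that by (simp add: constant_coeff_def laurent_at_add laurent_at_mult laurent_at_const)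
    have "constant_coeff w (f + mero_const c * y) \<noteq> 0" if w: "w \<in> Z" for w
    proof
      assume "constant_coeff w (f + mero_const c * y) = 0"
      then have e: "constant_coeff w f + c * constant_coeff w y = 0" using lin w insert.prems(1) by auto
      then have "constant_coeff w y \<noteq> 0" using f(2) w by auto
      then have "c = - constant_coeff w f / constant_coeff w y" using e
        by (simp add: field_simps eq_neg_iff_add_eq_0)
      then show False using c w by blast
    qed
    moreover have "constant_coeff z (f + mero_const c * y) \<noteq> 0" using lin[of z] insert.prems(1) True y c
      by auto
    ultimately show ?thesis using add[OF f(1) cmult[OF y(1)]] by blast
  qed
qed

text \<open>
  The number of zeros with multiplicity; it also bounds each single multiplicity.
\<close>

definition num_zeros :: nat where "num_zeros = (\<Sum>z\<in>omega_zeros. nat (rel_ord 2 (omega \<phi>) z))"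

text \<open>
  At each zero of \<open>\<omega>\<close> some iterated derivative of order at most \<open>num_zeros\<close> does not vanish.
  Powers bring these derivatives to a common weight, where a linear combination avoids all the
  zeros.
\<close>

lemma exists_nonvanishing_form:
  assumes "\<And>l. l \<le> num_zeros \<Longrightarrow> omega_iter l \<in> component (generated_algebra S) (2 + int l)"
  defines "W \<equiv> (\<Prod>l\<le>num_zeros. 2 + l)"
  shows "\<exists>G\<in>forms (int W) \<inter> component (generated_algebra S) (int W). \<forall>z\<in>omega_zeros. G \<noteq> 0
      \<and> rel_ord (int W) G z = 0"
proof -
  let ?Y = "forms (int W) \<inter> component (generated_algebra S) (int W)"
  have "\<exists>y\<in>?Y. constant_coeff z y \<noteq> 0" if z: "z \<in> omega_zeros" for z
  proof -
    have zu: "z \<in> uhp" by (rule zeros_uhp[OF z])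
    define m where "m = nat (rel_ord 2 (omega \<phi>) z)"
    have m: "rel_ord 2 (omega \<phi>) z = int m" using z by (simp add: m_def omega_zeros_def)
    have mle: "m \<le> num_zeros" unfolding m_def num_zeros_def
      by (rule member_le_sum[OF z]) (auto simp: finite_zeros)
    have o: "omega_iter m \<noteq> 0" "rel_ord (2 + int m) (omega_iter m) z = 0"
      using omega_iter_rel_ord[OF zu m zeros_not_pole[OF z], of m] pole_order_zeros[OF z]
        by (auto simp: rel_ord_def)
    have "(2 + m) dvd W" unfolding W_def by (rule dvd_prodI) (use mle in auto)
    then obtain e where e: "W = (2 + m) * e" by (rule dvdE)
    have W: "int W = int e * (2 + int m)" unfolding e by (simp add: algebra_simps)
    have "omega_iter m ^ e \<in> ?Y" unfolding W
      using forms_power[OF omega_iter_forms] component_power[OF assms(1)[OF mle]] by blast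
    moreover have "constant_coeff z (omega_iter m ^ e) \<noteq> 0"
      using constant_coeff_nonzero_iff[OF z forms_power[OF omega_iter_forms]]
        rel_ord_power[OF zu o(1), of e] o mero_power_nonzero[OF o(1)]
      by simp
    ultimately show ?thesis by blast
  qed
  moreover have "0 \<in> ?Y" using forms_0 by (simp add: component_def generated_algebra_0)
  ultimately obtain G where G: "G \<in> ?Y" "\<forall>z\<in>omega_zeros. constant_coeff z G \<noteq> 0"
    using nonvanishing_combination[of omega_zeros ?Y] finite_zeros zeros_uhp
    by (auto intro: forms_add forms_cmult component_add component_cmult)
  then show ?thesis using constant_coeff_nonzero_iff by blast
qed

section \<open>Levels along the divisor of omega\<close>

lemma zero_enumeration:
  obtains s :: "nat \<Rightarrow> complex" where "\<And>i. i < num_zeros \<Longrightarrow> s i \<in> omega_zeros"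
    "\<And>z. z \<in> omega_zeros \<Longrightarrow> card {i. i < num_zeros \<and> s i = z} = nat (rel_ord 2 (omega \<phi>) z)"
proof -
  let ?m = "\<lambda>z. nat (rel_ord 2 (omega \<phi>) z)"
  let ?S = "SIGMA z:omega_zeros. {..<?m z}"
  have "finite ?S" using finite_zeros by auto
  moreover have "card ?S = num_zeros" by (simp add: num_zeros_def card_SigmaI finite_zeros)
  ultimately obtain h where h: "bij_betw h {0..<num_zeros} ?S" using ex_bij_betw_nat_finite by metis
  have hS: "h i \<in> ?S" if "i < num_zeros" for i using bij_betwE[OF h] that by simp
  show ?thesis
  proof (rule that[of "fst \<circ> h"])
    show "(fst \<circ> h) i \<in> omega_zeros" if "i < num_zeros" for i using hS[OF that] by auto
    show "card {i. i < num_zeros \<and> (fst \<circ> h) i = z} = ?m z" if z: "z \<in> omega_zeros" for z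
    proof -
      let ?A = "{i. i < num_zeros \<and> (fst \<circ> h) i = z}"
      have img: "h ` ?A = {z} \<times> {..<?m z}"
      proof (intro equalityI subsetI)
        fix x assume "x \<in> h ` ?A"
        then obtain i where i: "i < num_zeros" "fst (h i) = z" "x = h i" by auto
        then have "x \<in> ?S" using hS by blast
        then show "x \<in> {z} \<times> {..<?m z}" using i by (cases x) auto
      next
        fix x assume x: "x \<in> {z} \<times> {..<?m z}"
        then have "x \<in> ?S" using z by auto
        then have "x \<in> h ` {0..<num_zeros}" using h unfolding bij_betw_def by blast
        then obtain i where i: "i < num_zeros" "x = h i" by auto
        then have "i \<in> ?A" using x by auto
        then show "x \<in> h ` ?A" using i(2) by blast
      qed
      have inj: "inj_on h ?A" by (rule inj_on_subset[OF bij_betw_imp_inj_on[OF h]]) auto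
      have "card ?A = card ({z} \<times> {..<?m z})" using card_image[OF inj] unfolding img by (rule sym)
      then show ?thesis by (simp add: card_cartesian_product_singleton)
    qed
  qed
qed

definition zero_seq :: "nat \<Rightarrow> complex" where
  "zero_seq = (SOME s. (\<forall>i<num_zeros. s i \<in> omega_zeros) \<and>
      (\<forall>z\<in>omega_zeros. card {i. i < num_zeros \<and> s i = z} = nat (rel_ord 2 (omega \<phi>) z)))"

lemma zero_seq: "i < num_zeros \<Longrightarrow> zero_seq i \<in> omega_zeros"
  "z \<in> omega_zeros \<Longrightarrow> card {i. i < num_zeros \<and> zero_seq i = z} = nat (rel_ord 2 (omega \<phi>) z)"
proof -
  have "\<exists>s. (\<forall>i<num_zeros. s i \<in> omega_zeros) \<and> (\<forall>z\<in>omega_zeros. card {i. i < num_zeros \<and> s i = z}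
      = nat (rel_ord 2 (omega \<phi>) z))"
    using zero_enumeration by metis
  from someI_ex[OF this] show "i < num_zeros \<Longrightarrow> zero_seq i \<in> omega_zeros"
    "z \<in> omega_zeros \<Longrightarrow> card {i. i < num_zeros \<and> zero_seq i = z} = nat (rel_ord 2 (omega \<phi>) z)"
    unfolding zero_seq_def[symmetric] by auto
qed

text \<open>
  Otherwise \<open>1 / \<omega>\<close> would be a form of negative weight.
\<close>

lemma num_zeros_pos: "num_zeros > 0"
proof (rule ccontr)
  assume "\<not> ?thesis"
  then have "omega_zeros = {}" using finite_zeros by (auto simp: num_zeros_def omega_zeros_def)
  then have "rel_ord 2 (omega \<phi>) z \<le> rel_ord 0 1 z" if "z \<in> fundamental_compact" for z
    using that fundamental_compact(2) rel_ord_1[of z] by (force simp: omega_zeros_def)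
  then obtain h where h: "h \<in> forms (0 - 2)" "1 = omega \<phi> * h"
    using forms_divide[OF _ omega_forms omega_nonzero, of 1 0] forms_const[of 1]
      by (auto simp: mero_const_1)
  have "h = 0" using forms_negative[OF _ h(1)] by simp
  then show False using h(2) by (metis mult_zero_right zero_neq_one)
qed

definition zero_at :: "nat \<Rightarrow> complex" where "zero_at b = zero_seq (b mod num_zeros)"

text \<open>
  The multiplicity of \<open>z\<close> among the first \<open>b\<close> members of the periodic sequence \<open>zero_at\<close>. The
  closed formula makes the shift by a full period evident.
\<close>

definition divisor :: "nat \<Rightarrow> complex \<Rightarrow> int" where
  "divisor b z = int (b div num_zeros) * rel_ord 2 (omega \<phi>) z + int (card {i. i < b mod num_zeros
      \<and> zero_seq i = z})"

lemma zero_at_in: "zero_at b \<in> omega_zeros" unfolding zero_at_def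
  by (rule zero_seq) (use num_zeros_pos in simp)

lemma divisor_0: "divisor 0 z = 0" by (simp add: divisor_def)

lemma divisor_add: "divisor (b + n * num_zeros) z = divisor b z + int n * rel_ord 2 (omega \<phi>) z"
  using num_zeros_pos by (simp add: divisor_def algebra_simps)

lemma divisor_Suc:
  assumes "z \<in> omega_zeros" shows "divisor (Suc b) z = divisor b z + (if zero_at b = z then 1 else 0)"
proof -
  let ?r = "b mod num_zeros"
  have set: "{i. i < Suc ?r \<and> zero_seq i = z} = {i. i < ?r \<and> zero_seq i = z} \<union> (if zero_at b
      = z then {?r} else {})"
    by (auto simp: zero_at_def less_Suc_eq)
  have c: "card {i. i < Suc ?r \<and> zero_seq i = z} = card {i. i < ?r \<and> zero_seq i = z} + (if zero_at b
      = z then 1 else 0)"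
    unfolding set by (subst card_Un_disjoint) auto
  show ?thesis
  proof (cases "Suc ?r = num_zeros")
    case True
    then have "Suc b mod num_zeros = 0" "Suc b div num_zeros = Suc (b div num_zeros)"
      by (simp_all add: mod_Suc div_Suc)
    then have "divisor (Suc b) z = (int (b div num_zeros) + 1) * rel_ord 2 (omega \<phi>) z"
      by (simp add: divisor_def add.commute)
    moreover have "int (card {i. i < Suc ?r \<and> zero_seq i = z}) = rel_ord 2 (omega \<phi>) z"
      unfolding True using zero_seq(2)[OF assms] assms by (simp add: omega_zeros_def)
    then have "rel_ord 2 (omega \<phi>) z = int (card {i. i < ?r \<and> zero_seq i = z}) + (if zero_at b
        = z then 1 else 0)"
      unfolding c by (simp split: if_splits)
    ultimately show ?thesis unfolding divisor_def[of b] by (simp only: distrib_right mult_1 add.assoc)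
  next
    case False
    then have "Suc b mod num_zeros = Suc ?r" "Suc b div num_zeros = b div num_zeros"
      by (simp_all add: mod_Suc div_Suc)
    then show ?thesis using c by (simp add: divisor_def)
  qed
qed

definition above :: "int \<Rightarrow> mero_uhp \<Rightarrow> nat \<Rightarrow> bool" where
  "above j f b \<longleftrightarrow> (\<forall>z\<in>omega_zeros. divisor b z \<le> rel_ord j f z)"

text \<open>
  The largest \<open>b\<close> with \<open>above j f b\<close>: the next member of the sequence violates the condition.
\<close>

definition level :: "int \<Rightarrow> mero_uhp \<Rightarrow> nat \<Rightarrow> bool" where
  "level j f b \<longleftrightarrow> f \<noteq> 0 \<and> above j f b \<and> rel_ord j f (zero_at b) = divisor b (zero_at b)"

text \<open>
  The form is divisible by the power of \<open>\<omega>\<close> given by the number of complete periods, and the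
  quotient cannot have negative weight.
\<close>

lemma above_bound:
  assumes f: "f \<in> forms (int j)" "f \<noteq> 0" and ab: "above (int j) f b"
  shows "2 * (b div num_zeros) \<le> j"
proof -
  define n where "n = b div num_zeros"
  have "omega \<phi> ^ n \<in> forms (int n * 2)" by (rule forms_power[OF omega_forms])
  moreover have "omega \<phi> ^ n \<noteq> 0" by (rule mero_power_nonzero[OF omega_nonzero])
  moreover have "rel_ord (int n * 2) (omega \<phi> ^ n) z \<le> rel_ord (int j) f z"
      if z: "z \<in> fundamental_compact" for z
  proof -
    have zu: "z \<in> uhp" using z fundamental_compact(2) by auto
    have e: "rel_ord (int n * 2) (omega \<phi> ^ n) z = int n * rel_ord 2 (omega \<phi>) z"
      by (rule rel_ord_power[OF zu omega_nonzero])
    show ?thesis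
    proof (cases "z \<in> omega_zeros")
      case True
      then have "divisor b z \<le> rel_ord (int j) f z" using ab by (simp add: above_def)
      then show ?thesis unfolding e by (simp add: divisor_def n_def)
    next
      case False
      then have "rel_ord 2 (omega \<phi>) z = 0" using z rel_ord_nonneg[OF omega_forms omega_nonzero zu]
        by (simp add: omega_zeros_def)
      then show ?thesis unfolding e using rel_ord_nonneg[OF f zu] by simp
    qed
  qed
  ultimately obtain h where h: "h \<in> forms (int j - int n * 2)" "f = omega \<phi> ^ n * h"
    using forms_divide[OF f(1), of "omega \<phi> ^ n" "int n * 2"] by metis
  then have "h \<noteq> 0" using f(2) by auto
  then have "\<not> int j - int n * 2 < 0" using forms_negative h(1) by blast
  then show ?thesis by (simp add: n_def)
qed

lemma level_exists:
  assumes f: "f \<in> forms (int j)" "f \<noteq> 0" and ab: "above (int j) f b0"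
  obtains b where "b \<ge> b0" "level (int j) f b"
proof -
  let ?B = "(j + 1) * num_zeros"
  have "\<not> above (int j) f (b0 + ?B)"
  proof
    assume "above (int j) f (b0 + ?B)"
    from above_bound[OF f this] have "2 * ((b0 + ?B) div num_zeros) \<le> j" .
    moreover have "j + 1 \<le> (b0 + ?B) div num_zeros"
      by (subst less_eq_div_iff_mult_less_eq) (use num_zeros_pos in auto)
    ultimately show False by simp
  qed
  then have "\<exists>n. \<not> above (int j) f (b0 + n)" by blast
  define n where "n = (LEAST n. \<not> above (int j) f (b0 + n))"
  have n: "\<not> above (int j) f (b0 + n)" unfolding n_def using \<open>\<exists>n. _\<close> by (rule LeastI_ex)
  then have "n \<noteq> 0" using ab by (metis add_0_right)
  then obtain k where k: "n = Suc k" by (cases n) auto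
  have abk: "above (int j) f (b0 + k)" using not_less_Least[of k "\<lambda>n. \<not> above (int j) f (b0 + n)"] k
    by (simp add: n_def)
  obtain z where z: "z \<in> omega_zeros" "rel_ord (int j) f z < divisor (Suc (b0 + k)) z" using n k
    by (auto simp: above_def not_le)
  moreover have "divisor (b0 + k) z \<le> rel_ord (int j) f z" using abk z by (simp add: above_def)
  ultimately have "zero_at (b0 + k) = z" "rel_ord (int j) f z = divisor (b0 + k) z"
    using divisor_Suc[OF z(1), of "b0 + k"] by (auto split: if_splits)
  then show ?thesis using that[of "b0 + k"] abk f(2) by (simp add: level_def)
qed

lemma level_omega_mult:
  assumes "level j f b" "f \<in> forms j" shows "level (j + 2) (omega \<phi> * f) (b + num_zeros)"
proof -
  have f: "f \<noteq> 0" using assms by (simp add: level_def)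
  have r: "rel_ord (j + 2) (omega \<phi> * f) z = rel_ord j f z + rel_ord 2 (omega \<phi>) z" if "z \<in> omega_zeros"
      for z
    using rel_ord_mult[OF zeros_uhp[OF that] omega_nonzero f, of 2 j] by (simp add: algebra_simps)
  have d: "divisor (b + num_zeros) z = divisor b z + rel_ord 2 (omega \<phi>) z" for z
    using divisor_add[of b 1 z] by simp
  have "zero_at (b + num_zeros) = zero_at b" by (simp add: zero_at_def)
  moreover have "omega \<phi> * f \<noteq> 0" using f omega_nonzero mero_no_zero_divisors by blast
  ultimately show ?thesis using assms(1) zero_at_in r by (simp add: level_def above_def d)
qed

lemma level_mult_nonvanishing:
  assumes "level j f b" "\<forall>z\<in>omega_zeros. G \<noteq> 0 \<and> rel_ord w G z = 0" shows "level (j + w) (G * f) b"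
proof -
  have f: "f \<noteq> 0" using assms by (simp add: level_def)
  have G: "G \<noteq> 0" using assms(2) zero_at_in by blast
  have r: "rel_ord (j + w) (G * f) z = rel_ord j f z" if "z \<in> omega_zeros" for z
    using rel_ord_mult[OF zeros_uhp[OF that] G f, of w j] assms(2) that by (simp add: algebra_simps)
  have "G * f \<noteq> 0" using f G mero_no_zero_divisors by blast
  then show ?thesis using assms(1) zero_at_in r by (simp add: level_def above_def)
qed

text \<open>
  At \<open>zero_at b\<close> both forms have the same order, so their leading coefficients there can be
  cancelled.
\<close>

lemma level_eliminate:
  assumes f: "f \<in> forms j" "level j f b" and g: "g \<in> forms j" "level j g b"
  obtains c where "f - mero_const c * g = 0 \<or> above j (f - mero_const c * g) (Suc b)"
proof -
  let ?z = "zero_at b"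
  have z: "?z \<in> omega_zeros" "?z \<in> uhp" using zero_at_in zeros_uhp by blast+
  have nz: "f \<noteq> 0" "g \<noteq> 0" using f g by (auto simp: level_def)
  have o: "ord f ?z = divisor b ?z" "ord g ?z = divisor b ?z"
    using f(2) g(2) pole_order_zeros[OF z(1)] by (simp_all add: level_def rel_ord_def)
  obtain c where c: "ord_ge (f - mero_const c * g) ?z (ord f ?z + 1)"
    using cancel_leading_coefficient[OF z(2) nz] o by auto
  let ?h = "f - mero_const c * g"
  show ?thesis
  proof (rule that[of c], cases "?h = 0")
    case False
    have "divisor (Suc b) y \<le> rel_ord j ?h y" if y: "y \<in> omega_zeros" for y
    proof -
      have yu: "y \<in> uhp" by (rule zeros_uhp[OF y])
      have "ord_ge f y (divisor b y)" "ord_ge g y (divisor b y)"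
        using f(2) g(2) y yu nz pole_order_zeros[OF y]
          by (auto simp: level_def above_def rel_ord_def ord_ge_iff)
      then have "ord_ge ?h y (divisor b y)" by (intro ord_ge_diff ord_ge_cmult yu)
      moreover have "ord_ge ?h y (divisor b y + 1)" if "zero_at b = y" using c o that by simp
      ultimately show ?thesis
        using False yu pole_order_zeros[OF y] divisor_Suc[OF y, of b]
          by (auto simp: ord_ge_iff rel_ord_def)
    qed
    then show "?h = 0 \<or> above j ?h (Suc b)" by (simp add: above_def)
  qed simp
qed

text \<open>
  Subtracting elements of \<open>P\<close> raises the level of an element of \<open>P'\<close> until it exceeds the bound.
\<close>

lemma subspace_eq_of_levels:
  assumes P: "P \<subseteq> P'" "P' \<subseteq> forms (int j)"
    and sub: "\<And>f g c. f \<in> P \<Longrightarrow> g \<in> P \<Longrightarrow> f + mero_const c * g \<in> P"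
    and sub': "\<And>f g c. f \<in> P' \<Longrightarrow> g \<in> P' \<Longrightarrow> f + mero_const c * g \<in> P'" and "0 \<in> P"
    and lev: "\<And>f b. f \<in> P' \<Longrightarrow> level (int j) f b \<Longrightarrow> \<exists>g\<in>P. level (int j) g b"
  shows "P' \<subseteq> P"
proof -
  have key: "f \<in> P" if "f \<in> P'" "f \<noteq> 0" "above (int j) f b" "(j + 1) * num_zeros \<le> b + m" for f b m
    using that
  proof (induction m arbitrary: f b)
    case 0
    have "2 * (b div num_zeros) \<le> j" using above_bound[of f j b] 0 P by auto
    moreover have "j + 1 \<le> b div num_zeros" using 0 num_zeros_pos
      by (simp add: less_eq_div_iff_mult_less_eq)
    ultimately show ?case by simp
  next
    case (Suc m)
    have fj: "f \<in> forms (int j)" using Suc P by auto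
    obtain b' where b': "b' \<ge> b" "level (int j) f b'" using level_exists[OF fj] Suc.prems by blast
    obtain g where g: "g \<in> P" "level (int j) g b'" using lev[OF Suc.prems(1) b'(2)] by blast
    obtain c where c: "f - mero_const c * g = 0 \<or> above (int j) (f - mero_const c * g) (Suc b')"
      using level_eliminate[OF fj b'(2) _ g(2)] g(1) P by blast
    have eq: "f - mero_const c * g = f + mero_const (- c) * g"
      using mero_const_diff[of 0 c] by (simp add: mero_const_0)
    have "f - mero_const c * g \<in> P"
    proof (cases "f - mero_const c * g = 0")
      case False
      show ?thesis
      proof (rule Suc.IH)
        show "f - mero_const c * g \<in> P'" unfolding eq using Suc.prems g P by (intro sub') auto
        show "above (int j) (f - mero_const c * g) (Suc b')" using c False by blast
        show "(j + 1) * num_zeros \<le> Suc b' + m" using Suc.prems b' by simp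
      qed (rule False)
    qed (use \<open>0 \<in> P\<close> in simp)
    then show ?case using sub[OF _ g(1), of "f - mero_const c * g" c] by simp
  qed
  show ?thesis
  proof
    fix f assume f: "f \<in> P'"
    show "f \<in> P"
    proof (cases "f = 0")
      case False
      have "above (int j) f 0" using rel_ord_nonneg[of f "int j"] f False P zeros_uhp
        by (auto simp: above_def divisor_0)
      then show ?thesis using key[OF f False, of 0 "(j + 1) * num_zeros"] by simp
    qed (use \<open>0 \<in> P\<close> in simp)
  qed
qed

text \<open>
  If no two consecutive members agree, choose for each \<open>n\<close> a pair of weight and level that is new
  in step \<open>n\<close>. Modulo the two shifts by \<open>(2, num_zeros)\<close> and \<open>(w, 0)\<close>, which preserve each set of
  pairs, the pairs are described by finitely many residues and two natural numbers. By Dickson's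
  lemma a later pair arises by shifts from an earlier one, so it was not new.
\<close>

lemma chain_stabilises:
  fixes P :: "nat \<Rightarrow> nat \<Rightarrow> mero_uhp set" and w :: nat
  assumes mono: "\<And>n j. P n j \<subseteq> P (Suc n) j" and forms: "\<And>n j. P n j \<subseteq> forms (int j)"
    and lin: "\<And>n j f g c. f \<in> P n j \<Longrightarrow> g \<in> P n j \<Longrightarrow> f + mero_const c * g \<in> P n j" and zero:
        "\<And>n j. 0 \<in> P n j"
    and om: "\<And>n j f. f \<in> P n j \<Longrightarrow> omega \<phi> * f \<in> P n (j + 2)"
    and G: "\<And>n j f. f \<in> P n j \<Longrightarrow> G * f \<in> P n (j + w)" "\<forall>z\<in>omega_zeros. G \<noteq> 0 \<and> rel_ord (int w) G z = 0"
        "w > 0"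
  shows "\<exists>n. \<forall>j. P (Suc n) j = P n j"
proof -
  define T where "T = (\<lambda>n. {(j, b). \<exists>f\<in>P n j. level (int j) f b})"
  have Tmono: "T m \<subseteq> T n" if "m \<le> n" for m n
    using lift_Suc_mono_le[of T, OF _ that] mono by (fastforce simp: T_def)
  have Tom: "(j + 2, b + num_zeros) \<in> T n" if T: "(j, b) \<in> T n" for j b n
  proof -
    obtain f where f: "f \<in> P n j" "level (int j) f b" using T unfolding T_def by blast
    have fj: "f \<in> forms (int j)" using f(1) forms by blast
    have e: "int (j + 2) = int j + 2" by simp
    have "level (int (j + 2)) (omega \<phi> * f) (b + num_zeros)"
      unfolding e by (rule level_omega_mult[OF f(2) fj])
    then show ?thesis using om[OF f(1)] unfolding T_def by blast
  qed
  have Tom': "(j + i * 2, b + i * num_zeros) \<in> T n" if "(j, b) \<in> T n" for i j b n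
  proof (induction i)
    case (Suc i)
    then show ?case using Tom[OF Suc] by (simp add: algebra_simps)
  qed (use that in simp)
  have TG: "(j + w, b) \<in> T n" if "(j, b) \<in> T n" for j b n
    using that G(1) level_mult_nonvanishing[OF _ G(2)] by (fastforce simp: T_def)
  have TG': "(j + i * w, b) \<in> T n" if "(j, b) \<in> T n" for i j b n
  proof (induction i)
    case (Suc i)
    then show ?case using TG[OF Suc] by (simp add: algebra_simps)
  qed (use that in simp)
  have bound: "2 * (b div num_zeros) \<le> j" if "(j, b) \<in> T n" for j b n
    using that forms above_bound by (fastforce simp: T_def level_def)
  have "\<exists>n. T (Suc n) \<subseteq> T n"
  proof (rule ccontr)
    assume "\<not> ?thesis"
    then have "\<forall>n. \<exists>x. x \<in> T (Suc n) - T n" by blast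
    then obtain x where x: "\<And>n. x n \<in> T (Suc n) - T n" by metis
    define J where "J = (\<lambda>n. fst (x n))"
    define B where "B = (\<lambda>n. snd (x n))"
    have xJB: "x n = (J n, B n)" for n by (simp add: J_def B_def)
    define p where "p = (\<lambda>n. B n div num_zeros)"
    define k where "k = (\<lambda>n. J n - 2 * p n)"
    have Jk: "J n = k n + 2 * p n" for n using bound[of "J n" "B n" "Suc n"] x[of n]
      by (simp add: k_def p_def xJB)
    define c where "c = (\<lambda>n. (B n mod num_zeros, k n mod w))"
    have "range c \<subseteq> {..<num_zeros} \<times> {..<w}" using num_zeros_pos G(3) by (auto simp: c_def)
    then have "finite (range c)" by (rule finite_subset) auto
    then obtain i i' where ii: "i < i'" "c i = c i'" "p i \<le> p i'" "k i div w \<le> k i' div w"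
      by (rule dickson_pair[where x=p and y="\<lambda>n. k n div w"])
    have "x i \<in> T i'" using x[of i] Tmono[of "Suc i" i'] ii(1) by auto
    then have
        "(J i + (p i' - p i) * 2 + (k i' div w - k i div w) * w, B i + (p i' - p i) * num_zeros) \<in> T i'"
      unfolding xJB by (intro TG' Tom')
    moreover have "B i + (p i' - p i) * num_zeros = B i'"
    proof -
      have "B i = p i * num_zeros + B i mod num_zeros" "B i' = p i' * num_zeros + B i' mod num_zeros"
        by (simp_all only: p_def div_mult_mod_eq)
      moreover have "B i mod num_zeros = B i' mod num_zeros" using ii(2) by (simp add: c_def)
      moreover have "p i * num_zeros + (p i' - p i) * num_zeros = p i' * num_zeros" using ii(3)
        by (simp flip: add_mult_distrib)
      ultimately show ?thesis by linarith
    qed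
    moreover have "J i + (p i' - p i) * 2 + (k i' div w - k i div w) * w = J i'"
    proof -
      have "k i = k i div w * w + k i mod w" "k i' = k i' div w * w + k i' mod w" by simp_all
      moreover have "k i mod w = k i' mod w" using ii(2) by (simp add: c_def)
      moreover have "k i div w * w + (k i' div w - k i div w) * w = k i' div w * w" using ii(4)
        by (simp flip: add_mult_distrib)
      ultimately have "k i' = k i + (k i' div w - k i div w) * w" by linarith
      then show ?thesis using Jk[of i] Jk[of i'] ii(3) by linarith
    qed
    ultimately show False using x[of i'] by (simp add: xJB)
  qed
  then obtain n where n: "T (Suc n) \<subseteq> T n" by blast
  have "P (Suc n) j \<subseteq> P n j" for j
  proof (rule subspace_eq_of_levels[OF mono forms])
    fix f b assume "f \<in> P (Suc n) j" "level (int j) f b"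
    then have "(j, b) \<in> T (Suc n)" by (auto simp: T_def)
    then show "\<exists>g\<in>P n j. level (int j) g b" using n by (auto simp: T_def)
  qed (use lin zero in auto)
  then show ?thesis using mono by blast
qed

section \<open>Stable subalgebras\<close>

definition graded_forms :: "graded set" where
  "graded_forms = {F. \<forall>k. Poly_Mapping.lookup F k \<in> (if even k then forms (k div 2) else {0})}"

lemma graded_forms_single: "f \<in> forms j \<Longrightarrow> Poly_Mapping.single (2 * j) f \<in> graded_forms"
  by (auto simp: graded_forms_def lookup_single when_def forms_0)

lemma graded_forms_add: "F \<in> graded_forms \<Longrightarrow> H \<in> graded_forms \<Longrightarrow> F + H \<in> graded_forms"
proof -
  assume F: "F \<in> graded_forms" and H: "H \<in> graded_forms"
  have "Poly_Mapping.lookup F k + Poly_Mapping.lookup H k \<in> (if even k then forms (k div 2) else {0})"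
      for k
    using F[unfolded graded_forms_def mem_Collect_eq, rule_format, of k]
      H[unfolded graded_forms_def mem_Collect_eq, rule_format, of k]
    by (cases "even k") (auto intro: forms_add)
  then show ?thesis by (simp add: graded_forms_def lookup_add)
qed

lemma graded_forms_sum: "(\<And>i. i \<in> I \<Longrightarrow> F i \<in> graded_forms) \<Longrightarrow> (\<Sum>i\<in>I. F i) \<in> graded_forms"
proof (induction I rule: infinite_finite_induct)
  case (insert x I)
  then show ?case by (simp add: graded_forms_add)
qed (use graded_forms_single[OF forms_0, of 0] in simp_all)

lemma graded_eq_sum:
    "(F :: graded) = (\<Sum>k\<in>Poly_Mapping.keys F. Poly_Mapping.single k (Poly_Mapping.lookup F k))"
proof (rule poly_mapping_eqI)
  fix l
  have "(\<Sum>k\<in>Poly_Mapping.keys F. if k = l then Poly_Mapping.lookup F k else 0)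
      = Poly_Mapping.lookup F l"
    by (simp add: in_keys_iff)
  then show
      "Poly_Mapping.lookup F l = Poly_Mapping.lookup (\<Sum>k\<in>Poly_Mapping.keys F. Poly_Mapping.single k
          (Poly_Mapping.lookup F k)) l"
    by (simp add: lookup_sum lookup_single when_def)
qed

lemma graded_forms_mult:
  assumes F: "F \<in> graded_forms" and H: "H \<in> graded_forms" shows "F * H \<in> graded_forms"
proof -
  have "F * H = (\<Sum>k\<in>Poly_Mapping.keys F. \<Sum>l\<in>Poly_Mapping.keys H.
      Poly_Mapping.single k (Poly_Mapping.lookup F k) * Poly_Mapping.single l
          (Poly_Mapping.lookup H l))"
    by (subst graded_eq_sum[of F], subst graded_eq_sum[of H]) (rule sum_product)
  also have "\<dots> \<in> graded_forms"
  proof (intro graded_forms_sum)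
    fix k l assume k: "k \<in> Poly_Mapping.keys F" "l \<in> Poly_Mapping.keys H"
    then have "Poly_Mapping.lookup F k \<noteq> 0" "Poly_Mapping.lookup H l \<noteq> 0" by (auto simp: in_keys_iff)
    then have e: "even k" "even l" "Poly_Mapping.lookup F k \<in> forms (k div 2)"
        "Poly_Mapping.lookup H l \<in> forms (l div 2)"
      using F H by (auto simp: graded_forms_def split: if_splits)
    have "2 * (k div 2 + l div 2) = k + l" using e(1,2) by (auto elim!: evenE)
    then show
        "Poly_Mapping.single k (Poly_Mapping.lookup F k) * Poly_Mapping.single l (Poly_Mapping.lookup H
            l) \<in> graded_forms"
      using graded_forms_single[OF forms_mult[OF e(3,4)]] by (simp add: mult_single)
  qed
  finally show ?thesis .
qed

lemma generated_algebra_forms: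
  assumes "S \<subseteq> graded_forms" shows "component (generated_algebra S) j \<subseteq> forms j"
proof
  have gen: "F \<in> graded_forms" if "F \<in> generated_algebra S" for F
    using that
  proof induction
    case (const c)
    then show ?case using graded_forms_single[OF forms_const[of c]] by (simp add: graded_const_def)
  qed (use assms in \<open>auto intro: graded_forms_add graded_forms_mult\<close>)
  fix f assume "f \<in> component (generated_algebra S) j"
  then have "Poly_Mapping.single (2 * j) f \<in> graded_forms" using gen by (simp add: component_def)
  then show "f \<in> forms j" unfolding graded_forms_def by (auto dest!: spec[of _ "2 * j"])
qed

end

text \<open>
  The components of \<open>R N\<close>, for \<open>N\<close> large enough that \<open>R N\<close> contains the nonvanishing form, are a
  chain as in \<open>chain_stabilises\<close>.
\<close>

theorem theorem10:
  fixes \<Gamma> :: "(real^2^2) set set" and \<phi> :: mero_uhp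
    and d :: nat and f :: "nat \<Rightarrow> graded"
  assumes "discrete_subgroup \<Gamma>" and "cocompact \<Gamma>"
    and "\<phi> \<in> quasimodular_weight2_delta1 \<Gamma>"
    and "\<forall>i\<in>{1..d}. homogeneous (f i)"
    and "basis_modulo (positive_weight_ideal \<Gamma>) (ideal_square (positive_weight_ideal \<Gamma>)) d f"
  shows "\<exists>N\<ge>1.
    let R = generated_algebra
      ({(D \<phi> ^^ j) (f i) | i j. i \<in> {1..d} \<and> j \<le> N} \<union>
       {(D \<phi> ^^ l) (Poly_Mapping.single 4 (omega \<phi>)) | l. l \<le> N})
    in \<forall>F\<in>R. D \<phi> F \<in> R"
proof -
  interpret quasimodular_setting \<Gamma> \<phi> by unfold_locales fact+
  define S where "S = (\<lambda>N. {(D \<phi> ^^ j) (f i) | i j. i \<in> {1..d} \<and> j \<le> N} \<union>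
       {(D \<phi> ^^ l) (Poly_Mapping.single 4 (omega \<phi>)) | l. l \<le> N})"
  have gen: "\<exists>g e. f i = Poly_Mapping.single (2 * int e) g \<and> g \<in> forms (int e)" if i: "i \<in> {1..d}" for i
  proof -
    obtain k g where kg: "f i = Poly_Mapping.single k g" using bspec[OF assms(4) i]
      unfolding homogeneous_def by blast
    show ?thesis
    proof (cases "g = 0")
      case True
      then show ?thesis using kg forms_0[of 0] by (intro exI[of _ 0] exI[of _ "0::nat"]) simp
    next
      case False
      have "f i \<in> positive_weight_ideal \<Gamma>" using assms(5) i by (simp add: basis_modulo_def)
      then have "Poly_Mapping.lookup (f i) k \<in> (if k > 0 then modular_forms \<Gamma> k else {0})"
        unfolding positive_weight_ideal_def by blast
      then have k: "k > 0" "g \<in> modular_forms \<Gamma> k" using False kg by (auto split: if_splits)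
      have "even k" using has_weight_odd[OF subgroup_Gamma modular_forms_has_weight[OF k(2)]] False
        by blast
      then have e: "k = 2 * int (nat (k div 2))" using k(1) by auto
      have "g \<in> forms (int (nat (k div 2)))"
        by (rule modular_forms_subset_forms) (use k(2) e in auto)
      then show ?thesis using kg e by metis
    qed
  qed
  have hom: "\<exists>j h. F = Poly_Mapping.single (2 * int j) h \<and> h \<in> forms (int j)" if F: "F \<in> S N" for F N
  proof -
    consider i j where "i \<in> {1..d}" "F = (D \<phi> ^^ j) (f i)" | l
        where "F = (D \<phi> ^^ l) (Poly_Mapping.single 4 (omega \<phi>))"
      using F by (auto simp: S_def)
    then show ?thesis
    proof cases
      case 1
      obtain g e where ge: "f i = Poly_Mapping.single (2 * int e) g" "g \<in> forms (int e)"
        using gen[OF 1(1)] by blast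
      obtain h where "h \<in> forms (int e + int j)" "F = Poly_Mapping.single (2 * (int e + int j)) h"
        using D_power_single_forms[OF ge(2), of j] 1(2) ge(1) by auto
      then show ?thesis by (intro exI[of _ "e + j"] exI[of _ h]) simp
    next
      case 2
      then show ?thesis using D_power_omega[of l] omega_iter_forms[of l]
        by (intro exI[of _ "2 + l"] exI[of _ "omega_iter l"]) simp
    qed
  qed
  have S_forms: "S N \<subseteq> graded_forms" for N using hom graded_forms_single by blast
  have S_mono: "S N \<subseteq> S N'" if "N \<le> N'" for N N' unfolding S_def using that by fastforce
  have comp_mono: "component (generated_algebra (S N)) j \<subseteq> component (generated_algebra (S N')) j"
      if "N \<le> N'" for N N' j
  proof -
    have "generated_algebra (S N) \<subseteq> generated_algebra (S N')"
      by (rule generated_algebra_mono) (use S_mono[OF that] in \<open>auto intro: generated_algebra.incl\<close>)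
    then show ?thesis by (auto simp: component_def)
  qed
  define M where "M = num_zeros + 1"
  have om: "omega_iter l \<in> component (generated_algebra (S N)) (2 + int l)" if "l \<le> N" for l N
    using that D_power_omega[of l] by (auto simp: component_def S_def intro!: generated_algebra.incl)
  define W where "W = (\<Prod>l\<le>num_zeros. 2 + l)"
  obtain G where G: "G \<in> component (generated_algebra (S M)) (int W)"
      "\<forall>z\<in>omega_zeros. G \<noteq> 0 \<and> rel_ord (int W) G z = 0"
    using exists_nonvanishing_form[of "S M"] om[of _ M] unfolding W_def M_def by auto
  define P where "P = (\<lambda>n j. component (generated_algebra (S (n + M))) (int j))"
  have "\<exists>n. \<forall>j. P (Suc n) j = P n j"
  proof (rule chain_stabilises[where G=G and w=W])
    show "P n j \<subseteq> P (Suc n) j" for n j unfolding P_def by (rule comp_mono) simp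
    show "P n j \<subseteq> forms (int j)" for n j unfolding P_def by (rule generated_algebra_forms[OF S_forms])
    show "g + mero_const c * h \<in> P n j" if "g \<in> P n j" "h \<in> P n j" for n j g h c
      using that unfolding P_def by (intro component_add component_cmult)
    show "0 \<in> P n j" for n j by (simp add: P_def component_def generated_algebra_0)
    show "omega \<phi> * g \<in> P n (j + 2)" if "g \<in> P n j" for n j g
      using component_mult[OF om[of 0 "n + M"], of g "int j"] that unfolding P_def
        by (simp add: algebra_simps)
    show "G * g \<in> P n (j + W)" if "g \<in> P n j" for n j g
      using component_mult[of G "S (n + M)" "int W" g "int j"] subsetD[OF comp_mono[of M "n + M"] G(1)]
        that
      unfolding P_def by (simp add: algebra_simps)
    show "\<forall>z\<in>omega_zeros. G \<noteq> 0 \<and> rel_ord (int W) G z = 0" by (rule G(2))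
    show "W > 0" unfolding W_def by (rule prod_pos) simp
  qed
  then obtain n where n: "\<And>j. P (Suc n) j = P n j" by blast
  define N where "N = n + M"
  have up: "S (Suc N) \<subseteq> generated_algebra (S N)"
  proof
    fix F assume F: "F \<in> S (Suc N)"
    then obtain j h where F': "F = Poly_Mapping.single (2 * int j) h" using hom by blast
    have "h \<in> P (Suc n) j" using F F'
      by (auto simp: P_def component_def N_def intro: generated_algebra.incl)
    then show "F \<in> generated_algebra (S N)" unfolding n F' by (simp add: P_def component_def N_def)
  qed
  have "D \<phi> F \<in> generated_algebra (S N)" if F: "F \<in> S N" for F
  proof -
    have "D \<phi> F \<in> S (Suc N)"
    proof -
      consider i j where "i \<in> {1..d}" "j \<le> N" "F = (D \<phi> ^^ j) (f i)"
        | l where "l \<le> N" "F = (D \<phi> ^^ l) (Poly_Mapping.single 4 (omega \<phi>))"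
        using F by (auto simp: S_def)
      then show ?thesis
      proof cases
        case 1
        then have "D \<phi> F = (D \<phi> ^^ Suc j) (f i)" "Suc j \<le> Suc N" by simp_all
        then show ?thesis unfolding S_def using 1(1) by blast
      next
        case 2
        then have "D \<phi> F = (D \<phi> ^^ Suc l) (Poly_Mapping.single 4 (omega \<phi>))" "Suc l \<le> Suc N" by simp_all
        then show ?thesis unfolding S_def by blast
      qed
    qed
    then show ?thesis using up by blast
  qed
  then have "\<forall>F\<in>generated_algebra (S N). D \<phi> F \<in> generated_algebra (S N)"
    using generated_algebra_D_closed by blast
  moreover have "N \<ge> 1" by (simp add: N_def M_def)
  ultimately show ?thesis unfolding S_def Let_def by blast
qed

end
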